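(* Let $\mathbf y_1\neq\mathbf y_2$ be two points of $\mathbb R^3$, let $m_1,m_2>0$, and let $$\widetilde\gamma_{ij}=\delta_{ij}-\frac{8G^2m_1m_2}{c^4}\,\frac{\partial^2 g}{\partial y_1^{<i}\,\partial y_2^{j>}},\qquad g(\mathbf x;\mathbf y_1,\mathbf y_2)=\ln(r_1+r_2+r_{12}).$$ Let $\gamma_{ij}=\Psi^4\widetilde\gamma_{ij}$, where $\Psi$ is the perturbative solution (specified in the context) of the time-symmetric vacuum constraint equation $\widetilde\Delta\Psi=\frac18\widetilde R\,\Psi$. Then, in the post-Newtonian expansion $c\to+\infty$, $\gamma_{ij}$ differs from the standard 2PN spatial metric in harmonic coordinates, taken at zero velocities, by a mere (infinitesimal) change of coordinates at the 2PN order: there is a vector field $\xi_i(\mathbf x)$, of order $1/c^4$, defined for $\mathbf x\in\mathbb R^3\setminus\{\mathbf y_1,\mathbf y_2\}$, such that $$\gamma_{ij}=\mathrm g^{\rm 2PN}_{ij}\Big|_{\mathbf v_1=\mathbf v_2=\mathbf 0}+\partial_i\xi_j+\partial_j\xi_i+\mathcal O\!\left(\frac1{c^6}\right),$$ where $\mathrm g^{\rm 2PN}_{ij}|_{\mathbf v_1=\mathbf v_2=\mathbf 0}$ is the explicit metric written in the context.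
   Context: Notation. $G$ is the gravitational constant, $c$ the speed of light. $\mathbf x\in\mathbb R^3$ is the field point, $r_1=|\mathbf x-\mathbf y_1|$, $r_2=|\mathbf x-\mathbf y_2|$, $r_{12}=|\mathbf y_1-\mathbf y_2|$, $n_1^i=(x^i-y_1^i)/r_1$, $n_2^i=(x^i-y_2^i)/r_2$, $n_{12}^i=(y_1^i-y_2^i)/r_{12}$, $\partial_i=\partial/\partial x^i$. Angle brackets on indices denote the symmetric trace-free part, $T_{<ij>}=\frac12(T_{ij}+T_{ji})-\frac13\delta_{ij}T_{kk}$; round brackets denote symmetrization, $T_{(ij)}=\frac12(T_{ij}+T_{ji})$. $\widetilde\Delta$ and $\widetilde R$ are the Laplacian and the scalar curvature of $\widetilde\gamma_{ij}$; $\Delta=\partial_i\partial_i$ is the flat Laplacian. The equation $\widetilde\Delta\Psi=\frac18\widetilde R\Psi$ is equivalent to vanishing of the scalar curvature of $\gamma_{ij}=\Psi^4\widetilde\gamma_{ij}$. The $n$PN order refers to terms of order $c^{-2n}$; all expansions when $c\to+\infty$ are formal expansions at fixed $\mathbf x\ne\mathbf y_1,\mathbf y_2$ and fixed $\mathbf y_1,\mathbf y_2,m_1,m_2$. The solution $\Psi$. Write $\widetilde\gamma_{ij}=\delta_{ij}+\beta s_{ij}$ with $\beta=-8G^2m_1m_2/c^4$ and $s_{ij}=\partial^2g/\partial y_1^{<i}\partial y_2^{j>}$. The solution is $\Psi=\psi+\sum_{n\ge1}\beta^n\sigma_{(n)}$ (formal power series in $\beta$), where $\psi=1+\alpha_1/r_1+\alpha_2/r_2$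 is the Brill–Lindquist conformal factor with constants $\alpha_1,\alpha_2$. Inserting this in the constraint equation, with $s_{ij},\alpha_1,\alpha_2$ treated as independent of $\beta$, and identifying powers of $\beta$ gives a hierarchy $\Delta\sigma_{(n)}=\Sigma_{(n)}[\sigma_{(1)},\dots,\sigma_{(n-1)}]$, starting with $\Delta\sigma_{(1)}=\frac18\psi\,\partial_{ij}s_{ij}+\partial_js_{ij}\,\partial_i\psi+s_{ij}\,\partial_{ij}\psi$; each $\sigma_{(n)}$ is the solution of its equation in the sense of distributions on $\mathbb R^3$ (including the points $\mathbf y_1,\mathbf y_2$) that tends to zero at spatial infinity. The constants are $$\alpha_1=\frac{Gm_1}{2c^2}\left[1-\frac{Gm_2}{2r_{12}c^2}+\mathcal O\!\left(\frac1{c^4}\right)\right],\qquad \alpha_2=\frac{Gm_2}{2c^2}\left[1-\frac{Gm_1}{2r_{12}c^2}+\mathcal O\!\left(\frac1{c^4}\right)\right].$$ The standard 2PN spatial metric of two point particles of masses $m_1,m_2$ in harmonic coordinates, at zero velocities (with $S=r_1+r_2+r_{12}$): $$\mathrm g^{\rm 2PN}_{ij}\Big|_{\mathbf v_1=\mathbf v_2=\mathbf 0}=\delta_{ij}\Big[1+\frac{2Gm_1}{c^2r_1}+\frac{2Gm_2}{c^2r_2}\Big]+\frac{G^2}{c^4}\Big(\frac{m_1^2}{r_1^2}(\delta_{ij}+n_1^in_1^j)+\frac{m_2^2}{r_2^2}(\delta_{ij}+n_2^in_2^j)\Big)$$ $$+\frac{G^2m_1m_2}{c^4}\delta_{ij}\Big[\frac4{r_1r_2}-\frac{r_1+r_2}{2r_{12}^3}+\frac1{2r_{12}^3}\Big(\frac{r_1^2}{r_2}+\frac{r_2^2}{r_1}\Big)-\frac5{2r_{12}}\Big(\frac1{r_1}+\frac1{r_2}\Big)+\frac8{r_{12}S}\Big]$$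 $$-\frac{8G^2m_1m_2}{c^4}n_{12}^in_{12}^j\Big(\frac1{S^2}+\frac1{r_{12}S}\Big)+\frac{8G^2m_1m_2}{c^4S^2}\Big(n_1^{(i}n_2^{j)}+n_1^{(i}n_{12}^{j)}-n_2^{(i}n_{12}^{j)}\Big).$$ *)

theory Defs
  imports
    "HOL-Analysis.Analysis"
    "HOL-Computational_Algebra.Formal_Power_Series"
    "HOL-Library.Landau_Symbols"
begin

type_synonym point = "real ^ 3"

definition pd :: "3 \<Rightarrow> (point \<Rightarrow> real) \<Rightarrow> point \<Rightarrow> real" where
  "pd i f x = deriv (\<lambda>t. f (x + t *\<^sub>R axis i 1)) 0"

definition laplacian :: "(point \<Rightarrow> real) \<Rightarrow> point \<Rightarrow> real" where
  "laplacian f x = (\<Sum>i\<in>UNIV. pd i (pd i f) x)"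

text \<open>Only meant for open \<open>S\<close>.\<close>

fun Ck_on :: "nat \<Rightarrow> point set \<Rightarrow> (point \<Rightarrow> real) \<Rightarrow> bool" where
  "Ck_on 0 S f \<longleftrightarrow> continuous_on S f"
| "Ck_on (Suc k) S f \<longleftrightarrow> f differentiable_on S \<and> (\<forall>i. Ck_on k S (pd i f))"

definition smooth_on :: "point set \<Rightarrow> (point \<Rightarrow> real) \<Rightarrow> bool" where
  "smooth_on S f \<longleftrightarrow> (\<forall>k. Ck_on k S f)"

definition test_function :: "(point \<Rightarrow> real) \<Rightarrow> bool" where
  "test_function \<phi> \<longleftrightarrow> smooth_on UNIV \<phi> \<and> bounded {x. \<phi> x \<noteq> 0}"

text \<open>
  A field that depends formally on the parameter \<open>\<beta>\<close> has values in \<^typ>\<open>real fps\<close>, the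
  indeterminate \<^const>\<open>fps_X\<close> playing the role of \<open>\<beta>\<close>; it is differentiated coefficientwise.
\<close>

definition fpd :: "3 \<Rightarrow> (point \<Rightarrow> real fps) \<Rightarrow> point \<Rightarrow> real fps" where
  "fpd i F x = Abs_fps (\<lambda>n. pd i (\<lambda>z. fps_nth (F z) n) x)"

type_synonym fmetric = "point \<Rightarrow> real fps ^ 3 ^ 3"

definition christoffel :: "fmetric \<Rightarrow> 3 \<Rightarrow> 3 \<Rightarrow> 3 \<Rightarrow> point \<Rightarrow> real fps" where
  \<comment> \<open>the first index is the upper one\<close>
  "christoffel h k i j x = fps_const (1/2) *
     (\<Sum>l\<in>UNIV. matrix_inv (h x) $ k $ l *
        (fpd i (\<lambda>z. h z $ l $ j) x + fpd j (\<lambda>z. h z $ l $ i) x - fpd l (\<lambda>z. h z $ i $ j) x))"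

definition ricci :: "fmetric \<Rightarrow> 3 \<Rightarrow> 3 \<Rightarrow> point \<Rightarrow> real fps" where
  "ricci h i j x =
     (\<Sum>k\<in>UNIV. fpd k (christoffel h k i j) x - fpd j (christoffel h k i k) x)
     + (\<Sum>k\<in>UNIV. \<Sum>l\<in>UNIV. christoffel h k k l x * christoffel h l i j x
                          - christoffel h k j l x * christoffel h l i k x)"

definition scalar_curvature :: "fmetric \<Rightarrow> point \<Rightarrow> real fps" where
  "scalar_curvature h x = (\<Sum>i\<in>UNIV. \<Sum>j\<in>UNIV. matrix_inv (h x) $ i $ j * ricci h i j x)"

definition metric_laplacian :: "fmetric \<Rightarrow> (point \<Rightarrow> real fps) \<Rightarrow> point \<Rightarrow> real fps" where
  "metric_laplacian h F x =
     (\<Sum>i\<in>UNIV. \<Sum>j\<in>UNIV. matrix_inv (h x) $ i $ j *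
        (fpd i (fpd j F) x - (\<Sum>k\<in>UNIV. christoffel h k i j x * fpd k F x)))"

text \<open>
  Hadamard's finite part \<open>I\<close> of the integral of a function that may be singular at \<open>y1\<close> and
  \<open>y2\<close>: the integral outside of two balls of radius \<open>s\<close> is expanded when \<open>s \<rightarrow> 0\<close> on the
  functions \<open>s\<^sup>-\<^sup>p (ln s)\<^sup>q\<close>, and \<open>I\<close> is the coefficient of \<open>p = q = 0\<close>. For an integrable
  function it is the usual integral.
\<close>

definition has_finite_part :: "point \<Rightarrow> point \<Rightarrow> (point \<Rightarrow> real) \<Rightarrow> real \<Rightarrow> bool" where
  "has_finite_part y1 y2 f I \<longleftrightarrow>
     (let E = (\<lambda>s::real. {x. s < dist x y1 \<and> s < dist x y2}) in
        (\<forall>s>0. set_integrable lborel (E s) f) \<and>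
        (\<exists>(K::nat) (a :: nat \<Rightarrow> nat \<Rightarrow> real). a 0 0 = I \<and>
           ((\<lambda>s. (LINT x:E s|lborel. f x)
                 - (\<Sum>p\<le>K. \<Sum>q\<le>K. a p q * (1 / s ^ p) * ln s ^ q)) \<longlongrightarrow> 0) (at_right 0)))"

text \<open>
  The Poisson equation \<open>\<Delta>u = F\<close> in the sense of distributions on the whole space, the points
  \<open>y1\<close> and \<open>y2\<close> included. The source need not be locally integrable there, and as a
  distribution it is the finite part of \<open>F\<close>.
\<close>

definition weak_poisson ::
    "point \<Rightarrow> point \<Rightarrow> (point \<Rightarrow> real) \<Rightarrow> (point \<Rightarrow> real) \<Rightarrow> bool" where
  "weak_poisson y1 y2 u F \<longleftrightarrow>
     (\<forall>R. set_integrable lborel (cball 0 R) u) \<and>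
     (\<forall>\<phi>. test_function \<phi> \<longrightarrow>
        has_finite_part y1 y2 (\<lambda>x. F x * \<phi> x) (LINT x|lborel. u x * laplacian \<phi> x))"

definition kron :: "3 \<Rightarrow> 3 \<Rightarrow> real" where
  "kron i j = (if i = j then 1 else 0)"

definition g_log :: "point \<Rightarrow> point \<Rightarrow> point \<Rightarrow> real" where
  "g_log x y1 y2 = ln (norm (x - y1) + norm (x - y2) + norm (y1 - y2))"

definition stf :: "(3 \<Rightarrow> 3 \<Rightarrow> real) \<Rightarrow> 3 \<Rightarrow> 3 \<Rightarrow> real" where
  "stf T i j = (T i j + T j i) / 2 - kron i j * (\<Sum>k\<in>UNIV. T k k) / 3"

definition s_field :: "point \<Rightarrow> point \<Rightarrow> point \<Rightarrow> 3 \<Rightarrow> 3 \<Rightarrow> real" where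
  "s_field y1 y2 x = stf (\<lambda>i j. pd i (\<lambda>a. pd j (\<lambda>b. g_log x a b) y2) y1)"

definition gamma_tilde :: "point \<Rightarrow> point \<Rightarrow> fmetric" where
  "gamma_tilde y1 y2 x = (\<chi> i j. fps_const (kron i j) + fps_X * fps_const (s_field y1 y2 x i j))"

definition brill_lindquist :: "point \<Rightarrow> point \<Rightarrow> real \<Rightarrow> real \<Rightarrow> point \<Rightarrow> real" where
  "brill_lindquist y1 y2 a1 a2 x = 1 + a1 / norm (x - y1) + a2 / norm (x - y2)"

definition conformal_series ::
    "(point \<Rightarrow> real) \<Rightarrow> (nat \<Rightarrow> point \<Rightarrow> real) \<Rightarrow> point \<Rightarrow> real fps" where
  "conformal_series \<psi> \<sigma> x = Abs_fps (\<lambda>n. if n = 0 then \<psi> x else \<sigma> n x)"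

text \<open>
  In the coefficient of \<open>\<beta>\<^sup>n\<close> of the constraint equation, the unknown of order \<open>n\<close> occurs only
  through its flat Laplacian (the metric is flat at order zero). Hence the source of that
  Laplacian is what the series truncated below order \<open>n\<close> leaves in this coefficient.
\<close>

definition constraint_source ::
    "fmetric \<Rightarrow> (point \<Rightarrow> real fps) \<Rightarrow> nat \<Rightarrow> point \<Rightarrow> real" where
  "constraint_source h \<Psi> n x =
     (let \<Psi>n = (\<lambda>z. fps_cutoff n (\<Psi> z)) in
        fps_nth (fps_const (1/8) * scalar_curvature h x * \<Psi>n x - metric_laplacian h \<Psi>n x) n)"

definition perturbative_solution ::
    "point \<Rightarrow> point \<Rightarrow> real \<Rightarrow> real \<Rightarrow> (nat \<Rightarrow> point \<Rightarrow> real) \<Rightarrow> bool" where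
  "perturbative_solution y1 y2 a1 a2 \<sigma> \<longleftrightarrow>
     (\<forall>n\<ge>1. smooth_on (- {y1, y2}) (\<sigma> n) \<and>
        (\<sigma> n \<longlongrightarrow> 0) at_infinity \<and>
        weak_poisson y1 y2 (\<sigma> n)
          (constraint_source (gamma_tilde y1 y2)
             (conformal_series (brill_lindquist y1 y2 a1 a2) \<sigma>) n))"

definition gamma_series ::
    "point \<Rightarrow> point \<Rightarrow> real \<Rightarrow> real \<Rightarrow> (nat \<Rightarrow> point \<Rightarrow> real) \<Rightarrow> fmetric" where
  "gamma_series y1 y2 a1 a2 \<sigma> x =
     (\<chi> i j. conformal_series (brill_lindquist y1 y2 a1 a2) \<sigma> x ^ 4 * gamma_tilde y1 y2 x $ i $ j)"

text \<open>
  The series in \<open>\<beta>\<close> are formal; their expansion when \<open>c \<rightarrow> \<infinity>\<close> (where \<open>\<beta>\<close> is of order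
  \<open>1/c\<^sup>4\<close>) is read off their partial sums.
\<close>

definition fps_partial_eval :: "nat \<Rightarrow> real fps \<Rightarrow> real \<Rightarrow> real" where
  "fps_partial_eval N F b = (\<Sum>n\<le>N. fps_nth F n * b ^ n)"

definition sym_prod :: "point \<Rightarrow> point \<Rightarrow> 3 \<Rightarrow> 3 \<Rightarrow> real" where
  "sym_prod u v i j = (u $ i * v $ j + u $ j * v $ i) / 2"

definition metric_2PN ::
    "real \<Rightarrow> real \<Rightarrow> real \<Rightarrow> point \<Rightarrow> point \<Rightarrow> real \<Rightarrow> point \<Rightarrow> 3 \<Rightarrow> 3 \<Rightarrow> real" where
  "metric_2PN G m1 m2 y1 y2 c x i j =
    (let r1 = norm (x - y1); r2 = norm (x - y2); r12 = norm (y1 - y2);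
         n1 = (x - y1) /\<^sub>R r1; n2 = (x - y2) /\<^sub>R r2; n12 = (y1 - y2) /\<^sub>R r12;
         S = r1 + r2 + r12
     in kron i j * (1 + 2 * G * m1 / (c^2 * r1) + 2 * G * m2 / (c^2 * r2))
      + G^2 / c^4 * (m1^2 / r1^2 * (kron i j + n1 $ i * n1 $ j)
                   + m2^2 / r2^2 * (kron i j + n2 $ i * n2 $ j))
      + G^2 * m1 * m2 / c^4 * kron i j *
          (4 / (r1 * r2) - (r1 + r2) / (2 * r12^3)
           + 1 / (2 * r12^3) * (r1^2 / r2 + r2^2 / r1)
           - 5 / (2 * r12) * (1 / r1 + 1 / r2) + 8 / (r12 * S))
      - 8 * G^2 * m1 * m2 / c^4 * (n12 $ i * n12 $ j) * (1 / S^2 + 1 / (r12 * S))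
      + 8 * G^2 * m1 * m2 / (c^4 * S^2) *
          (sym_prod n1 n2 i j + sym_prod n1 n12 i j - sym_prod n2 n12 i j))"

end

theory Submission
  imports Defs
begin

text \<open>
  Uniqueness comes from a Liouville theorem: a weakly harmonic function on the whole space that is
  continuous off finitely many points and tends to zero at infinity vanishes. It shows that the
  coefficients \<open>\<sigma>\<^sub>n\<close> are determined, hence affine in \<open>(\<alpha>\<^sub>1, \<alpha>\<^sub>2)\<close> since the hierarchy is
  linear; they stay bounded when \<open>c \<rightarrow> \<infinity>\<close>, and at order \<open>1/c\<^sup>4\<close> only \<open>\<sigma>\<^sub>1\<close> at \<open>\<psi> = 1\<close> matters.
  Its source \<open>\<partial>\<^sub>i\<^sub>j s\<^sub>i\<^sub>j / 8\<close> is computed from the explicit form of \<open>\<partial>\<^sup>2 g / \<partial>y\<^sub>1\<^sup>i \<partial>y\<^sub>2\<^sup>j\<close>; it is of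
  order \<open>1/r\<^sup>2\<close> at the singular points, hence locally integrable, so that the finite part is the
  ordinary integral. With \<open>d = y\<^sub>1 - y\<^sub>2\<close>, the solution is
  \<open>\<sigma>\<^sub>1 = (1/r\<^sub>1r\<^sub>2 - 1/r\<^sub>1r\<^sub>1\<^sub>2 - 1/r\<^sub>2r\<^sub>1\<^sub>2)/96 - (n\<^sub>1\<cdot>d - n\<^sub>2\<cdot>d)/32r\<^sub>1\<^sub>2\<^sup>3\<close>; it is bounded at the
  singular points, so no delta function appears there. The \<open>m\<^sub>1m\<^sub>2\<close> parts of the two metrics then
  agree exactly, and the \<open>m\<^sub>a\<^sup>2\<close> parts differ by the Lie derivative along
  \<open>G\<^sup>2(m\<^sub>1\<^sup>2n\<^sub>1/r\<^sub>1 + m\<^sub>2\<^sup>2n\<^sub>2/r\<^sub>2)/4c\<^sup>4\<close>.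
\<close>

subsection \<open>Smooth functions and partial derivatives\<close>

text \<open>The equations hold across the two points, where \<open>pd\<close> carries no
  information. A pointwise computation off them cannot identify \<sigma>_1: adding a multiple of
  1/r_1 would leave both the Laplacian there and the decay at infinity unchanged. The weak equation
  excludes this, at the price of controlling every delta function. To that end r is replaced by
  sqrt(r^2 + e^2), Green's identity is applied to the resulting smooth fields, and e tends to 0
  under a locally integrable majorant, so that no surface integrals occur.

  A second obstacle is that the constants vary with c, while the solutions are given as a family
  with no regularity in (\<alpha>_1, \<alpha>_2). Affinity supplies the estimate: at fixed x each
  coefficient is a combination of the three fixed numbers belonging to (0,0), (1,0) and (0,1).

  The difference of the m_a^2 parts is that between isotropic and harmonic coordinates of a single
  Schwarzschild body, since one body alone gives the Brill-Lindquist factor 1 + \<alpha>/r.\<close>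

lemma pd_cong:
  assumes "open S" "x \<in> S" "\<And>y. y \<in> S \<Longrightarrow> f y = g y"
  shows "pd i f x = pd i g x"
proof -
  have "((\<lambda>t::real. x + t *\<^sub>R axis i 1) \<longlongrightarrow> x + 0 *\<^sub>R axis i 1) (nhds 0)"
    by (intro tendsto_intros filterlim_ident)
  then have "\<forall>\<^sub>F t in nhds 0. x + t *\<^sub>R axis i 1 \<in> S"
    using assms(1,2) by (simp add: topological_tendstoD)
  then show ?thesis
    unfolding pd_def by (intro deriv_cong_ev) (auto elim!: eventually_mono simp: assms(3))
qed

lemma DERIV_pd:
  assumes "f differentiable (at x)"
  shows "((\<lambda>t. f (x + t *\<^sub>R axis i 1)) has_real_derivative pd i f x) (at 0)"
proof -
  have "((\<lambda>t::real. x + t *\<^sub>R axis i 1) has_derivative (\<lambda>t. t *\<^sub>R axis i 1)) (at 0)"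
    by (auto intro!: derivative_eq_intros)
  then have "(\<lambda>t::real. x + t *\<^sub>R axis i 1) differentiable (at 0)"
    by (rule differentiableI)
  moreover have "f differentiable (at (x + 0 *\<^sub>R axis i (1::real)))" using assms by simp
  ultimately have "(f \<circ> (\<lambda>t::real. x + t *\<^sub>R axis i 1)) differentiable (at 0)"
    by (intro differentiable_chain_at) auto
  then show ?thesis
    by (simp add: pd_def o_def DERIV_deriv_iff_real_differentiable)
qed

lemma pd_eqI: "((\<lambda>t. f (x + t *\<^sub>R axis i 1)) has_real_derivative f') (at 0) \<Longrightarrow> pd i f x = f'"
  by (simp add: pd_def DERIV_imp_deriv)

lemma pd_const [simp]: "pd i (\<lambda>x. c) = (\<lambda>x. 0)"
  by (auto simp: pd_def)

lemma pd_add: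
  assumes "f differentiable (at x)" "g differentiable (at x)"
  shows "pd i (\<lambda>x. f x + g x) x = pd i f x + pd i g x"
  using assms by (intro pd_eqI derivative_intros DERIV_pd)

lemma pd_cmult:
  assumes "f differentiable (at x)"
  shows "pd i (\<lambda>x. c * f x) x = c * pd i f x"
  by (rule pd_eqI) (rule DERIV_cmult[OF DERIV_pd[OF assms]])

lemma pd_sum:
  assumes "\<And>k. k \<in> A \<Longrightarrow> f k differentiable (at x)"
  shows "pd i (\<lambda>x. \<Sum>k\<in>A. f k x) x = (\<Sum>k\<in>A. pd i (f k) x)"
  using assms by (intro pd_eqI DERIV_sum DERIV_pd)

lemma pd_mult:
  assumes "f differentiable (at x)" "g differentiable (at x)"
  shows "pd i (\<lambda>x. f x * g x) x = pd i f x * g x + f x * pd i g x"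
  by (rule pd_eqI)
    (use DERIV_mult[OF DERIV_pd[OF assms(1), of i] DERIV_pd[OF assms(2), of i]] in \<open>simp add: mult_ac\<close>)

lemma pd_compose:
  assumes "f differentiable (at x)" "(D has_real_derivative D') (at (f x))"
  shows "pd i (\<lambda>x. D (f x)) x = D' * pd i f x"
  by (rule pd_eqI)
    (use DERIV_chain2[of D D' "\<lambda>t. f (x + t *\<^sub>R axis i 1)", OF _ DERIV_pd[OF assms(1)]] assms(2) in simp)

lemma pd_nth [simp]: "pd i (\<lambda>x. x $ j) = (\<lambda>x. kron i j)"
proof
  fix x
  show "pd i (\<lambda>x. x $ j) x = kron i j"
    by (rule pd_eqI) (auto intro!: derivative_eq_intros simp: kron_def axis_def)
qed

section \<open>Differentiability classes on open sets\<close>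

lemma Ck_on_cong:
  assumes "open S" "\<And>x. x \<in> S \<Longrightarrow> f x = g x"
  shows "Ck_on k S f \<longleftrightarrow> Ck_on k S g"
  using assms(2)
proof (induction k arbitrary: f g)
  case 0
  then show ?case by (simp cong: continuous_on_cong)
next
  case (Suc k)
  have "g differentiable_on S" if dif: "f differentiable_on S" and eq: "\<And>x. x \<in> S \<Longrightarrow> f x = g x" for f g :: "point \<Rightarrow> real"
    unfolding differentiable_on_def
  proof
    fix x assume x: "x \<in> S"
    then obtain f' where "(f has_derivative f') (at x within S)"
      using dif unfolding differentiable_on_def differentiable_def by blast
    from has_derivative_transform[OF x eq[symmetric] this]
    show "g differentiable (at x within S)" by (auto intro: differentiableI)
  qed
  from this[of f g] this[of g f] have "f differentiable_on S \<longleftrightarrow> g differentiable_on S"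
    using Suc.prems by metis
  moreover have "Ck_on k S (pd i f) \<longleftrightarrow> Ck_on k S (pd i g)" for i
    by (intro Suc.IH pd_cong[OF assms(1)] Suc.prems)
  ultimately show ?case by simp
qed

lemma Ck_on_Un:
  assumes "open S" "open T"
  shows "Ck_on k S f \<Longrightarrow> Ck_on k T f \<Longrightarrow> Ck_on k (S \<union> T) f"
  using assms
  by (induction k arbitrary: f)
    (auto intro: continuous_on_open_Un simp: differentiable_on_eq_differentiable_at open_Un)

lemma Ck_on_SucD: "Ck_on (Suc k) S f \<Longrightarrow> Ck_on k S f"
  by (induction k arbitrary: f) (auto intro: differentiable_imp_continuous_on)

lemma Ck_on_const: "Ck_on k S (\<lambda>x. c)"
  by (induction k arbitrary: c) auto

lemma Ck_on_add:
  assumes "open S"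
  shows "Ck_on k S f \<Longrightarrow> Ck_on k S g \<Longrightarrow> Ck_on k S (\<lambda>x. f x + g x)"
proof (induction k arbitrary: f g)
  case 0
  then show ?case by (auto intro: continuous_intros)
next
  case (Suc k)
  have "Ck_on k S (pd i (\<lambda>x. f x + g x))" for i
  proof (subst Ck_on_cong[OF assms])
    show "Ck_on k S (\<lambda>x. pd i f x + pd i g x)" using Suc by simp
  qed (use Suc.prems assms in \<open>simp add: pd_add differentiable_on_eq_differentiable_at\<close>)
  with Suc.prems show ?case by (auto intro: differentiable_on_add)
qed

lemma Ck_on_mult:
  assumes "open S"
  shows "Ck_on k S f \<Longrightarrow> Ck_on k S g \<Longrightarrow> Ck_on k S (\<lambda>x. f x * g x)"
proof (induction k arbitrary: f g)
  case 0
  then show ?case by (auto intro: continuous_intros)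
next
  case (Suc k)
  note SucD = Ck_on_SucD[OF Suc.prems(1)] Ck_on_SucD[OF Suc.prems(2)]
  have "Ck_on k S (pd i (\<lambda>x. f x * g x))" for i
  proof (subst Ck_on_cong[OF assms])
    show "Ck_on k S (\<lambda>x. pd i f x * g x + f x * pd i g x)"
      using Suc SucD by (intro Ck_on_add[OF assms]) simp_all
  qed (use Suc.prems assms in \<open>simp add: pd_mult differentiable_on_eq_differentiable_at\<close>)
  with Suc.prems show ?case by (auto intro: differentiable_on_mult)
qed

text \<open>\<open>D\<close> is the whole tower of derivatives of one function: differentiating
  \<open>D n\<close> after \<open>f\<close> gives \<open>D (Suc n)\<close> after \<open>f\<close>
  times a partial derivative of \<open>f\<close>, so the induction on \<open>k\<close> runs with
  \<open>n\<close> arbitrary.\<close>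

lemma Ck_on_compose:
  assumes "open S" and D: "\<And>n t. t \<in> T \<Longrightarrow> (D n has_real_derivative D (Suc n) t) (at t)"
    and "f ` S \<subseteq> T"
  shows "Ck_on k S f \<Longrightarrow> Ck_on k S (\<lambda>x. D n (f x))"
  using assms(3)
proof (induction k arbitrary: n)
  case 0
  have "continuous_on T (D n)"
    using D by (meson DERIV_isCont continuous_at_imp_continuous_on)
  with 0 show ?case by (auto intro: continuous_on_compose2)
next
  case (Suc k)
  have dif: "f differentiable (at x)" if "x \<in> S" for x
    using Suc.prems that assms(1) by (simp add: differentiable_on_eq_differentiable_at)
  have "(\<lambda>x. D n (f x)) differentiable (at x)" if "x \<in> S" for x
  proof -
    have "D n differentiable (at (f x))"
      using D[of "f x" n] that Suc.prems(2) real_differentiable_def by blast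
    from differentiable_chain_at[OF dif[OF that] this] show ?thesis by (simp add: o_def)
  qed
  then have "(\<lambda>x. D n (f x)) differentiable_on S"
    using assms(1) by (simp add: differentiable_on_eq_differentiable_at)
  moreover have "Ck_on k S (pd i (\<lambda>x. D n (f x)))" for i
  proof (subst Ck_on_cong[OF assms(1)])
    show "Ck_on k S (\<lambda>x. D (Suc n) (f x) * pd i f x)"
      using Suc Ck_on_SucD[OF Suc.prems(1)] by (intro Ck_on_mult[OF assms(1)]) simp_all
    show "pd i (\<lambda>x. D n (f x)) x = D (Suc n) (f x) * pd i f x" if "x \<in> S" for x
      using that Suc.prems(2) by (intro pd_compose dif D) auto
  qed
  ultimately show ?case by simp
qed

lemma smooth_on_cong:
  assumes "open S" "\<And>x. x \<in> S \<Longrightarrow> f x = g x"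
  shows "smooth_on S f \<longleftrightarrow> smooth_on S g"
  unfolding smooth_on_def using Ck_on_cong[OF assms] by simp

lemma smooth_on_Un: "open S \<Longrightarrow> open T \<Longrightarrow> smooth_on S f \<Longrightarrow> smooth_on T f \<Longrightarrow> smooth_on (S \<union> T) f"
  by (auto simp: smooth_on_def intro: Ck_on_Un)

lemma smooth_on_pd: "smooth_on S f \<Longrightarrow> smooth_on S (pd i f)"
  unfolding smooth_on_def using Ck_on.simps(2) by blast

lemma smooth_on_continuous: "smooth_on S f \<Longrightarrow> continuous_on S f"
  unfolding smooth_on_def using Ck_on.simps(1) by blast

lemma smooth_on_differentiable:
  "smooth_on S f \<Longrightarrow> open S \<Longrightarrow> x \<in> S \<Longrightarrow> f differentiable (at x)"
  unfolding smooth_on_def using Ck_on.simps(2) differentiable_on_eq_differentiable_at by blast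

lemma smooth_on_const: "smooth_on S (\<lambda>x. c)"
  by (simp add: smooth_on_def Ck_on_const)

lemma smooth_on_add:
  "open S \<Longrightarrow> smooth_on S f \<Longrightarrow> smooth_on S g \<Longrightarrow> smooth_on S (\<lambda>x. f x + g x)"
  by (simp add: smooth_on_def Ck_on_add)

lemma smooth_on_mult:
  "open S \<Longrightarrow> smooth_on S f \<Longrightarrow> smooth_on S g \<Longrightarrow> smooth_on S (\<lambda>x. f x * g x)"
  by (simp add: smooth_on_def Ck_on_mult)

lemma smooth_on_minus: "open S \<Longrightarrow> smooth_on S f \<Longrightarrow> smooth_on S (\<lambda>x. - f x)"
  using smooth_on_mult[OF _ smooth_on_const[of S "-1"], where g=f] by (simp only: mult_minus1)

lemma smooth_on_diff:
  "open S \<Longrightarrow> smooth_on S f \<Longrightarrow> smooth_on S g \<Longrightarrow> smooth_on S (\<lambda>x. f x - g x)"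
  unfolding diff_conv_add_uminus by (intro smooth_on_add smooth_on_minus)

lemma smooth_on_sum:
  assumes "open S"
  shows "(\<And>k. k \<in> A \<Longrightarrow> smooth_on S (f k)) \<Longrightarrow> smooth_on S (\<lambda>x. \<Sum>k\<in>A. f k x)"
  by (induction A rule: infinite_finite_induct) (auto intro!: smooth_on_const smooth_on_add assms)

lemma smooth_on_power: "open S \<Longrightarrow> smooth_on S f \<Longrightarrow> smooth_on S (\<lambda>x. f x ^ n)"
  by (induction n) (simp_all add: smooth_on_const smooth_on_mult)

lemma smooth_on_nth: "smooth_on S (\<lambda>x. x $ i)"
proof -
  have "Ck_on k S (\<lambda>x. x $ i)" for k
    by (cases k) (auto intro!: Ck_on_const linear_imp_differentiable_on bounded_linear.linear
        bounded_linear_vec_nth continuous_intros)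
  then show ?thesis by (simp add: smooth_on_def)
qed

lemma smooth_on_compose:
  assumes "open S" "smooth_on S f" "\<And>x. x \<in> S \<Longrightarrow> f x \<in> T"
    and "\<And>n t. t \<in> T \<Longrightarrow> (D n has_real_derivative D (Suc n) t) (at t)"
  shows "smooth_on S (\<lambda>x. D n (f x))"
  unfolding smooth_on_def
proof
  fix k
  show "Ck_on k S (\<lambda>x. D n (f x))"
    by (rule Ck_on_compose[where T=T]) (use assms in \<open>auto simp: smooth_on_def\<close>)
qed

text \<open>The tower of derivatives of t^a is explicit, with falling factorials of a as
  coefficients. Inverse and square root are the exponents -1 and 1/2, whence the positivity
  hypotheses of the rules below.\<close>

lemma smooth_on_powr:
  fixes a :: real
  assumes "open S" "smooth_on S f" "\<And>x. x \<in> S \<Longrightarrow> 0 < f x"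
  shows "smooth_on S (\<lambda>x. f x powr a)"
proof -
  define D where "D n t = (\<Prod>k<n. a - real k) * t powr (a - real n)" for n :: nat and t :: real
  have D: "(D n has_real_derivative D (Suc n) t) (at t)" if "t \<in> {0<..}" for n t
  proof -
    have "((\<lambda>t. t powr (a - real n)) has_real_derivative (a - real n) * t powr (a - real n - 1)) (at t)"
      using that by (intro has_real_derivative_powr) auto
    from DERIV_cmult[OF this, of "\<Prod>k<n. a - real k"] show ?thesis
      unfolding D_def by (simp add: mult.assoc diff_diff_eq add.commute)
  qed
  have "smooth_on S (\<lambda>x. D 0 (f x))"
    by (rule smooth_on_compose[where D=D and T="{0<..}", OF assms(1,2) _ D]) (use assms(3) in simp_all)
  then show ?thesis by (simp add: D_def)
qed

lemma smooth_on_inverse: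
  assumes "open S" "smooth_on S f" "\<And>x. x \<in> S \<Longrightarrow> 0 < f x"
  shows "smooth_on S (\<lambda>x. inverse (f x))"
proof (subst smooth_on_cong[OF assms(1)])
  show "smooth_on S (\<lambda>x. f x powr (-1))" by (rule smooth_on_powr[OF assms])
  show "inverse (f x) = f x powr (-1)" if "x \<in> S" for x
    using assms(3)[OF that] by (simp add: powr_minus)
qed

lemma smooth_on_divide:
  assumes "open S" "smooth_on S g" "smooth_on S f" "\<And>x. x \<in> S \<Longrightarrow> 0 < f x"
  shows "smooth_on S (\<lambda>x. g x / f x)"
  unfolding divide_inverse by (intro smooth_on_mult smooth_on_inverse assms)

lemma smooth_on_sqrt:
  assumes "open S" "smooth_on S f" "\<And>x. x \<in> S \<Longrightarrow> 0 < f x"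
  shows "smooth_on S (\<lambda>x. sqrt (f x))"
proof (subst smooth_on_cong[OF assms(1)])
  show "smooth_on S (\<lambda>x. f x powr (1/2))" by (rule smooth_on_powr[OF assms])
  show "sqrt (f x) = f x powr (1/2)" if "x \<in> S" for x
    using assms(3)[OF that] by (simp add: powr_half_sqrt)
qed

lemma norm_vec3_sq: "(norm (v::point))\<^sup>2 = (\<Sum>i\<in>UNIV. (v $ i)\<^sup>2)"
  by (simp add: norm_vec_def L2_set_def sum_nonneg)

lemma smooth_on_norm_sq:
  assumes "open S" shows "smooth_on S (\<lambda>x. (norm (x - y))\<^sup>2)"
  unfolding norm_vec3_sq vector_minus_component
  by (intro smooth_on_sum smooth_on_power smooth_on_diff smooth_on_nth smooth_on_const assms)

lemma smooth_on_norm: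
  assumes "open S" "y \<notin> S" shows "smooth_on S (\<lambda>x. norm (x - y))"
proof -
  have "0 < (norm (x - y))\<^sup>2" if "x \<in> S" for x
    using that assms(2) by auto
  from smooth_on_sqrt[OF assms(1) smooth_on_norm_sq[OF assms(1)] this] show ?thesis
    by simp
qed

lemmas smooth_intros = smooth_on_add smooth_on_mult smooth_on_diff smooth_on_minus smooth_on_const
  smooth_on_nth smooth_on_norm smooth_on_norm_sq smooth_on_sum smooth_on_power smooth_on_divide
  smooth_on_sqrt smooth_on_pd smooth_on_inverse

subsection \<open>Integration by parts\<close>

definition locally_integrable :: "(point \<Rightarrow> real) \<Rightarrow> bool" where
  "locally_integrable f \<longleftrightarrow> (\<forall>R. set_integrable lborel (cball 0 R) f)"

definition has_support_in_cball :: "(point \<Rightarrow> real) \<Rightarrow> real \<Rightarrow> bool" where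
  "has_support_in_cball f R \<longleftrightarrow> (\<forall>x. R < norm x \<longrightarrow> f x = 0)"

lemma integrable_indicator_cball: "integrable lborel (\<lambda>x. indicator (cball a R) x :: real)"
  by (intro integrable_real_indicator emeasure_lborel_cball_finite[unfolded less_top[symmetric]]) auto

lemma continuous_support_bounded:
  assumes "continuous_on UNIV \<phi>" "has_support_in_cball \<phi> R"
  obtains M where "0 \<le> M" "\<And>x. \<bar>\<phi> x\<bar> \<le> M"
proof -
  have "compact (\<phi> ` cball 0 R)"
    by (intro compact_continuous_image continuous_on_subset[OF assms(1)]) auto
  then obtain M where M: "\<And>y. y \<in> \<phi> ` cball 0 R \<Longrightarrow> norm y \<le> M"
    using compact_imp_bounded bounded_iff by metis
  have "\<bar>\<phi> x\<bar> \<le> max M 0" for x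
    using M[of "\<phi> x"] assms(2)[unfolded has_support_in_cball_def, rule_format, of x]
    by (cases "norm x \<le> R") auto
  then show ?thesis using that[of "max M 0"] by auto
qed

lemma integrable_locally_integrable_mult:
  assumes "locally_integrable f" "continuous_on UNIV \<phi>" "has_support_in_cball \<phi> R"
  shows "integrable lborel (\<lambda>x. f x * \<phi> x)"
proof -
  obtain M where M: "0 \<le> M" "\<And>x. \<bar>\<phi> x\<bar> \<le> M"
    using continuous_support_bounded[OF assms(2,3)] by blast
  have int: "integrable lborel (\<lambda>x. indicator (cball 0 R) x * f x)"
    using assms(1) by (simp add: locally_integrable_def set_integrable_def)
  have [measurable]: "\<phi> \<in> borel_measurable borel"
    using assms(2) by (rule borel_measurable_continuous_onI)
  have eq: "f x * \<phi> x = (indicator (cball 0 R) x * f x) * \<phi> x" for x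
    using assms(3) by (auto simp: has_support_in_cball_def indicator_def)
  show ?thesis
    unfolding eq
  proof (rule Bochner_Integration.integrable_bound)
    show "integrable lborel (\<lambda>x. M * (indicator (cball 0 R) x * f x))"
      using int by simp
    show "(\<lambda>x. indicator (cball 0 R) x * f x * \<phi> x) \<in> borel_measurable lborel"
      using borel_measurable_integrable[OF int] by measurable
    show "AE x in lborel. norm (indicator (cball 0 R) x * f x * \<phi> x) \<le> norm (M * (indicator (cball 0 R) x * f x))"
      using M by (auto simp: abs_mult mult.commute[of M] intro!: mult_left_mono)
  qed
qed

lemma locally_integrable_continuous:
  assumes "continuous_on UNIV f" shows "locally_integrable f"
  unfolding locally_integrable_def set_integrable_def
  by (intro allI borel_integrable_compact continuous_on_subset[OF assms]) auto

lemma integrable_continuous_support: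
  assumes "continuous_on UNIV \<phi>" "has_support_in_cball \<phi> R"
  shows "integrable lborel \<phi>"
  using integrable_locally_integrable_mult[OF locally_integrable_continuous[OF continuous_on_const[of _ 1]] assms]
  by simp

lemma locally_integrable_add:
  "locally_integrable f \<Longrightarrow> locally_integrable g \<Longrightarrow> locally_integrable (\<lambda>x. f x + g x)"
  by (simp add: locally_integrable_def set_integral_add(1))

lemma locally_integrable_cmult: "locally_integrable f \<Longrightarrow> locally_integrable (\<lambda>x. c * f x)"
  by (simp add: locally_integrable_def)

lemma locally_integrable_bound:
  assumes "locally_integrable g" "f \<in> borel_measurable borel" "AE x in lborel. \<bar>f x\<bar> \<le> g x"
  shows "locally_integrable f"
  unfolding locally_integrable_def
proof
  fix R
  show "set_integrable lborel (cball 0 R) f"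
  proof (rule set_integrable_bound)
    show "set_integrable lborel (cball 0 R) g" using assms(1) by (simp add: locally_integrable_def)
    show "set_borel_measurable lborel (cball 0 R) f"
      unfolding set_borel_measurable_def using assms(2)
      by (intro borel_measurable_scaleR borel_measurable_indicator) auto
    show "AE x in lborel. x \<in> cball 0 R \<longrightarrow> norm (f x) \<le> norm (g x)"
      using assms(3) by eventually_elim auto
  qed
qed

lemma integral_translate:
  fixes f :: "point \<Rightarrow> real"
  assumes "f \<in> borel_measurable borel"
  shows "(LINT x|lborel. f (x + v)) = (LINT x|lborel. f x)"
proof -
  have "(LINT x|distr lborel borel ((+) v). f x) = (LINT x|lborel. f (v + x))"
    using assms by (intro integral_distr) auto
  then show ?thesis by (simp add: lborel_distr_plus add.commute)
qed

text \<open>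
  By translation invariance the difference quotients of \<open>h\<close> have integral zero, and they converge
  dominatedly to the derivative.
\<close>

lemma integral_pd_eq_0:
  assumes dif: "\<And>x. h differentiable (at x)" and cont: "continuous_on UNIV (pd i h)"
    and supp: "has_support_in_cball h R"
  shows "has_support_in_cball (pd i h) R" "(LINT x|lborel. pd i h x) = 0"
proof -
  let ?e = "axis i 1 :: point"
  have op: "open {x::point. R < norm x}"
    by (intro open_Collect_less continuous_intros)
  have "pd i h x = pd i (\<lambda>x. 0) x" if "R < norm x" for x
    using that supp by (intro pd_cong[OF op]) (auto simp: has_support_in_cball_def)
  then show supp': "has_support_in_cball (pd i h) R"
    by (simp add: has_support_in_cball_def)
  obtain M where M: "0 \<le> M" "\<And>x. \<bar>pd i h x\<bar> \<le> M"
    using continuous_support_bounded[OF cont supp'] by blast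
  have conth: "continuous_on UNIV h"
    using dif by (simp add: continuous_at_imp_continuous_on differentiable_imp_continuous_within)
  then have [measurable]: "h \<in> borel_measurable borel" by (rule borel_measurable_continuous_onI)
  have line: "((\<lambda>t. h (x + t *\<^sub>R ?e)) has_real_derivative pd i h (x + t *\<^sub>R ?e)) (at t)" for x t
  proof -
    have "((\<lambda>s. h ((x + t *\<^sub>R ?e) + s *\<^sub>R ?e)) has_real_derivative pd i h (x + t *\<^sub>R ?e)) (at 0)"
      by (rule DERIV_pd[OF dif])
    then show ?thesis
      using DERIV_at_within_shift_lemma[of _ _ t]
      by (simp add: DERIV_shift[of "\<lambda>t. h (x + t *\<^sub>R ?e)" _ 0 t, simplified] algebra_simps)
  qed
  define q where "q n x = real (Suc n) * (h (x + (1 / real (Suc n)) *\<^sub>R ?e) - h x)" for n x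
  have lim: "(\<lambda>n. q n x) \<longlonglongrightarrow> pd i h x" for x
  proof -
    have "((\<lambda>t. (h (x + t *\<^sub>R ?e) - h x) / t) \<longlongrightarrow> pd i h x) (at 0)"
      using line[of x 0] by (simp add: DERIV_def)
    moreover have "filterlim (\<lambda>n. 1 / real (Suc n)) (at 0) sequentially"
      using LIMSEQ_inverse_real_of_nat by (auto simp: filterlim_at inverse_eq_divide)
    ultimately have "(\<lambda>n. (h (x + (1 / real (Suc n)) *\<^sub>R ?e) - h x) / (1 / real (Suc n))) \<longlonglongrightarrow> pd i h x"
      by (rule filterlim_compose)
    then show ?thesis by (simp add: q_def mult.commute)
  qed
  \<comment> \<open>The mean value theorem turns the quotient into a value of the derivative; the
    step is at most 1, which enlarges the support to radius \<open>R + 1\<close>.\<close>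
  have bound: "\<bar>q n x\<bar> \<le> M * indicator (cball 0 (R + 1)) x" for n x
  proof (cases "norm x \<le> R + 1")
    case True
    let ?t = "1 / real (Suc n)"
    have "\<exists>z>0. z < ?t \<and> h (x + ?t *\<^sub>R ?e) - h (x + 0 *\<^sub>R ?e) = (?t - 0) * pd i h (x + z *\<^sub>R ?e)"
      by (rule MVT2) (auto intro: line)
    then obtain z where "h (x + ?t *\<^sub>R ?e) - h x = ?t * pd i h (x + z *\<^sub>R ?e)" by auto
    then have "q n x = pd i h (x + z *\<^sub>R ?e)" by (simp add: q_def)
    then show ?thesis using M(2) True by (simp add: indicator_def)
  next
    case False
    have "norm x \<le> norm (x + (1 / real (Suc n)) *\<^sub>R ?e) + norm ((1 / real (Suc n)) *\<^sub>R ?e)"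
      using norm_triangle_ineq4[of "x + (1 / real (Suc n)) *\<^sub>R ?e" "(1 / real (Suc n)) *\<^sub>R ?e"] by simp
    also have "norm ((1 / real (Suc n)) *\<^sub>R ?e) \<le> 1" by (simp add: norm_axis_1)
    finally have "R < norm (x + (1 / real (Suc n)) *\<^sub>R ?e)" using False by simp
    then show ?thesis using False supp M(1) by (simp add: q_def has_support_in_cball_def)
  qed
  have "(\<lambda>n. LINT x|lborel. q n x) \<longlonglongrightarrow> (LINT x|lborel. pd i h x)"
  proof (rule integral_dominated_convergence)
    show "integrable lborel (\<lambda>x. M * indicator (cball 0 (R + 1)) x)"
      by (intro integrable_mult_right integrable_indicator_cball)
    show "pd i h \<in> borel_measurable lborel" using cont by (simp add: borel_measurable_continuous_onI)
    show "q n \<in> borel_measurable lborel" for n unfolding q_def by measurable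
  qed (use lim bound in auto)
  moreover have "(LINT x|lborel. q n x) = 0" for n
  proof -
    have inth: "integrable lborel h" by (rule integrable_continuous_support[OF conth supp])
    have "has_support_in_cball (\<lambda>x. h (x + (1 / real (Suc n)) *\<^sub>R ?e)) (R + 1)"
      unfolding has_support_in_cball_def
    proof (intro allI impI)
      fix x :: point assume "R + 1 < norm x"
      then have "q n x = 0" using bound[of n x] by simp
      moreover have "h x = 0" using \<open>R + 1 < norm x\<close> supp by (simp add: has_support_in_cball_def)
      ultimately show "h (x + (1 / real (Suc n)) *\<^sub>R ?e) = 0" by (simp add: q_def)
    qed
    then have "integrable lborel (\<lambda>x. h (x + (1 / real (Suc n)) *\<^sub>R ?e))"
      by (intro integrable_continuous_support) (auto intro!: continuous_on_compose2[OF conth] continuous_intros)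
    then show ?thesis
      unfolding q_def using inth by (simp add: integral_translate)
  qed
  ultimately show "(LINT x|lborel. pd i h x) = 0"
    using LIMSEQ_unique[OF _ tendsto_const] by simp
qed

section \<open>Test functions and Green's identity\<close>

lemma test_functionE:
  assumes "test_function \<phi>"
  obtains R where "has_support_in_cball \<phi> R" "smooth_on UNIV \<phi>"
  using assms unfolding test_function_def bounded_iff has_support_in_cball_def
  by (metis (mono_tags, lifting) mem_Collect_eq not_less)

lemma laplacian_continuous: "smooth_on UNIV f \<Longrightarrow> continuous_on UNIV (laplacian f)"
  unfolding laplacian_def[abs_def]
  by (intro continuous_intros smooth_on_continuous smooth_on_pd)

lemma smooth_UNIV_dif: "smooth_on UNIV f \<Longrightarrow> f differentiable (at x)"
  by (rule smooth_on_differentiable) auto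

lemma has_support_pd:
  assumes "smooth_on UNIV \<phi>" "has_support_in_cball \<phi> R"
  shows "has_support_in_cball (pd i \<phi>) R"
  using assms by (intro integral_pd_eq_0(1) smooth_UNIV_dif smooth_on_continuous smooth_on_pd)

lemma has_support_laplacian:
  assumes "smooth_on UNIV \<phi>" "has_support_in_cball \<phi> R"
  shows "has_support_in_cball (laplacian \<phi>) R"
proof -
  have "has_support_in_cball (pd i (pd i \<phi>)) R" for i
    by (intro has_support_pd smooth_on_pd assms)
  then show ?thesis by (simp add: has_support_in_cball_def laplacian_def)
qed

text \<open>The divergence of f grad \<phi> - \<phi> grad f integrates to zero. The growth of
  \<open>f\<close> is harmless because each term contains \<phi> or one of its derivatives.\<close>

lemma green_identity:
  assumes f: "smooth_on UNIV f" and \<phi>: "test_function \<phi>"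
  shows "(LINT x|lborel. f x * laplacian \<phi> x) = (LINT x|lborel. laplacian f x * \<phi> x)"
proof -
  obtain R where R: "has_support_in_cball \<phi> R" and s: "smooth_on UNIV \<phi>"
    using test_functionE[OF \<phi>] .
  define h where "h i x = f x * pd i \<phi> x + (-1) * (\<phi> x * pd i f x)" for i x
  note intr = smooth_on_add smooth_on_mult smooth_on_const smooth_on_pd f s open_UNIV
  have sm: "smooth_on UNIV (h i)" for i unfolding h_def[abs_def] by (intro intr)
  have pdh: "pd i (h i) x = f x * pd i (pd i \<phi>) x - \<phi> x * pd i (pd i f) x" for i x
  proof -
    have "pd i (h i) x = (pd i f x * pd i \<phi> x + f x * pd i (pd i \<phi>) x)
        + (-1) * (pd i \<phi> x * pd i f x + \<phi> x * pd i (pd i f) x)"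
      unfolding h_def[abs_def]
      by (subst pd_add pd_cmult pd_mult, (intro smooth_UNIV_dif intr)+)+ simp
    then show ?thesis by simp
  qed
  have supp: "has_support_in_cball (h i) R" for i
    using R has_support_pd[OF s R] by (simp add: h_def has_support_in_cball_def)
  have 0: "has_support_in_cball (pd i (h i)) R" "(LINT x|lborel. pd i (h i) x) = 0" for i
    using integral_pd_eq_0[OF smooth_UNIV_dif[OF sm] smooth_on_continuous[OF smooth_on_pd[OF sm]] supp]
    by blast+
  have "integrable lborel (pd i (h i))" for i
    by (rule integrable_continuous_support[OF _ 0(1)]) (intro smooth_on_continuous smooth_on_pd sm)
  then have "(LINT x|lborel. (\<Sum>i\<in>UNIV. pd i (h i) x)) = 0"
    by (simp add: 0)
  also have "(\<lambda>x. \<Sum>i\<in>UNIV. pd i (h i) x) = (\<lambda>x. f x * laplacian \<phi> x - laplacian f x * \<phi> x)"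
    by (auto simp: pdh laplacian_def sum_subtractf sum_distrib_left sum_distrib_right mult.commute)
  also have "(LINT x|lborel. f x * laplacian \<phi> x - laplacian f x * \<phi> x)
     = (LINT x|lborel. f x * laplacian \<phi> x) - (LINT x|lborel. laplacian f x * \<phi> x)"
    by (intro Bochner_Integration.integral_diff
        integrable_locally_integrable_mult[OF _ laplacian_continuous[OF s] has_support_laplacian[OF s R]]
        integrable_locally_integrable_mult[OF _ smooth_on_continuous[OF s] R]
        locally_integrable_continuous smooth_on_continuous[OF f] laplacian_continuous[OF f])
  finally show ?thesis by simp
qed

text \<open>Green's identity for smooth approximations, passed to the limit by dominated
  convergence. The decisive hypothesis is the majorant \<open>g'\<close> of the Laplacians: it
  prevents mass from concentrating at the points of \<open>A\<close>, so that the limit has no delta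
  functions there.\<close>

lemma weak_laplacian_limit:
  assumes f: "\<And>n. smooth_on UNIV (f n)"
    and meas: "u \<in> borel_measurable borel" "F \<in> borel_measurable borel"
    and "finite A"
    and g: "locally_integrable g" "locally_integrable g'"
    and bound: "\<And>n x. x \<notin> A \<Longrightarrow> \<bar>f n x\<bar> \<le> g x" "\<And>n x. x \<notin> A \<Longrightarrow> \<bar>laplacian (f n) x\<bar> \<le> g' x"
    and lim: "\<And>x. x \<notin> A \<Longrightarrow> (\<lambda>n. f n x) \<longlonglongrightarrow> u x"
      "\<And>x. x \<notin> A \<Longrightarrow> (\<lambda>n. laplacian (f n) x) \<longlonglongrightarrow> F x"
    and \<phi>: "test_function \<phi>"
  shows "(LINT x|lborel. u x * laplacian \<phi> x) = (LINT x|lborel. F x * \<phi> x)"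
proof -
  obtain R where R: "has_support_in_cball \<phi> R" and s: "smooth_on UNIV \<phi>"
    using test_functionE[OF \<phi>] .
  have AE: "AE x in lborel. x \<notin> A"
    using \<open>finite A\<close> by (intro AE_not_in finite_imp_null_set_lborel)
  have *: "(\<lambda>n. LINT x|lborel. f n x * \<psi> x) \<longlonglongrightarrow> (LINT x|lborel. u x * \<psi> x)"
    if f: "\<And>n. continuous_on UNIV (f n)" and u: "u \<in> borel_measurable borel"
      and g: "locally_integrable g"
      and bd: "\<And>n x. x \<notin> A \<Longrightarrow> \<bar>f n x\<bar> \<le> g x"
      and lim: "\<And>x. x \<notin> A \<Longrightarrow> (\<lambda>n. f n x) \<longlonglongrightarrow> u x"
      and \<psi>: "continuous_on UNIV \<psi>" "has_support_in_cball \<psi> R"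
    for f u g \<psi>
  proof (rule integral_dominated_convergence)
    have [measurable]: "\<psi> \<in> borel_measurable borel" "f n \<in> borel_measurable borel" for n
      using \<psi>(1) f by (auto intro: borel_measurable_continuous_onI)
    note u [measurable]
    show "(\<lambda>x. u x * \<psi> x) \<in> borel_measurable lborel" by measurable
    show "(\<lambda>x. f n x * \<psi> x) \<in> borel_measurable lborel" for n by measurable
    show "integrable lborel (\<lambda>x. g x * \<bar>\<psi> x\<bar>)"
      using \<psi> by (intro integrable_locally_integrable_mult[OF g, of _ R])
        (auto simp: has_support_in_cball_def intro: continuous_intros)
    show "AE x in lborel. norm (f n x * \<psi> x) \<le> g x * \<bar>\<psi> x\<bar>" for n
      using AE by eventually_elim (auto simp: abs_mult intro!: mult_right_mono bd)
    show "AE x in lborel. (\<lambda>n. f n x * \<psi> x) \<longlonglongrightarrow> u x * \<psi> x"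
      using AE by eventually_elim (auto intro!: tendsto_intros lim)
  qed
  have "(\<lambda>n. LINT x|lborel. f n x * laplacian \<phi> x) \<longlonglongrightarrow> (LINT x|lborel. u x * laplacian \<phi> x)"
    by (intro * [of f u g] smooth_on_continuous f meas g bound lim laplacian_continuous s
        has_support_laplacian R)
  moreover have "(\<lambda>n. LINT x|lborel. laplacian (f n) x * \<phi> x) \<longlonglongrightarrow> (LINT x|lborel. F x * \<phi> x)"
    by (intro * [of "\<lambda>n. laplacian (f n)" F g'] laplacian_continuous smooth_on_continuous f meas g bound lim s R)
  ultimately show ?thesis
    unfolding green_identity[OF f \<phi>] by (rule LIMSEQ_unique)
qed

section \<open>Local integrability of the inverse square of the distance\<close>

lemma dyadic_shell:
  fixes r R :: real
  assumes "0 < r" "r < R"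
  obtains k where "r < R / 2 ^ k" "R / 2 ^ Suc k \<le> r"
proof -
  obtain n where "R / r < 2 ^ n"
    using real_arch_pow[of 2 "R / r"] by auto
  then have ex: "R / 2 ^ n \<le> r"
    using assms by (simp add: field_simps)
  define m where "m = (LEAST n. R / 2 ^ n \<le> r)"
  have m: "R / 2 ^ m \<le> r" unfolding m_def by (rule LeastI[where P="\<lambda>n. R / 2 ^ n \<le> r", OF ex])
  with assms have "m \<noteq> 0" by (cases m) auto
  then obtain k where k: "m = Suc k" by (cases m) auto
  have "\<not> R / 2 ^ k \<le> r"
    using not_less_Least[of k "\<lambda>n. R / 2 ^ n \<le> r"] k unfolding m_def by auto
  with m k that show ?thesis by (auto simp: not_le)
qed

text \<open>On the shell between R/2^(k+1) and R/2^k the function is at most 4^(k+1)/R^2, while the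
  volume is of order R^3/8^k. The contributions form a geometric series of ratio 1/2.\<close>

lemma locally_integrable_inverse_norm_sq: "locally_integrable (\<lambda>x. 1 / (norm (x - y))\<^sup>2)"
proof -
  have *: "set_integrable lborel (ball y R) (\<lambda>x. 1 / (norm (x - y))\<^sup>2)" if "0 < R" for R
    unfolding set_integrable_def
  proof (rule integrableI_bounded)
    show "(\<lambda>x. indicat_real (ball y R) x *\<^sub>R (1 / (norm (x - y))\<^sup>2)) \<in> borel_measurable lborel"
      by (intro borel_measurable_scaleR borel_measurable_indicator borel_measurable_divide
          borel_measurable_power borel_measurable_norm borel_measurable_diff) auto
    define V where "V = unit_ball_vol (real DIM(point))"
    have V: "0 \<le> V" unfolding V_def by (rule unit_ball_vol_nonneg) simp
    define w where "w k = (4 ^ Suc k / R\<^sup>2)" for k :: nat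
    have w: "0 \<le> w k" for k by (simp add: w_def)
    have "(\<integral>\<^sup>+ x. ennreal (norm (indicat_real (ball y R) x *\<^sub>R (1 / (norm (x - y))\<^sup>2))) \<partial>lborel)
        \<le> (\<integral>\<^sup>+ x. (\<Sum>k. ennreal (w k) * indicator (ball y (R / 2 ^ k)) x) \<partial>lborel)"
    proof (rule nn_integral_mono)
      fix x :: point
      show "ennreal (norm (indicat_real (ball y R) x *\<^sub>R (1 / (norm (x - y))\<^sup>2)))
        \<le> (\<Sum>k. ennreal (w k) * indicator (ball y (R / 2 ^ k)) x)"
      \<comment> \<open>At the centre the integrand is 1/0 = 0, so only points lying in some shell
        matter. Whole balls are summed instead of shells; the overcounting only enlarges the
        bound.\<close>
      proof (cases "x \<noteq> y \<and> x \<in> ball y R")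
        case True
        then obtain k where k: "norm (x - y) < R / 2 ^ k" "R / 2 ^ Suc k \<le> norm (x - y)"
          using dyadic_shell[of "norm (x - y)" R] by (auto simp: dist_norm norm_minus_commute)
        have "(R / 2 ^ Suc k)\<^sup>2 \<le> (norm (x - y))\<^sup>2"
          using k(2) \<open>0 < R\<close> by (intro power_mono) auto
        then have "1 / (norm (x - y))\<^sup>2 \<le> 1 / (R / 2 ^ Suc k)\<^sup>2"
          using \<open>0 < R\<close> True by (intro divide_left_mono) auto
        also have "\<dots> = w k"
        proof -
          have "(4::real) ^ k = 2 ^ k * 2 ^ k" by (simp flip: power_mult_distrib)
          then show ?thesis by (simp add: w_def power2_eq_square field_simps)
        qed
        finally have "1 / (norm (x - y))\<^sup>2 \<le> w k" .
        then have "ennreal (norm (indicat_real (ball y R) x *\<^sub>R (1 / (norm (x - y))\<^sup>2)))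
            \<le> ennreal (w k) * indicator (ball y (R / 2 ^ k)) x"
          using True k(1) by (simp add: indicator_def dist_norm norm_minus_commute ennreal_leI)
        also have "\<dots> = (\<Sum>j\<in>{k}. ennreal (w j) * indicator (ball y (R / 2 ^ j)) x)"
          by (subst sum.insert) simp_all
        also have "\<dots> \<le> (\<Sum>j. ennreal (w j) * indicator (ball y (R / 2 ^ j)) x)"
          by (intro sum_le_suminf) auto
        finally show ?thesis .
      qed (auto simp: indicator_def)
    qed
    also have "\<dots> = (\<Sum>k. ennreal (w k) * emeasure lborel (ball y (R / 2 ^ k)))"
    proof (subst nn_integral_suminf)
      show "(\<lambda>x. ennreal (w k) * indicator (ball y (R / 2 ^ k)) x) \<in> borel_measurable lborel" for k
        by (intro borel_measurable_times_ennreal borel_measurable_const borel_measurable_indicator) simp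
      show "(\<Sum>k. \<integral>\<^sup>+ x. ennreal (w k) * indicator (ball y (R / 2 ^ k)) x \<partial>lborel)
          = (\<Sum>k. ennreal (w k) * emeasure lborel (ball y (R / 2 ^ k)))"
        by (intro suminf_cong nn_integral_cmult_indicator) simp
    qed
    also have "\<dots> = (\<Sum>k. ennreal (4 * V * R * (1 / 2) ^ k))"
    proof (rule suminf_cong)
      fix k
      have "w k * (V * (R / 2 ^ k) ^ 3) = 4 * V * R * (1 / 2) ^ k"
      proof -
        have "4 * (c * c) / R\<^sup>2 * (V * (R / c) ^ 3) = 4 * V * R * (1 / c)" if "0 < c" for c
          using that \<open>0 < R\<close> by (simp add: field_simps power2_eq_square power3_eq_cube)
        from this[of "2 ^ k"] show ?thesis
          by (simp add: w_def power_one_over flip: power_mult_distrib)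
      qed
      moreover have "emeasure lborel (ball y (R / 2 ^ k)) = ennreal (V * (R / 2 ^ k) ^ 3)"
        using \<open>0 < R\<close> by (simp add: emeasure_ball V_def)
      ultimately show "ennreal (w k) * emeasure lborel (ball y (R / 2 ^ k)) = ennreal (4 * V * R * (1 / 2) ^ k)"
        by (simp only: ennreal_mult'[OF w, symmetric])
    qed
    also have "\<dots> < \<infinity>"
    proof -
      have "(\<Sum>k. ennreal (4 * V * R * (1 / 2) ^ k)) \<noteq> top"
        using V \<open>0 < R\<close> by (intro ennreal_suminf_neq_top summable_mult summable_geometric) auto
      then show ?thesis by (simp add: less_top)
    qed
    finally show "(\<integral>\<^sup>+ x. ennreal (norm (indicat_real (ball y R) x *\<^sub>R (1 / (norm (x - y))\<^sup>2))) \<partial>lborel) < \<infinity>" .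
  qed
  show ?thesis
    unfolding locally_integrable_def
  proof
    fix R
    have "cball 0 R \<subseteq> ball y (\<bar>R\<bar> + norm y + 1)"
    proof
      fix x :: point assume "x \<in> cball 0 R"
      then show "x \<in> ball y (\<bar>R\<bar> + norm y + 1)"
        using norm_triangle_ineq4[of y x] by (simp add: dist_norm)
    qed
    then show "set_integrable lborel (cball 0 R) (\<lambda>x. 1 / (norm (x - y))\<^sup>2)"
      by (intro set_integrable_subset[OF *[of "\<bar>R\<bar> + norm y + 1"]]) (use norm_ge_zero[of y] in \<open>simp_all, linarith\<close>)
  qed
qed

subsection \<open>Hadamard's finite part\<close>

lemma poly_tendsto_0_at_top:
  fixes p :: "real poly"
  assumes "(poly p \<longlongrightarrow> 0) at_top"
  shows "p = 0"
proof -
  have "\<not> 0 < lead_coeff q" if q: "(poly q \<longlongrightarrow> 0) at_top" for q :: "real poly"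
  proof
    assume pos: "0 < lead_coeff q"
    then obtain n where n: "\<And>x. n \<le> x \<Longrightarrow> lead_coeff q \<le> poly q x"
      using poly_pinfty_gt_lc by blast
    have "\<forall>\<^sub>F x in at_top. lead_coeff q \<le> poly q x"
      using n eventually_at_top_linorder by blast
    then have "lead_coeff q \<le> 0"
      by (rule tendsto_lowerbound[OF q]) simp
    with pos show False by simp
  qed
  from this[of p] this[of "- p"] assms tendsto_minus[OF assms]
  have "lead_coeff p = 0" by (simp add: fun_eq_iff poly_minus[abs_def])
  then show ?thesis by simp
qed

lemma poly_exp_minus_tendsto_0:
  fixes p :: "real poly"
  shows "((\<lambda>x. poly p x * exp (- x)) \<longlongrightarrow> 0) at_top"
proof -
  have "((\<lambda>x. \<Sum>i\<le>degree p. coeff p i * (x ^ i / exp x)) \<longlongrightarrow> (\<Sum>i\<le>degree p. coeff p i * 0)) at_top"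
    by (intro tendsto_intros tendsto_power_div_exp_0)
  then show ?thesis
    by (simp add: poly_altdef sum_distrib_right exp_minus divide_inverse mult.assoc)
qed

text \<open>Multiplying by exp(-Kx) suppresses all terms but the top one, so the top polynomial
  tends to zero and vanishes; the rest follows by descent.\<close>

lemma poly_exp_sum_tendsto_0:
  fixes P :: "nat \<Rightarrow> real poly"
  assumes "((\<lambda>x. \<Sum>p\<le>K. poly (P p) x * exp x ^ p) \<longlongrightarrow> 0) at_top"
  shows "p \<le> K \<Longrightarrow> P p = 0"
  using assms
proof (induction K arbitrary: p)
  case 0
  then show ?case using poly_tendsto_0_at_top[of "P 0"] by simp
next
  case (Suc K)
  let ?e = "\<lambda>x::real. exp (- x)"
  have e: "(?e \<longlongrightarrow> 0) at_top"
    using poly_exp_minus_tendsto_0[of 1] by simp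
  have ee: "exp x * exp (- x) = 1" for x :: real by (simp add: exp_minus)
  have "((\<lambda>x. (\<Sum>p\<le>Suc K. poly (P p) x * exp x ^ p) * ?e x ^ Suc K
       - (\<Sum>p\<le>K. (poly (P p) x * ?e x) * ?e x ^ (K - p))) \<longlongrightarrow> 0 * 0 ^ Suc K - (\<Sum>p\<le>K. 0 * 0 ^ (K - p))) at_top"
    by (intro tendsto_intros Suc.prems e poly_exp_minus_tendsto_0)
  moreover have "(\<Sum>p\<le>Suc K. poly (P p) x * exp x ^ p) * ?e x ^ Suc K
       - (\<Sum>p\<le>K. (poly (P p) x * ?e x) * ?e x ^ (K - p)) = poly (P (Suc K)) x" for x
  proof -
    have summand: "poly (P p) x * exp x ^ p * ?e x ^ Suc K = (poly (P p) x * ?e x) * ?e x ^ (K - p)" if "p \<le> K" for p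
    proof -
      have "?e x ^ Suc K = ?e x ^ p * (?e x * ?e x ^ (K - p))"
        using that by (simp flip: power_Suc power_add)
      moreover have "exp x ^ p * ?e x ^ p = 1" by (simp add: ee flip: power_mult_distrib)
      ultimately show ?thesis by (simp add: algebra_simps)
    qed
    have "(\<Sum>p\<le>K. poly (P p) x * exp x ^ p) * ?e x ^ Suc K
        = (\<Sum>p\<le>K. (poly (P p) x * ?e x) * ?e x ^ (K - p))"
      unfolding sum_distrib_right by (rule sum.cong) (use summand in auto)
    moreover have "exp x ^ Suc K * ?e x ^ Suc K = 1"
      by (simp only: ee power_one flip: power_mult_distrib)
    ultimately show ?thesis by (simp only: sum.atMost_Suc distrib_right mult.assoc)
  qed
  ultimately have "(poly (P (Suc K)) \<longlongrightarrow> 0) at_top" by simp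
  then have top: "P (Suc K) = 0" by (rule poly_tendsto_0_at_top)
  with Suc.prems(2) have "((\<lambda>x. \<Sum>p\<le>K. poly (P p) x * exp x ^ p) \<longlongrightarrow> 0) at_top" by simp
  with Suc.IH Suc.prems(1) top show ?case by (cases "p = Suc K") auto
qed

text \<open>With s = exp(-x) the function s^-p (ln s)^q becomes exp(px) (-x)^q, and the expansion
  becomes a polynomial combination of powers of exp(x). The coefficient concerned is the one that
  defines the finite part.\<close>

lemma log_power_expansion_unique:
  fixes a :: "nat \<Rightarrow> nat \<Rightarrow> real"
  assumes "((\<lambda>s. \<Sum>p\<le>K. \<Sum>q\<le>K. a p q * (1 / s ^ p) * ln s ^ q) \<longlongrightarrow> 0) (at_right 0)"
  shows "a 0 0 = 0"
proof -
  define P where "P p = (\<Sum>q\<le>K. monom (a p q * (- 1) ^ q) q)" for p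
  have "filterlim (\<lambda>x::real. exp (- x)) (at_right 0) at_top"
    unfolding filterlim_at
    using poly_exp_minus_tendsto_0[of 1] by simp
  from filterlim_compose[OF assms this]
  have "((\<lambda>x. \<Sum>p\<le>K. poly (P p) x * exp x ^ p) \<longlongrightarrow> 0) at_top"
  proof (rule filterlim_cong[THEN iffD1, OF refl refl, rotated])
    show "\<forall>\<^sub>F x in at_top. (\<Sum>p\<le>K. \<Sum>q\<le>K. a p q * (1 / exp (- x) ^ p) * ln (exp (- x)) ^ q)
        = (\<Sum>p\<le>K. poly (P p) x * exp x ^ p)"
    proof (intro always_eventually allI sum.cong refl)
      fix x :: real and p
      have "1 / exp (- x) ^ p = exp x ^ p" by (simp add: exp_minus field_simps)
      moreover have "poly (P p) x = (\<Sum>q\<le>K. a p q * (- x) ^ q)"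
        unfolding P_def poly_sum poly_monom by (simp add: power_minus[of x] mult.assoc)
      ultimately show "(\<Sum>q\<le>K. a p q * (1 / exp (- x) ^ p) * ln (exp (- x)) ^ q) = poly (P p) x * exp x ^ p"
        by (simp add: sum_distrib_left sum_distrib_right mult_ac)
    qed
  qed
  then have "P 0 = 0" by (rule poly_exp_sum_tendsto_0) simp
  then have "coeff (P 0) 0 = 0" by simp
  moreover have "coeff (P 0) 0 = (\<Sum>q\<le>K. if q = 0 then a 0 q else 0)"
    unfolding P_def coeff_sum by (intro sum.cong) auto
  ultimately show ?thesis by simp
qed

section \<open>Linearity and consistency of the finite part\<close>

lemma finite_part_lincomb:
  assumes f: "has_finite_part y1 y2 f I" and g: "has_finite_part y1 y2 g J"
  shows "has_finite_part y1 y2 (\<lambda>x. a * f x + b * g x) (a * I + b * J)"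
proof -
  define E where "E = (\<lambda>s::real. {x. s < dist x y1 \<and> s < dist x y2})"
  define w where "w p q s = (1 / s ^ p) * ln s ^ q" for p q and s :: real
  from f obtain K1 A where f1: "\<And>s. s > 0 \<Longrightarrow> set_integrable lborel (E s) f" and A: "A 0 0 = I"
    and f2: "((\<lambda>s. (LINT x:E s|lborel. f x) - (\<Sum>p\<le>K1. \<Sum>q\<le>K1. A p q * w p q s)) \<longlongrightarrow> 0) (at_right 0)"
    unfolding has_finite_part_def Let_def E_def w_def by (auto simp: mult.assoc)
  from g obtain K2 B where g1: "\<And>s. s > 0 \<Longrightarrow> set_integrable lborel (E s) g" and B: "B 0 0 = J"
    and g2: "((\<lambda>s. (LINT x:E s|lborel. g x) - (\<Sum>p\<le>K2. \<Sum>q\<le>K2. B p q * w p q s)) \<longlongrightarrow> 0) (at_right 0)"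
    unfolding has_finite_part_def Let_def E_def w_def by (auto simp: mult.assoc)
  define K where "K = max K1 K2"
  have K: "K1 \<le> K" "K2 \<le> K" by (simp_all add: K_def)
  \<comment> \<open>The two expansions may have different lengths; both are padded with zero
    coefficients to the larger one.\<close>
  have ext: "(\<Sum>p\<le>L. \<Sum>q\<le>L. c p q * w p q s)
      = (\<Sum>p\<le>K. \<Sum>q\<le>K. (if p \<le> L \<and> q \<le> L then c p q else 0) * w p q s)"
    if "L \<le> K" for L s and c :: "nat \<Rightarrow> nat \<Rightarrow> real"
  proof -
    have "(\<Sum>p\<le>L. \<Sum>q\<le>L. c p q * w p q s)
        = (\<Sum>p\<le>L. \<Sum>q\<le>L. (if p \<le> L \<and> q \<le> L then c p q else 0) * w p q s)"
      by (intro sum.cong) auto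
    also have "\<dots> = (\<Sum>p\<le>L. \<Sum>q\<le>K. (if p \<le> L \<and> q \<le> L then c p q else 0) * w p q s)"
      using that by (intro sum.cong sum.mono_neutral_left) auto
    also have "\<dots> = (\<Sum>p\<le>K. \<Sum>q\<le>K. (if p \<le> L \<and> q \<le> L then c p q else 0) * w p q s)"
      using that by (intro sum.mono_neutral_left) auto
    finally show ?thesis .
  qed
  define C where "C p q = a * (if p \<le> K1 \<and> q \<le> K1 then A p q else 0)
    + b * (if p \<le> K2 \<and> q \<le> K2 then B p q else 0)" for p q
  have C: "C 0 0 = a * I + b * J" by (simp add: C_def A B)
  have sumC: "(\<Sum>p\<le>K. \<Sum>q\<le>K. C p q * w p q s) = a * (\<Sum>p\<le>K1. \<Sum>q\<le>K1. A p q * w p q s)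
      + b * (\<Sum>p\<le>K2. \<Sum>q\<le>K2. B p q * w p q s)" for s
    unfolding ext[OF K(1)] ext[OF K(2)] C_def
    by (simp add: sum.distrib sum_distrib_left distrib_right mult.assoc)
  have int: "set_integrable lborel (E s) (\<lambda>x. a * f x + b * g x)" if "s > 0" for s
    by (intro set_integral_add(1) set_integrable_mult_right f1 g1 that)
  have lint: "(LINT x:E s|lborel. a * f x + b * g x)
      = a * (LINT x:E s|lborel. f x) + b * (LINT x:E s|lborel. g x)" if "s > 0" for s
    using f1[OF that] g1[OF that] by (subst set_integral_add) auto
  have "((\<lambda>s. a * ((LINT x:E s|lborel. f x) - (\<Sum>p\<le>K1. \<Sum>q\<le>K1. A p q * w p q s))
      + b * ((LINT x:E s|lborel. g x) - (\<Sum>p\<le>K2. \<Sum>q\<le>K2. B p q * w p q s)))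
      \<longlongrightarrow> 0) (at_right 0)"
    using tendsto_add[OF tendsto_mult_left[OF f2, of a] tendsto_mult_left[OF g2, of b]] by simp
  then have "((\<lambda>s. (LINT x:E s|lborel. a * f x + b * g x) - (\<Sum>p\<le>K. \<Sum>q\<le>K. C p q * w p q s))
      \<longlongrightarrow> 0) (at_right 0)"
  proof (rule Lim_transform_eventually)
    show "\<forall>\<^sub>F s in at_right 0. a * ((LINT x:E s|lborel. f x) - (\<Sum>p\<le>K1. \<Sum>q\<le>K1. A p q * w p q s))
      + b * ((LINT x:E s|lborel. g x) - (\<Sum>p\<le>K2. \<Sum>q\<le>K2. B p q * w p q s))
      = (LINT x:E s|lborel. a * f x + b * g x) - (\<Sum>p\<le>K. \<Sum>q\<le>K. C p q * w p q s)"
      using eventually_at_right_less[of 0]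
      by eventually_elim (simp add: lint sumC algebra_simps)
  qed
  then show ?thesis
    unfolding has_finite_part_def Let_def using int C
    by (intro conjI allI impI exI[of _ K] exI[of _ C]) (auto simp: E_def w_def mult.assoc)
qed

text \<open>\<open>has_finite_part\<close> is a relation, so the value 0 has to be forced: all
  truncated integrals vanish, hence the expansion itself tends to zero, and uniqueness applies to
  it. The values of \<open>f\<close> at the two points never enter, since the balls remove
  them.\<close>

lemma finite_part_0_unique:
  assumes "has_finite_part y1 y2 f I" "\<And>x. x \<notin> {y1, y2} \<Longrightarrow> f x = 0"
  shows "I = 0"
proof -
  obtain K a where a: "a 0 0 = I"
    and lim: "((\<lambda>s. (LINT x:{x. s < dist x y1 \<and> s < dist x y2}|lborel. f x)
       - (\<Sum>p\<le>K. \<Sum>q\<le>K. a p q * (1 / s ^ p) * ln s ^ q)) \<longlongrightarrow> 0) (at_right 0)"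
    using assms(1) unfolding has_finite_part_def Let_def by auto
  have "(LINT x:{x. s < dist x y1 \<and> s < dist x y2}|lborel. f x) = 0" if "s > 0" for s
  proof -
    have "indicat_real {x. s < dist x y1 \<and> s < dist x y2} x *\<^sub>R f x = 0" for x
      using assms(2)[of x] that by (cases "x \<in> {y1, y2}") (auto simp: indicator_def)
    then show ?thesis by (simp only: set_lebesgue_integral_def integral_zero)
  qed
  then have "\<forall>\<^sub>F s in at_right 0. (LINT x:{x. s < dist x y1 \<and> s < dist x y2}|lborel. f x) = 0"
    using eventually_at_right_less[of 0] by (auto elim: eventually_mono)
  then have "((\<lambda>s. - (\<Sum>p\<le>K. \<Sum>q\<le>K. a p q * (1 / s ^ p) * ln s ^ q)) \<longlongrightarrow> 0) (at_right 0)"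
    using lim by (elim filterlim_mono_eventually[OF _ order_refl order_refl]) (auto elim: eventually_mono)
  from tendsto_minus[OF this] have "a 0 0 = 0"
    by (intro log_power_expansion_unique) simp
  with a show ?thesis by simp
qed

lemma integrable_has_finite_part:
  assumes int: "integrable lborel f"
  shows "has_finite_part y1 y2 f (LINT x|lborel. f x)"
proof -
  define E where "E = (\<lambda>s::real. {x. s < dist x y1 \<and> s < dist x y2})"
  have E: "E s \<in> sets borel" for s
    unfolding E_def by (intro borel_open open_Collect_conj open_Collect_less continuous_intros)
  have AE: "AE x in lborel. x \<notin> {y1, y2}"
    by (intro AE_not_in finite_imp_null_set_lborel) auto
  \<comment> \<open>The radius is written as an inverse so that dominated convergence can be used
    for a parameter tending to infinity.\<close>
  have "((\<lambda>t. LINT x|lborel. indicator (E (inverse t)) x * f x) \<longlongrightarrow> (LINT x|lborel. f x)) at_top"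
  proof (rule integral_dominated_convergence_at_top[where w = "\<lambda>x. \<bar>f x\<bar>"])
    show "AE x in lborel. ((\<lambda>t. indicat_real (E (inverse t)) x * f x) \<longlongrightarrow> f x) at_top"
      using AE
    proof eventually_elim
      fix x assume x: "x \<notin> {y1, y2}"
      have "\<forall>\<^sub>F t in at_top. inverse t < min (dist x y1) (dist x y2)"
        using x by (intro order_tendstoD(2)[OF tendsto_inverse_0_at_top] filterlim_ident) auto
      then have "\<forall>\<^sub>F t in at_top. indicat_real (E (inverse t)) x * f x = f x"
        by eventually_elim (auto simp: E_def)
      then show "((\<lambda>t. indicat_real (E (inverse t)) x * f x) \<longlongrightarrow> f x) at_top"
        by (rule tendsto_eventually)
    qed
    show "\<forall>\<^sub>F t in at_top. AE x in lborel. norm (indicat_real (E (inverse t)) x * f x) \<le> \<bar>f x\<bar>"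
      by (auto simp: indicator_def)
  qed (use int E in auto)
  then have lim0: "((\<lambda>s. LINT x:E s|lborel. f x) \<longlongrightarrow> (LINT x|lborel. f x)) (at_right 0)"
    by (simp add: filterlim_at_right_to_top set_lebesgue_integral_def)
  show ?thesis
    unfolding has_finite_part_def Let_def E_def[symmetric]
  proof (intro conjI allI impI exI[of _ 0] exI[of _ "\<lambda>_ _. LINT x|lborel. f x"])
    show "set_integrable lborel (E s) f" for s
      unfolding set_integrable_def using int E by (intro integrable_mult_indicator) auto
    show "((\<lambda>s. (LINT x:E s|lborel. f x) - (\<Sum>p\<le>0. \<Sum>q\<le>0. (LINT x|lborel. f x) * (1 / s ^ p) * ln s ^ q))
       \<longlongrightarrow> 0) (at_right 0)"
      using tendsto_diff[OF lim0 tendsto_const[of "LINT x|lborel. f x"]] by (simp add: E_def[symmetric])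
  qed simp
qed

subsection \<open>Test potentials with shell-shaped Laplacian\<close>

definition reg_dist :: "point \<Rightarrow> real \<Rightarrow> point \<Rightarrow> real" where
  "reg_dist y e x = sqrt ((norm (x - y))\<^sup>2 + e\<^sup>2)"

lemma reg_dist_0 [simp]: "reg_dist y 0 x = norm (x - y)"
  by (simp add: reg_dist_def)

text \<open>The hypothesis covers both the case e \<noteq> 0 at every point and the case e = 0 away
  from \<open>y\<close>, so that one computation serves the regularised and the true
  distance.\<close>

lemma DERIV_line_reg_dist:
  assumes "reg_dist y e x \<noteq> 0"
  shows "((\<lambda>t. reg_dist y e (x + t *\<^sub>R axis i 1)) has_real_derivative (x - y) $ i / reg_dist y e x) (at 0)"
proof -
  define v where "v = x - y"
  define w where "w = (norm v)\<^sup>2 + e\<^sup>2"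
  have n: "reg_dist y e (x + t *\<^sub>R axis i 1) = sqrt (w + (2 * (v $ i * t) + t\<^sup>2))" for t
  proof -
    have "v $ i * t = v \<bullet> (t *\<^sub>R axis i 1)" by (simp add: inner_axis)
    also have "\<dots> = ((norm (v + t *\<^sub>R axis i 1))\<^sup>2 - (norm v)\<^sup>2 - (norm (t *\<^sub>R axis i (1::real)))\<^sup>2) / 2"
      by (rule dot_norm)
    also have "(norm (t *\<^sub>R axis i (1::real) :: point))\<^sup>2 = t\<^sup>2" by (simp add: norm_axis_1)
    finally have *: "v $ i * t = ((norm (v + t *\<^sub>R axis i 1))\<^sup>2 - (norm v)\<^sup>2 - t\<^sup>2) / 2" .
    have "a = b + (2 * p + c)" if "p = (a - b - c) / 2" for p a b c :: real using that by simp
    from this[OF *] have "(norm (v + t *\<^sub>R axis i 1))\<^sup>2 = (norm v)\<^sup>2 + (2 * (v $ i * t) + t\<^sup>2)" .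
    moreover have "v + t *\<^sub>R axis i 1 = x + t *\<^sub>R axis i 1 - y" by (simp add: v_def)
    ultimately show ?thesis by (simp add: reg_dist_def w_def)
  qed
  let ?q = "\<lambda>t. w + (2 * (v $ i * t) + t\<^sup>2)"
  have w: "0 < w" using assms by (simp add: reg_dist_def w_def v_def less_le)
  have 1: "(?q has_real_derivative 2 * v $ i) (at 0)"
    by (auto intro!: derivative_eq_intros)
  have 2: "(sqrt has_real_derivative inverse (sqrt (?q 0)) / 2) (at (?q 0))"
    by (rule DERIV_real_sqrt) (use w in simp)
  have 3: "inverse (sqrt (?q 0)) / 2 * (2 * v $ i) = v $ i / sqrt w"
    using w by (simp add: field_simps)
  have 4: "reg_dist y e x = sqrt w" by (simp add: reg_dist_def w_def v_def)
  show ?thesis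
    unfolding n 4 v_def[symmetric] using DERIV_chain2[where f=sqrt and g="?q" and x=0, OF 2 1] unfolding 3 .
qed

lemma DERIV_line_norm:
  fixes x y :: point
  assumes "x \<noteq> y"
  shows "((\<lambda>t. norm (x + t *\<^sub>R axis i 1 - y)) has_real_derivative (x - y) $ i / norm (x - y)) (at 0)"
  using DERIV_line_reg_dist[of y 0 x i] assms by simp

lemma DERIV_line_nth:
  fixes x y :: point
  shows "((\<lambda>t. (x + t *\<^sub>R axis i 1 - y) $ j) has_real_derivative kron i j) (at 0)"
  by (auto intro!: derivative_eq_intros simp: kron_def axis_def)

lemma kron_self [simp]: "kron i i = 1"
  by (simp add: kron_def)

lemma norm_sq_sum: "(norm (v::point))\<^sup>2 = v $ 1 ^ 2 + v $ 2 ^ 2 + v $ 3 ^ 2"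
  by (simp add: norm_vec3_sq sum_3)

lemma inner_sum: "(v::point) \<bullet> w = v $ 1 * w $ 1 + v $ 2 * w $ 2 + v $ 3 * w $ 3"
  by (simp add: inner_vec_def sum_3)

lemma continuous_on_reg_dist: "continuous_on UNIV (reg_dist y e)"
  unfolding reg_dist_def[abs_def] by (intro continuous_intros)

lemma pd_inverse_reg_dist:
  assumes "reg_dist y e x \<noteq> 0"
  shows "pd i (\<lambda>x. c / reg_dist y e x) x = - c * (x - y) $ i / reg_dist y e x ^ 3"
  by (intro pd_eqI, rule DERIV_cong[OF DERIV_divide[OF DERIV_const DERIV_line_reg_dist[OF assms]]])
    (use assms in \<open>simp_all add: field_simps power3_eq_cube\<close>)

lemma pd_pd_inverse_reg_dist:
  assumes "reg_dist y e x \<noteq> 0"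
  shows "pd j (pd i (\<lambda>x. c / reg_dist y e x)) x =
    - c * (kron j i / reg_dist y e x ^ 3 - 3 * (x - y) $ i * (x - y) $ j / reg_dist y e x ^ 5)"
proof -
  have op: "open {x. reg_dist y e x \<noteq> 0}"
    by (intro open_Collect_neq continuous_on_reg_dist continuous_on_const)
  have "pd j (pd i (\<lambda>x. c / reg_dist y e x)) x = pd j (\<lambda>x. - c * (x - y) $ i / reg_dist y e x ^ 3) x"
    by (rule pd_cong[OF op]) (use assms in \<open>simp_all add: pd_inverse_reg_dist\<close>)
  also have "\<dots> = - c * (kron j i / reg_dist y e x ^ 3 - 3 * (x - y) $ i * (x - y) $ j / reg_dist y e x ^ 5)"
  proof -
    note * = DERIV_divide[OF DERIV_cmult[OF DERIV_line_nth[of x j y i], of "- c"]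
        DERIV_power[OF DERIV_line_reg_dist[OF assms, of j], of 3]]
    show ?thesis
      using assms by (intro pd_eqI DERIV_cong[OF *]) (simp_all add: field_simps eval_nat_numeral)
  qed
  finally show ?thesis .
qed

text \<open>For small e this is an approximation of -4 pi c times the delta function at
  \<open>y\<close>; for e = 0 it is the harmonicity of 1/r.\<close>

lemma laplacian_inverse_reg_dist:
  assumes "reg_dist y e x \<noteq> 0"
  shows "laplacian (\<lambda>x. c / reg_dist y e x) x = - 3 * c * e\<^sup>2 / reg_dist y e x ^ 5"
proof -
  define v where "v = x - y"
  have "(reg_dist y e x)\<^sup>2 = (norm v)\<^sup>2 + e\<^sup>2" by (simp add: reg_dist_def v_def)
  then have e: "e\<^sup>2 = (reg_dist y e x)\<^sup>2 - (v $ 1 ^ 2 + v $ 2 ^ 2 + v $ 3 ^ 2)"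
    by (simp add: norm_sq_sum)
  show ?thesis
    unfolding laplacian_def pd_pd_inverse_reg_dist[OF assms] sum_3 v_def[symmetric] e
    using assms by (simp add: field_simps eval_nat_numeral)
qed

lemmas pd_inverse_norm = pd_inverse_reg_dist[of _ 0, unfolded reg_dist_0 norm_eq_zero right_minus_eq zero_power2 mult_zero_right div_0]
  and laplacian_inverse_norm = laplacian_inverse_reg_dist[of _ 0, unfolded reg_dist_0 norm_eq_zero right_minus_eq zero_power2 mult_zero_right div_0]

text \<open>Made for profiles that are known only as antiderivatives, without an explicit tower of
  derivatives: by the chain rule, smoothness of \<open>G'\<close> after \<open>f\<close> yields
  smoothness of \<open>G\<close> after \<open>f\<close>.\<close>

lemma smooth_on_compose_antiderivative:
  assumes S: "open S" and f: "smooth_on S f"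
    and G: "\<And>t. (G has_real_derivative G' t) (at t)" and G': "smooth_on S (\<lambda>x. G' (f x))"
  shows "smooth_on S (\<lambda>x. G (f x))"
  unfolding smooth_on_def
proof
  fix k
  have dif: "f differentiable (at x)" if "x \<in> S" for x
    using smooth_on_differentiable[OF f S that] .
  have *: "(\<lambda>x. G (f x)) differentiable_on S"
  proof -
    have "(\<lambda>x. G (f x)) differentiable (at x)" if "x \<in> S" for x
    proof -
      have "G differentiable (at (f x))" using G real_differentiable_def by blast
      from differentiable_chain_at[OF dif[OF that] this] show ?thesis by (simp add: o_def)
    qed
    then show ?thesis using S by (simp add: differentiable_on_eq_differentiable_at)
  qed
  show "Ck_on k S (\<lambda>x. G (f x))"
  proof (cases k)
    case 0
    then show ?thesis using * by (simp add: differentiable_imp_continuous_on)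
  next
    case (Suc m)
    have "Ck_on m S (pd i (\<lambda>x. G (f x)))" for i
    proof (subst Ck_on_cong[OF S])
      show "pd i (\<lambda>x. G (f x)) x = G' (f x) * pd i f x" if "x \<in> S" for x
        by (intro pd_compose dif G that)
      have "smooth_on S (\<lambda>x. G' (f x) * pd i f x)"
        by (intro smooth_intros S f G')
      then show "Ck_on m S (\<lambda>x. G' (f x) * pd i f x)" by (simp add: smooth_on_def)
    qed
    with Suc * show ?thesis by simp
  qed
qed

text \<open>With u = 1/t one has du/dt = -u^2, so the derivative of p(u) exp(-u) is u^2 (p - p')(u)
  exp(-u). These are the polynomials in the derivatives of exp(-1/t).\<close>

primrec flat_poly :: "nat \<Rightarrow> real poly" where
  "flat_poly 0 = 1"
| "flat_poly (Suc n) = [:0, 0, 1:] * (flat_poly n - pderiv (flat_poly n))"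

definition flat_exp :: "nat \<Rightarrow> real \<Rightarrow> real" where
  "flat_exp n t = (if 0 < t then poly (flat_poly n) (1 / t) * exp (- (1 / t)) else 0)"

lemma flat_exp_DERIV: "(flat_exp n has_real_derivative flat_exp (Suc n) t) (at t)"
proof -
  consider "t < 0" | "t > 0" | "t = 0" by linarith
  then show ?thesis
  proof cases
    case 1
    have "((\<lambda>_. 0) has_real_derivative 0) (at t)" by simp
    then have "(flat_exp n has_real_derivative 0) (at t)"
      by (rule has_field_derivative_transform_within_open[where S="{..<0}"])
        (use 1 in \<open>auto simp: flat_exp_def\<close>)
    then show ?thesis using 1 by (simp add: flat_exp_def)
  next
    case 2
    have inv: "((\<lambda>t. 1 / t) has_real_derivative - ((1 / t) * (1 / t))) (at t)"
      using 2 by (auto intro!: derivative_eq_intros simp: divide_inverse)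
    have "((\<lambda>t. poly (flat_poly n) (1 / t) * exp (- (1 / t))) has_real_derivative flat_exp (Suc n) t) (at t)"
      by (rule DERIV_cong[OF DERIV_mult[OF DERIV_chain2[where g="\<lambda>t. 1 / t", OF poly_DERIV inv]
            DERIV_chain2[where g="\<lambda>t. - (1 / t)", OF DERIV_exp DERIV_minus[OF inv]]]])
        (use 2 in \<open>simp add: flat_exp_def field_simps\<close>)
    then show ?thesis
      by (rule has_field_derivative_transform_within_open[where S="{0<..}"])
        (use 2 in \<open>auto simp: flat_exp_def\<close>)
  next
    case 3
    \<comment> \<open>At the origin the right-hand quotient becomes, with x = 1/h, a polynomial
      times exp(-x).\<close>
    have "((\<lambda>h. flat_exp n h / h) \<longlongrightarrow> 0) (at 0)"
    proof (rule filterlim_split_at)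
      show "((\<lambda>h. flat_exp n h / h) \<longlongrightarrow> 0) (at_left 0)"
        by (rule tendsto_eventually) (auto simp: flat_exp_def eventually_at_filter)
      have "\<forall>\<^sub>F x in at_top. poly ([:0, 1:] * flat_poly n) x * exp (- x) = flat_exp n (inverse x) / inverse x"
        using eventually_gt_at_top[of 0] by eventually_elim (simp add: flat_exp_def divide_inverse)
      with poly_exp_minus_tendsto_0[of "[:0, 1:] * flat_poly n"]
      have "((\<lambda>x. flat_exp n (inverse x) / inverse x) \<longlongrightarrow> 0) at_top"
        by (rule Lim_transform_eventually)
      then show "((\<lambda>h. flat_exp n h / h) \<longlongrightarrow> 0) (at_right 0)"
        by (simp add: filterlim_at_right_to_top)
    qed
    with 3 show ?thesis by (simp add: DERIV_def flat_exp_def)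
  qed
qed

definition bump :: "real \<Rightarrow> real" where
  "bump t = flat_exp 0 (t - 1) * flat_exp 0 (2 - t)"

lemma bump_nonneg: "0 \<le> bump t"
  by (simp add: bump_def flat_exp_def)

lemma bump_eq_0_iff: "bump t = 0 \<longleftrightarrow> t \<le> 1 \<or> 2 \<le> t"
  by (auto simp: bump_def flat_exp_def)

lemma smooth_on_bump:
  assumes "open S" "smooth_on S f" shows "smooth_on S (\<lambda>x. bump (f x))"
proof -
  have flat: "smooth_on S (\<lambda>x. flat_exp 0 (g x))" if "smooth_on S g" for g
    using assms(1) that by (rule smooth_on_compose[where T=UNIV and D=flat_exp]) (auto intro: flat_exp_DERIV)
  show ?thesis
    unfolding bump_def[abs_def] by (intro smooth_on_mult flat smooth_on_diff smooth_on_const assms)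
qed

lemma isCont_bump: "isCont bump t"
proof -
  have "isCont (flat_exp 0) t" for t using flat_exp_DERIV by (rule DERIV_isCont)
  then show ?thesis unfolding bump_def[abs_def]
    using isCont_o2[where g="flat_exp 0" and f="\<lambda>t. t - 1" and a=t]
      isCont_o2[where g="flat_exp 0" and f="\<lambda>t. 2 - t" and a=t] by (intro isCont_mult) auto
qed

lemma DERIV_zero_const_interval:
  assumes "\<And>t. (G has_real_derivative G' t) (at t)" "\<And>t. t \<in> S \<Longrightarrow> G' t = 0" "convex S" "s \<in> S" "t \<in> S"
  shows "G s = G t"
proof -
  have "\<exists>c. \<forall>x\<in>S. G x = c"
    using assms(1,2,3)
    by (intro has_field_derivative_zero_constant) (auto intro: has_field_derivative_at_within simp flip: assms(2))
  with assms(4,5) show ?thesis by auto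
qed

text \<open>The function -\<open>bump\<close> is integrated twice. The first constant makes the
  slope vanish from 2 on; the second makes the straight part on t \<le> 1 pass through the origin,
  so that h(\<delta>/r)/\<delta> equals c/r for r \<ge> \<delta>, with the same c for all
  \<delta>.\<close>

lemma concave_profile:
  obtains h h' :: "real \<Rightarrow> real" and c where
    "\<And>t. (h has_real_derivative h' t) (at t)" "\<And>t. (h' has_real_derivative - bump t) (at t)"
    "\<And>t. t \<le> 1 \<Longrightarrow> h t = c * t" "\<And>t. 2 \<le> t \<Longrightarrow> h t = h 2"
proof -
  have ex: "\<exists>F. \<forall>t. (F has_real_derivative f t) (at t)" if "\<And>t. isCont f t" for f :: "real \<Rightarrow> real"
    using einterval_antiderivative[of "-\<infinity>" \<infinity> f] that
    by (auto simp: has_real_derivative_iff_has_vector_derivative)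
  obtain B where B: "\<And>t. (B has_real_derivative bump t) (at t)" using ex[OF isCont_bump] by blast
  define h' where "h' t = B 2 - B t" for t
  have h': "(h' has_real_derivative - bump t) (at t)" for t
    unfolding h'_def[abs_def] by (auto intro!: derivative_eq_intros B)
  have h'1: "h' t = h' 1" if "t \<le> 1" for t
    by (rule DERIV_zero_const_interval[OF h', where S="{..1}"]) (use that in \<open>auto simp: bump_eq_0_iff\<close>)
  have h'2: "h' t = h' 2" if "2 \<le> t" for t
    by (rule DERIV_zero_const_interval[OF h', where S="{2..}"]) (use that in \<open>auto simp: bump_eq_0_iff\<close>)
  have h'2: "h' t = 0" if "2 \<le> t" for t using h'2[OF that] by (simp add: h'_def)
  obtain A where A: "\<And>t. (A has_real_derivative h' t) (at t)" using ex[OF DERIV_isCont[OF h']] by blast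
  define h where "h t = A t - A 1 + h' 1" for t
  have h: "(h has_real_derivative h' t) (at t)" for t
    unfolding h_def[abs_def] by (auto intro!: derivative_eq_intros A)
  have "h t - h' 1 * t = h 1 - h' 1 * 1" if "t \<le> 1" for t
  proof (rule DERIV_zero_const_interval[where S="{..1}" and G="\<lambda>t. h t - h' 1 * t" and G'="\<lambda>t. h' t - h' 1"])
    show "((\<lambda>t. h t - h' 1 * t) has_real_derivative h' t - h' 1) (at t)" for t
      by (auto intro!: derivative_eq_intros h)
    show "h' t - h' 1 = 0" if "t \<in> {..1}" for t using h'1[of t] that by simp
  qed (use that in auto)
  then have "h t = h' 1 * t" if "t \<le> 1" for t using that by (simp add: h_def)
  moreover have "h t = h 2" if "2 \<le> t" for t
    by (rule DERIV_zero_const_interval[OF h, where S="{2..}"]) (use that h'2 in auto)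
  ultimately show ?thesis using that[of h h' "h' 1"] h h' by blast
qed

text \<open>
  For a concave profile \<open>h\<close>, linear up to 1 and constant from 2 on, the function \<open>h(\<delta>/r)/\<delta>\<close> is a
  smooth truncation of a multiple of \<open>1/r\<close>, and its Laplacian \<open>\<delta> h''(\<delta>/r)/r\<^sup>4\<close> has a sign. The
  difference of two of them is a test function, which replaces the mean value property.
\<close>

definition shell :: "point \<Rightarrow> real \<Rightarrow> point \<Rightarrow> real" where
  "shell x0 \<delta> x = \<delta> * bump (\<delta> / norm (x - x0)) / norm (x - x0) ^ 4"

lemma shell_nonneg: "0 < \<delta> \<Longrightarrow> 0 \<le> shell x0 \<delta> x"
  by (simp add: shell_def bump_nonneg)

lemma shell_neq_0D:
  assumes "shell x0 \<delta> x \<noteq> 0" "0 < \<delta>" shows "\<delta> / 2 < norm (x - x0)" "norm (x - x0) < \<delta>"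
proof -
  have "1 < \<delta> / norm (x - x0)" "\<delta> / norm (x - x0) < 2" and "0 < norm (x - x0)"
    using assms(1) by (auto simp: shell_def bump_eq_0_iff)
  then show "\<delta> / 2 < norm (x - x0)" "norm (x - x0) < \<delta>" by (auto simp: field_simps)
qed

text \<open>Since \<delta>/r is harmonic off \<open>x0\<close>, the term with h' drops out of the
  Laplacian and only h'' times |grad(\<delta>/r)|^2 = \<delta>^2/r^4 remains. The constant
  \<open>c\<close> is chosen before \<delta>, so differences of two potentials vanish far
  away.\<close>

lemma shell_potential:
  fixes x0 :: point
  obtains \<Phi> :: "real \<Rightarrow> point \<Rightarrow> real" and c where
    "\<And>\<delta>. 0 < \<delta> \<Longrightarrow> smooth_on UNIV (\<Phi> \<delta>)"
    "\<And>\<delta> x. 0 < \<delta> \<Longrightarrow> laplacian (\<Phi> \<delta>) x = - shell x0 \<delta> x"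
    "\<And>\<delta> x. 0 < \<delta> \<Longrightarrow> \<delta> \<le> norm (x - x0) \<Longrightarrow> \<Phi> \<delta> x = c / norm (x - x0)"
proof -
  obtain h h' c where h: "\<And>t. (h has_real_derivative h' t) (at t)"
    and h': "\<And>t. (h' has_real_derivative - bump t) (at t)"
    and h1: "\<And>t. t \<le> 1 \<Longrightarrow> h t = c * t" and h2: "\<And>t. 2 \<le> t \<Longrightarrow> h t = h 2"
    using concave_profile by blast
  (* The case split is only needed at x0, where \<delta> / norm (x - x0) has the junk value 0. *)
  define \<Phi> where "\<Phi> \<delta> x = (if norm (x - x0) < \<delta> / 2 then h 2 / \<delta> else h (\<delta> / norm (x - x0)) / \<delta>)" for \<delta> x
  have op: "open (- {x0})" by (intro open_Compl) auto
  have out: "\<Phi> \<delta> x = (1 / \<delta>) * h (\<delta> / norm (x - x0))" if "0 < \<delta>" "x \<in> - {x0}" for \<delta> x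
    using h2[of "\<delta> / norm (x - x0)"] that by (simp add: \<Phi>_def field_simps)
  have ins: "\<Phi> \<delta> x = h 2 / \<delta>" if "x \<in> ball x0 (\<delta> / 2)" for \<delta> x
    using that by (simp add: \<Phi>_def dist_norm norm_minus_commute)
  have smr: "smooth_on (- {x0}) (\<lambda>x. \<delta> / norm (x - x0))" for \<delta>
    by (intro smooth_intros) auto
  have smh': "smooth_on (- {x0}) (\<lambda>x. h' (\<delta> / norm (x - x0)))" for \<delta>
    by (intro smooth_on_compose_antiderivative[OF op smr h'] smooth_on_minus smooth_on_bump smr op)
  have smh: "smooth_on (- {x0}) (\<lambda>x. h (\<delta> / norm (x - x0)))" for \<delta>
    by (intro smooth_on_compose_antiderivative[OF op smr h] smh')
  have sm: "smooth_on UNIV (\<Phi> \<delta>)" if "0 < \<delta>" for \<delta>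
  proof -
    have "smooth_on (- {x0}) (\<Phi> \<delta>)"
      by (rule smooth_on_cong[OF op out[OF that], THEN iffD2]) (simp, intro smooth_on_mult smooth_on_const smh op)
    moreover have "smooth_on (ball x0 (\<delta> / 2)) (\<Phi> \<delta>)"
      by (rule smooth_on_cong[OF open_ball ins, THEN iffD2]) (simp, intro smooth_on_const)
    ultimately have "smooth_on (- {x0} \<union> ball x0 (\<delta> / 2)) (\<Phi> \<delta>)"
      by (intro smooth_on_Un) auto
    moreover have "- {x0} \<union> ball x0 (\<delta> / 2) = UNIV" using that by auto
    ultimately show ?thesis by simp
  qed
  have lap: "laplacian (\<Phi> \<delta>) x = - shell x0 \<delta> x" if \<delta>: "0 < \<delta>" for \<delta> x
  proof (cases "x = x0")
    \<comment> \<open>At the centre \<delta>/0 = 0 makes the shell function vanish, in agreement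
      with the potential being constant nearby.\<close>
    case True
    have "pd i (pd i (\<Phi> \<delta>)) x0 = pd i (\<lambda>x. 0) x0" for i
    proof (rule pd_cong[of "ball x0 (\<delta> / 2)"])
      fix y assume "y \<in> ball x0 (\<delta> / 2)"
      then have "pd i (\<Phi> \<delta>) y = pd i (\<lambda>x. h 2 / \<delta>) y"
        by (rule pd_cong[OF open_ball _ ins])
      then show "pd i (\<Phi> \<delta>) y = 0" by simp
    qed (use \<delta> in auto)
    then show ?thesis using True by (simp add: laplacian_def shell_def)
  next
    case False
    let ?\<rho> = "\<lambda>x. \<delta> / norm (x - x0)"
    define v where "v = x - x0"
    note dif = smooth_on_differentiable[OF _ op]
    have pd1: "pd i (\<Phi> \<delta>) z = (1 / \<delta>) * (h' (?\<rho> z) * pd i ?\<rho> z)" if z: "z \<in> - {x0}" for i z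
    proof -
      have "pd i (\<Phi> \<delta>) z = pd i (\<lambda>x. (1 / \<delta>) * h (?\<rho> x)) z"
        by (rule pd_cong[OF op z out[OF \<delta>]])
      also have "\<dots> = (1 / \<delta>) * (h' (?\<rho> z) * pd i ?\<rho> z)"
        by (subst pd_cmult[OF dif[OF smh z]], subst pd_compose[OF dif[OF smr z] h]) simp
      finally show ?thesis .
    qed
    have x: "x \<in> - {x0}" using False by simp
    have *: "pd i (pd i (\<Phi> \<delta>)) x
        = (1 / \<delta>) * (- bump (?\<rho> x) * (pd i ?\<rho> x)\<^sup>2 + h' (?\<rho> x) * pd i (pd i ?\<rho>) x)" for i
    proof -
      have "pd i (pd i (\<Phi> \<delta>)) x = pd i (\<lambda>z. (1 / \<delta>) * (h' (?\<rho> z) * pd i ?\<rho> z)) x"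
        by (rule pd_cong[OF op x pd1])
      also have "\<dots> = (1 / \<delta>) * (pd i (\<lambda>z. h' (?\<rho> z)) x * pd i ?\<rho> x + h' (?\<rho> x) * pd i (pd i ?\<rho>) x)"
        by (subst pd_cmult, intro dif[OF _ x] smooth_on_mult op smh' smooth_on_pd smr,
            subst pd_mult, (intro dif[OF _ x] smh' smooth_on_pd smr)+, simp)
      also have "pd i (\<lambda>z. h' (?\<rho> z)) x = - bump (?\<rho> x) * pd i ?\<rho> x"
        by (rule pd_compose[OF dif[OF smr x] h'])
      finally show ?thesis by (simp add: power2_eq_square)
    qed
    have "laplacian (\<Phi> \<delta>) x = (1 / \<delta>) * (- bump (?\<rho> x) * (\<Sum>i\<in>UNIV. (pd i ?\<rho> x)\<^sup>2)
        + h' (?\<rho> x) * (\<Sum>i\<in>UNIV. pd i (pd i ?\<rho>) x))"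
      unfolding laplacian_def * sum_3 by (simp only: distrib_left ac_simps)
    moreover have "(\<Sum>i\<in>UNIV. (pd i ?\<rho> x)\<^sup>2) = \<delta>\<^sup>2 / norm (x - x0) ^ 4"
    proof -
      have "(\<Sum>i\<in>UNIV. (pd i ?\<rho> x)\<^sup>2) = \<delta>\<^sup>2 * (norm (x - x0))\<^sup>2 / (norm (x - x0) ^ 3)\<^sup>2"
        unfolding pd_inverse_norm[OF False] sum_3 norm_sq_sum[of v] v_def[symmetric]
        by (simp add: power_divide power_mult_distrib distrib_left add_divide_distrib)
      then show ?thesis using False by (simp add: field_simps eval_nat_numeral)
    qed
    moreover have "(\<Sum>i\<in>UNIV. pd i (pd i ?\<rho>) x) = 0"
      using laplacian_inverse_norm[of x x0 \<delta>] False by (simp add: laplacian_def)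
    ultimately show ?thesis using \<delta> by (simp add: shell_def power2_eq_square)
  qed
  have "\<Phi> \<delta> x = c / norm (x - x0)" if "0 < \<delta>" "\<delta> \<le> norm (x - x0)" for \<delta> x
    using that out[of \<delta> x] h1[of "\<delta> / norm (x - x0)"] by (cases "x = x0") auto
  with sm lap that show ?thesis by blast
qed

subsection \<open>A Liouville theorem\<close>

text \<open>One estimate for the two limits in the Liouville theorem: \<open>v\<close> is
  \<open>w x0\<close> for a small shell and 0 for a large one.\<close>

lemma shell_integral_close:
  assumes w: "integrable lborel (\<lambda>x. w x * shell x0 \<delta> x)" and K: "integrable lborel (shell x0 \<delta>)"
    and "0 < \<delta>" and close: "\<And>x. \<delta> / 2 < norm (x - x0) \<Longrightarrow> norm (x - x0) < \<delta> \<Longrightarrow> \<bar>w x - v\<bar> \<le> \<epsilon>"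
  shows "\<bar>(LINT x|lborel. w x * shell x0 \<delta> x) - v * (LINT x|lborel. shell x0 \<delta> x)\<bar>
    \<le> \<epsilon> * (LINT x|lborel. shell x0 \<delta> x)"
proof -
  have "(LINT x|lborel. w x * shell x0 \<delta> x) - v * (LINT x|lborel. shell x0 \<delta> x)
      = (LINT x|lborel. w x * shell x0 \<delta> x - v * shell x0 \<delta> x)"
    using w K by simp
  also have "\<bar>\<dots>\<bar> \<le> (LINT x|lborel. \<bar>w x * shell x0 \<delta> x - v * shell x0 \<delta> x\<bar>)"
    by (rule integral_abs_bound)
  also have "\<dots> \<le> (LINT x|lborel. \<epsilon> * shell x0 \<delta> x)"
  proof (rule integral_mono)
    fix x
    show "\<bar>w x * shell x0 \<delta> x - v * shell x0 \<delta> x\<bar> \<le> \<epsilon> * shell x0 \<delta> x"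
    proof (cases "shell x0 \<delta> x = 0")
      case False
      then have "\<bar>w x - v\<bar> \<le> \<epsilon>" using close shell_neq_0D[OF False \<open>0 < \<delta>\<close>] by blast
      then have "\<bar>w x - v\<bar> * shell x0 \<delta> x \<le> \<epsilon> * shell x0 \<delta> x"
        by (rule mult_right_mono) (rule shell_nonneg[OF \<open>0 < \<delta>\<close>])
      then show ?thesis
        using shell_nonneg[OF \<open>0 < \<delta>\<close>, of x0 x] by (simp add: abs_mult flip: left_diff_distrib)
    qed simp
  qed (use w K in auto)
  finally show ?thesis using K by simp
qed

text \<open>Testing with the difference of two shell potentials shows that the integral of
  \<open>w\<close> against the shell function is the same for all radii. For small radii it is close
  to \<open>w x0\<close> times the mass \<open>k\<close> by continuity, for large radii it is close
  to zero by decay. Points of \<open>A\<close> inside a shell do no harm, since only local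
  integrability is used there.\<close>

theorem weakly_harmonic_vanishing_at_infinity:
  assumes loc: "locally_integrable w" and cont: "continuous_on (- A) w" and "finite A"
    and inf: "(w \<longlongrightarrow> 0) at_infinity"
    and weak: "\<And>\<phi>. test_function \<phi> \<Longrightarrow> (LINT x|lborel. w x * laplacian \<phi> x) = 0"
    and x0: "x0 \<notin> A"
  shows "w x0 = 0"
proof -
  obtain \<Phi> c where sm: "\<And>\<delta>. 0 < \<delta> \<Longrightarrow> smooth_on UNIV (\<Phi> \<delta>)"
    and lap: "\<And>\<delta> x. 0 < \<delta> \<Longrightarrow> laplacian (\<Phi> \<delta>) x = - shell x0 \<delta> x"
    and out: "\<And>\<delta> x. 0 < \<delta> \<Longrightarrow> \<delta> \<le> norm (x - x0) \<Longrightarrow> \<Phi> \<delta> x = c / norm (x - x0)"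
    using shell_potential[of x0] by blast
  have contK: "continuous_on UNIV (shell x0 \<delta>)" if "0 < \<delta>" for \<delta>
  proof -
    have "continuous_on UNIV (\<lambda>x. - laplacian (\<Phi> \<delta>) x)"
      by (intro continuous_on_minus laplacian_continuous sm that)
    then show ?thesis by (simp add: lap[OF that])
  qed
  have suppK: "has_support_in_cball (shell x0 \<delta>) (\<delta> + norm x0)" if "0 < \<delta>" for \<delta>
    unfolding has_support_in_cball_def
  proof (intro allI impI, rule ccontr)
    fix x assume "\<delta> + norm x0 < norm x" "shell x0 \<delta> x \<noteq> 0"
    with shell_neq_0D(2)[of x0 \<delta> x] that norm_triangle_ineq2[of x x0] show False by auto
  qed
  have intK: "integrable lborel (shell x0 \<delta>)" if "0 < \<delta>" for \<delta>
    by (rule integrable_continuous_support[OF contK suppK]) (use that in auto)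
  have intwK: "integrable lborel (\<lambda>x. w x * shell x0 \<delta> x)" if "0 < \<delta>" for \<delta>
    by (rule integrable_locally_integrable_mult[OF loc contK suppK]) (use that in auto)
  have test: "test_function (\<lambda>x. \<Phi> \<delta> x - \<Phi> \<rho> x)" if "0 < \<delta>" "0 < \<rho>" for \<delta> \<rho>
    unfolding test_function_def
  proof
    show "smooth_on UNIV (\<lambda>x. \<Phi> \<delta> x - \<Phi> \<rho> x)" by (intro smooth_on_diff sm that) auto
    have "{x. \<Phi> \<delta> x - \<Phi> \<rho> x \<noteq> 0} \<subseteq> ball x0 (max \<delta> \<rho>)"
    proof (intro subsetI, rule ccontr)
      fix x assume "x \<in> {x. \<Phi> \<delta> x - \<Phi> \<rho> x \<noteq> 0}" "x \<notin> ball x0 (max \<delta> \<rho>)"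
      then show False using out[OF that(1), of x] out[OF that(2), of x]
        by (auto simp: dist_norm norm_minus_commute)
    qed
    then show "bounded {x. \<Phi> \<delta> x - \<Phi> \<rho> x \<noteq> 0}" using bounded_ball bounded_subset by blast
  qed
  have laptest: "laplacian (\<lambda>x. \<Phi> \<delta> x - \<Phi> \<rho> x) x = shell x0 \<rho> x - shell x0 \<delta> x" if "0 < \<delta>" "0 < \<rho>" for \<delta> \<rho> x
  proof -
    have d: "pd i (\<lambda>x. f x - g x) = (\<lambda>z. pd i f z - pd i g z)"
      if f: "smooth_on UNIV f" and g: "smooth_on UNIV g" for f g i
    proof
      fix z
      have g': "smooth_on UNIV (\<lambda>x. (-1) * g x)" by (rule smooth_on_mult[OF open_UNIV smooth_on_const g])
      have "pd i (\<lambda>x. f x + (-1) * g x) z = pd i f z + (-1) * pd i g z"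
        unfolding pd_add[OF smooth_UNIV_dif[OF f] smooth_UNIV_dif[OF g']] pd_cmult[OF smooth_UNIV_dif[OF g]] ..
      then show "pd i (\<lambda>x. f x - g x) z = pd i f z - pd i g z" by simp
    qed
    have "laplacian (\<lambda>x. \<Phi> \<delta> x - \<Phi> \<rho> x) x = laplacian (\<Phi> \<delta>) x - laplacian (\<Phi> \<rho>) x"
      unfolding laplacian_def d[OF sm[OF that(1)] sm[OF that(2)]]
        d[OF smooth_on_pd[OF sm[OF that(1)]] smooth_on_pd[OF sm[OF that(2)]]]
      by (rule sum_subtractf)
    then show ?thesis by (simp add: lap that)
  qed
  define k where "k = (LINT x|lborel. shell x0 1 x)"
  \<comment> \<open>Green's identity with the harmonic function 1: all shells have the same
    mass.\<close>
  have k: "(LINT x|lborel. shell x0 \<delta> x) = k" if "0 < \<delta>" for \<delta>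
  proof -
    have "(LINT x|lborel. (\<lambda>_. 1) x * laplacian (\<lambda>x. \<Phi> 1 x - \<Phi> \<delta> x) x)
        = (LINT x|lborel. laplacian (\<lambda>_. 1) x * (\<Phi> 1 x - \<Phi> \<delta> x))"
      by (rule green_identity[OF smooth_on_const test]) (use that in auto)
    then have "(LINT x|lborel. shell x0 \<delta> x - shell x0 1 x) = 0"
      using that by (simp add: laptest laplacian_def[of "\<lambda>_. 1"])
    then show ?thesis using that by (simp add: k_def intK)
  qed
  have wk: "(LINT x|lborel. w x * shell x0 \<delta> x) = (LINT x|lborel. w x * shell x0 \<rho> x)"
    if "0 < \<delta>" "0 < \<rho>" for \<delta> \<rho>
    using weak[OF test[OF that(2,1)]] that intwK by (simp add: laptest right_diff_distrib)
  have kpos: "0 < k"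
  proof -
    have "0 \<le> k" unfolding k_def by (intro integral_nonneg_AE AE_I2 shell_nonneg) simp
    moreover have "k \<noteq> 0"
    proof
      assume "k = 0"
      then have "AE x in lborel. shell x0 1 x = 0"
        using integral_nonneg_eq_0_iff_AE[OF intK[of 1]] shell_nonneg[of 1 x0] by (simp add: k_def)
      moreover have "{x \<in> space lborel. \<not> shell x0 1 x = 0} \<in> sets lborel"
        using contK[of 1] by (simp, intro borel_open open_Collect_neq continuous_on_const)
      ultimately have "{x. shell x0 1 x \<noteq> 0} \<in> null_sets lborel"
        using AE_iff_null[of lborel "\<lambda>x. shell x0 1 x = 0"] by simp
      then have "negligible {x. shell x0 1 x \<noteq> 0}"
        by (simp add: negligible_iff_null_sets null_sets_completionI)
      moreover have "open {x. shell x0 1 x \<noteq> 0}"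
        using contK[of 1] by (intro open_Collect_neq continuous_on_const) auto
      \<comment> \<open>At distance 2/3 the argument of \<open>bump\<close> is 3/2, inside the
        interval (1,2) where it is positive.\<close>
      moreover have "shell x0 1 (x0 + (2/3) *\<^sub>R axis 1 1) \<noteq> 0"
        by (simp add: shell_def bump_eq_0_iff norm_axis_1)
      ultimately show False using open_not_negligible by blast
    qed
    ultimately show ?thesis by simp
  qed
  have "\<bar>w x0\<bar> \<le> 2 * \<epsilon>" if \<epsilon>: "0 < \<epsilon>" for \<epsilon>
  proof -
    have op: "open (- A)" using \<open>finite A\<close> by (simp add: finite_imp_closed open_Compl)
    then have "isCont w x0" using cont x0 by (simp add: continuous_on_eq_continuous_at)
    then obtain \<delta> where \<delta>: "0 < \<delta>" "\<And>x. dist x x0 < \<delta> \<Longrightarrow> dist (w x) (w x0) < \<epsilon>"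
      using \<epsilon> unfolding continuous_at_eps_delta by blast
    have 1: "\<bar>(LINT x|lborel. w x * shell x0 \<delta> x) - w x0 * k\<bar> \<le> \<epsilon> * k"
      unfolding k[OF \<delta>(1), symmetric]
      by (rule shell_integral_close[OF intwK[OF \<delta>(1)] intK[OF \<delta>(1)] \<delta>(1)])
        (use \<delta>(2) in \<open>auto simp: dist_norm less_imp_le\<close>)
    obtain M where M: "\<And>x. M \<le> norm x \<Longrightarrow> \<bar>w x\<bar> < \<epsilon>"
      using tendstoD[OF inf \<epsilon>] unfolding eventually_at_infinity by auto
    \<comment> \<open>The shell lies beyond distance \<rho>/2 from \<open>x0\<close>; this choice
      puts it where norm x \<ge> M.\<close>
    define \<rho> where "\<rho> = 2 * (\<bar>M\<bar> + norm x0 + 1)"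
    have \<rho>: "0 < \<rho>" by (simp add: \<rho>_def add_nonneg_pos)
    have "\<bar>(LINT x|lborel. w x * shell x0 \<rho> x) - 0 * k\<bar> \<le> \<epsilon> * k"
      unfolding k[OF \<rho>, symmetric]
    proof (rule shell_integral_close[OF intwK[OF \<rho>] intK[OF \<rho>] \<rho>])
      fix x assume "\<rho> / 2 < norm (x - x0)"
      then have "M \<le> norm x" using norm_triangle_ineq4[of x x0] by (simp add: \<rho>_def)
      then show "\<bar>w x - 0\<bar> \<le> \<epsilon>" using M[of x] by simp
    qed
    with 1 wk[OF \<delta>(1) \<rho>] have "\<bar>w x0 * k\<bar> \<le> (2 * \<epsilon>) * k" by (simp add: abs_le_iff)
    then show ?thesis using kpos by (simp add: abs_mult)
  qed
  \<comment> \<open>With \<epsilon> = |w x0|/4 the estimate reads |w x0| \<le> |w x0|/2.\<close>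
  from this[of "\<bar>w x0\<bar> / 4"] show ?thesis by (cases "w x0 = 0") auto
qed

subsection \<open>Distributional Laplacians by regularisation\<close>

lemma laplacian_mult:
  assumes "open S" "smooth_on S f" "smooth_on S g" "x \<in> S"
  shows "laplacian (\<lambda>x. f x * g x) x
    = laplacian f x * g x + 2 * (\<Sum>i\<in>UNIV. pd i f x * pd i g x) + f x * laplacian g x"
proof -
  note dif = smooth_on_differentiable[OF _ assms(1)]
  have "pd i (pd i (\<lambda>x. f x * g x)) x = pd i (pd i f) x * g x + 2 * (pd i f x * pd i g x) + f x * pd i (pd i g) x" for i
  proof -
    have "pd i (pd i (\<lambda>x. f x * g x)) x = pd i (\<lambda>x. pd i f x * g x + f x * pd i g x) x"
      by (rule pd_cong[OF assms(1,4)]) (intro pd_mult dif assms)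
    also have "\<dots> = pd i (\<lambda>x. pd i f x * g x) x + pd i (\<lambda>x. f x * pd i g x) x"
      by (intro pd_add dif[OF _ assms(4)] smooth_on_mult smooth_on_pd assms)
    also have "pd i (\<lambda>x. pd i f x * g x) x = pd i (pd i f) x * g x + pd i f x * pd i g x"
      by (intro pd_mult dif[OF _ assms(4)] smooth_on_pd assms)
    also have "pd i (\<lambda>x. f x * pd i g x) x = pd i f x * pd i g x + f x * pd i (pd i g) x"
      by (intro pd_mult dif[OF _ assms(4)] smooth_on_pd assms)
    finally show ?thesis by simp
  qed
  then show ?thesis
    by (simp add: laplacian_def sum.distrib sum_distrib_left sum_distrib_right)
qed

lemma laplacian_lincomb:
  assumes "open S" "smooth_on S f" "smooth_on S g" "x \<in> S"
  shows "laplacian (\<lambda>x. a * f x + b * g x) x = a * laplacian f x + b * laplacian g x"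
proof -
  note dif = smooth_on_differentiable[OF _ assms(1)]
  have lin: "pd i (\<lambda>x. a * f x + b * g x) y = a * pd i f y + b * pd i g y"
    if "smooth_on S f" "smooth_on S g" "y \<in> S" for f g y i
  proof -
    have "pd i (\<lambda>x. a * f x + b * g x) y = pd i (\<lambda>x. a * f x) y + pd i (\<lambda>x. b * g x) y"
      by (intro pd_add dif[OF _ that(3)] smooth_on_mult smooth_on_const that assms)
    then show ?thesis by (simp add: pd_cmult[OF dif[OF _ that(3)]] that)
  qed
  have "pd i (pd i (\<lambda>x. a * f x + b * g x)) x = a * pd i (pd i f) x + b * pd i (pd i g) x" for i
  proof -
    have "pd i (pd i (\<lambda>x. a * f x + b * g x)) x = pd i (\<lambda>x. a * pd i f x + b * pd i g x) x"
      by (rule pd_cong[OF assms(1,4)]) (intro lin assms)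
    also have "\<dots> = a * pd i (pd i f) x + b * pd i (pd i g) x"
      by (intro lin smooth_on_pd assms)
    finally show ?thesis .
  qed
  then show ?thesis by (simp add: laplacian_def sum.distrib sum_distrib_left)
qed

lemma pd_inner: "pd i (\<lambda>x. (x - y) \<bullet> d) = (\<lambda>x. d $ i)"
proof
  fix x
  have "((\<lambda>t. (x + t *\<^sub>R axis i 1 - y) \<bullet> d) has_real_derivative axis i 1 \<bullet> d) (at 0)"
    by (auto intro!: derivative_eq_intros simp: has_field_derivative_def inner_diff_left inner_add_left)
  then show "pd i (\<lambda>x. (x - y) \<bullet> d) x = d $ i"
    by (intro pd_eqI) (simp add: inner_axis')
qed

lemma laplacian_inner: "laplacian (\<lambda>x. (x - y) \<bullet> d) = (\<lambda>x. 0)"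
  by (simp add: laplacian_def fun_eq_iff pd_inner)

lemma smooth_on_inner: "open S \<Longrightarrow> smooth_on S (\<lambda>x. (x - y) \<bullet> d)"
  unfolding inner_vec_def vector_minus_component inner_real_def
  by (intro smooth_on_sum smooth_on_mult smooth_on_diff smooth_on_nth smooth_on_const)

section \<open>Estimates for the regularised distance\<close>

lemma reg_dist_pos: "e \<noteq> 0 \<Longrightarrow> 0 < reg_dist y e x"
  by (simp add: reg_dist_def add_nonneg_pos)

lemma smooth_on_inverse_reg_dist:
  assumes "e \<noteq> 0" shows "smooth_on UNIV (\<lambda>x. c / reg_dist y e x)"
  unfolding reg_dist_def
  using assms by (intro smooth_on_divide smooth_on_sqrt smooth_on_add smooth_on_norm_sq smooth_on_const)
    (simp_all add: add_nonneg_pos)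

lemma norm_le_reg_dist: "norm (x - y) \<le> reg_dist y e x"
  by (simp add: reg_dist_def real_le_rsqrt)

lemma abs_le_reg_dist: "\<bar>e\<bar> \<le> reg_dist y e x"
  by (simp add: reg_dist_def real_le_rsqrt)

lemma reg_dist_le: "reg_dist y e x \<le> norm (x - y) + \<bar>e\<bar>"
  unfolding reg_dist_def using sqrt_add_le_add_sqrt[of "(norm (x - y))\<^sup>2" "e\<^sup>2"] by simp

lemma tendsto_reg_dist: "(\<lambda>n. reg_dist y (1 / real (Suc n)) x) \<longlonglongrightarrow> norm (x - y)"
proof -
  have "(\<lambda>n. sqrt ((norm (x - y))\<^sup>2 + (inverse (real (Suc n)))\<^sup>2)) \<longlonglongrightarrow> sqrt ((norm (x - y))\<^sup>2 + 0\<^sup>2)"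
    by (intro tendsto_intros LIMSEQ_inverse_real_of_nat)
  then show ?thesis by (simp add: reg_dist_def inverse_eq_divide)
qed

lemma locally_integrable_const: "locally_integrable (\<lambda>x. c)"
  by (rule locally_integrable_continuous) simp

lemma locally_integrable_inverse_norm_sq': "locally_integrable (\<lambda>x. c / (norm (x - y))\<^sup>2)"
  using locally_integrable_cmult[OF locally_integrable_inverse_norm_sq, of c y] by simp

text \<open>The factor 5 = 2 + 3 is that of the majorant in \<open>weak_laplacian_dipole\<close>,
  where the regularised Laplacian has two terms.\<close>

lemma dipole_bounds:
  fixes v d :: point
  shows "\<bar>v \<bullet> d / norm v\<bar> \<le> norm d" "\<bar>- 2 * (v \<bullet> d) / norm v ^ 3\<bar> \<le> 5 * norm d / (norm v)\<^sup>2"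
proof -
  have "\<bar>v \<bullet> d\<bar> \<le> norm v * norm d" by (rule Cauchy_Schwarz_ineq2)
  then show "\<bar>v \<bullet> d / norm v\<bar> \<le> norm d"
    by (cases "v = 0") (simp_all add: field_simps)
  show "\<bar>- 2 * (v \<bullet> d) / norm v ^ 3\<bar> \<le> 5 * norm d / (norm v)\<^sup>2"
  proof (cases "v = 0")
    case False
    have "\<bar>v \<bullet> d\<bar> / norm v ^ 3 \<le> (norm v * norm d) / norm v ^ 3"
      by (intro divide_right_mono Cauchy_Schwarz_ineq2) simp
    also have "\<dots> = norm d / (norm v)\<^sup>2" using False by (simp add: field_simps eval_nat_numeral)
    finally have "\<bar>v \<bullet> d\<bar> / norm v ^ 3 \<le> norm d / (norm v)\<^sup>2" .
    moreover have "0 \<le> norm d / (norm v)\<^sup>2" by simp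
    moreover have "\<bar>- 2 * (v \<bullet> d) / norm v ^ 3\<bar> = 2 * (\<bar>v \<bullet> d\<bar> / norm v ^ 3)" by (simp add: abs_mult)
    moreover have "5 * norm d / (norm v)\<^sup>2 = 5 * (norm d / (norm v)\<^sup>2)" by simp
    ultimately show ?thesis by linarith
  qed simp
qed

lemma borel_measurable_inner_div:
  "(\<lambda>x. c * ((x - y) \<bullet> d) / norm (x - y) ^ n) \<in> borel_measurable borel" for y d :: point
  by (intro borel_measurable_divide borel_measurable_times borel_measurable_const borel_measurable_inner
      borel_measurable_diff borel_measurable_power borel_measurable_norm) auto

lemma dipole_locally_integrable:
  "locally_integrable (\<lambda>x. (x - y) \<bullet> d / norm (x - y))"
  "locally_integrable (\<lambda>x. - 2 * ((x - y) \<bullet> d) / norm (x - y) ^ 3)"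
proof -
  show "locally_integrable (\<lambda>x. (x - y) \<bullet> d / norm (x - y))"
    by (rule locally_integrable_bound[OF locally_integrable_const[of "norm d"]])
      (use dipole_bounds(1) borel_measurable_inner_div[of 1 y d 1] in auto)
  show "locally_integrable (\<lambda>x. - 2 * ((x - y) \<bullet> d) / norm (x - y) ^ 3)"
    by (rule locally_integrable_bound[OF locally_integrable_inverse_norm_sq'[of "5 * norm d" y]])
      (use dipole_bounds(2) borel_measurable_inner_div[of "-2" y d 3] in auto)
qed

text \<open>The function n.d is bounded but has no limit at \<open>y\<close>. Its Laplacian -2
  n.d/r^2 carries no delta function there, because the linear factor (x - y).d vanishes where the
  regularised delta concentrates and keeps their product below 3|d|/\<rho>^2.\<close>

lemma weak_laplacian_dipole:
  assumes \<phi>: "test_function \<phi>"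
  shows "(LINT x|lborel. (x - y) \<bullet> d / norm (x - y) * laplacian \<phi> x)
    = (LINT x|lborel. - 2 * ((x - y) \<bullet> d) / norm (x - y) ^ 3 * \<phi> x)"
proof -
  define e where "e n = 1 / real (Suc n)" for n
  have e: "e n \<noteq> 0" for n by (simp add: e_def)
  define \<rho> where "\<rho> n x = reg_dist y (e n) x" for n x
  have \<rho>: "0 < \<rho> n x" "norm (x - y) \<le> \<rho> n x" "\<bar>e n\<bar> \<le> \<rho> n x" for n x
    using e by (simp_all add: \<rho>_def reg_dist_pos norm_le_reg_dist abs_le_reg_dist)
  have \<rho>lim: "(\<lambda>n. \<rho> n x) \<longlonglongrightarrow> norm (x - y)" for x
    unfolding \<rho>_def e_def by (rule tendsto_reg_dist)
  have elim: "e \<longlonglongrightarrow> 0"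
    unfolding e_def[abs_def] using LIMSEQ_inverse_real_of_nat by (simp add: inverse_eq_divide)
  have lap: "laplacian (\<lambda>x. (x - y) \<bullet> d * (1 / \<rho> n x)) x
      = - 2 * ((x - y) \<bullet> d) / \<rho> n x ^ 3 - 3 * (e n)\<^sup>2 * ((x - y) \<bullet> d) / \<rho> n x ^ 5" for n x
  proof -
    have r: "reg_dist y (e n) x \<noteq> 0" using reg_dist_pos[OF e] by (metis less_irrefl)
    have "(\<Sum>i\<in>UNIV. d $ i * (- 1 * (x - y) $ i / \<rho> n x ^ 3)) = - ((x - y) \<bullet> d) / \<rho> n x ^ 3"
      unfolding inner_vec_def inner_real_def
      by (simp add: sum_3 add_divide_distrib diff_divide_distrib algebra_simps)
    then show ?thesis
      unfolding \<rho>_def laplacian_mult[OF open_UNIV smooth_on_inner[OF open_UNIV] smooth_on_inverse_reg_dist[OF e] UNIV_I]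
        laplacian_inner pd_inner laplacian_inverse_reg_dist[OF r] pd_inverse_reg_dist[OF r]
      by (simp add: mult_ac)
  qed
  have "(LINT x|lborel. ((x - y) \<bullet> d * (1 / norm (x - y))) * laplacian \<phi> x)
      = (LINT x|lborel. - 2 * ((x - y) \<bullet> d) / norm (x - y) ^ 3 * \<phi> x)"
  proof (rule weak_laplacian_limit[where f="\<lambda>n x. (x - y) \<bullet> d * (1 / \<rho> n x)" and A="{y}"
        and g="\<lambda>x. norm d" and g'="\<lambda>x. 5 * norm d / (norm (x - y))\<^sup>2"])
    show "smooth_on UNIV (\<lambda>x. (x - y) \<bullet> d * (1 / \<rho> n x))" for n
      unfolding \<rho>_def by (intro smooth_on_mult smooth_on_inner smooth_on_inverse_reg_dist e open_UNIV)
    show "(\<lambda>x. (x - y) \<bullet> d * (1 / norm (x - y))) \<in> borel_measurable borel"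
      using borel_measurable_inner_div[of 1 y d 1] by simp
    show "(\<lambda>x. - 2 * ((x - y) \<bullet> d) / norm (x - y) ^ 3) \<in> borel_measurable borel"
      by (rule borel_measurable_inner_div)
    show "\<bar>(x - y) \<bullet> d * (1 / \<rho> n x)\<bar> \<le> norm d" for n x
    proof -
      have "\<bar>(x - y) \<bullet> d\<bar> \<le> norm (x - y) * norm d" by (rule Cauchy_Schwarz_ineq2)
      also have "\<dots> \<le> \<rho> n x * norm d" by (intro mult_right_mono \<rho>) simp
      finally show ?thesis using \<rho>(1)[of n x] by (simp add: field_simps)
    qed
    show "\<bar>laplacian (\<lambda>x. (x - y) \<bullet> d * (1 / \<rho> n x)) x\<bar> \<le> 5 * norm d / (norm (x - y))\<^sup>2"
      if "x \<notin> {y}" for n x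
    proof -
      have p: "0 < \<rho> n x" by (rule \<rho>)
      have cs: "\<bar>(x - y) \<bullet> d\<bar> \<le> \<rho> n x * norm d"
        by (rule order_trans[OF Cauchy_Schwarz_ineq2]) (intro mult_right_mono \<rho> norm_ge_zero)
      have e2: "(e n)\<^sup>2 \<le> (\<rho> n x)\<^sup>2"
        using \<rho>(3)[of n x] p by (simp add: abs_le_square_iff[symmetric])
      have "\<bar>- 2 * ((x - y) \<bullet> d) / \<rho> n x ^ 3\<bar> \<le> 2 * (\<rho> n x * norm d) / \<rho> n x ^ 3"
        using cs p by (simp add: abs_mult divide_right_mono)
      also have "\<dots> = 2 * norm d / (\<rho> n x)\<^sup>2" using p by (simp add: field_simps eval_nat_numeral)
      finally have 1: "\<bar>- 2 * ((x - y) \<bullet> d) / \<rho> n x ^ 3\<bar> \<le> 2 * norm d / (\<rho> n x)\<^sup>2" .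
      have "\<bar>3 * (e n)\<^sup>2 * ((x - y) \<bullet> d) / \<rho> n x ^ 5\<bar> = 3 * ((e n)\<^sup>2 * \<bar>(x - y) \<bullet> d\<bar>) / \<rho> n x ^ 5"
        using p by (simp add: abs_mult)
      also have "\<dots> \<le> 3 * ((\<rho> n x)\<^sup>2 * (\<rho> n x * norm d)) / \<rho> n x ^ 5"
        using p by (intro divide_right_mono mult_left_mono mult_mono cs e2) auto
      also have "\<dots> = 3 * norm d / (\<rho> n x)\<^sup>2" using p by (simp add: field_simps eval_nat_numeral)
      finally have 2: "\<bar>3 * (e n)\<^sup>2 * ((x - y) \<bullet> d) / \<rho> n x ^ 5\<bar> \<le> 3 * norm d / (\<rho> n x)\<^sup>2" .
      have "\<bar>laplacian (\<lambda>x. (x - y) \<bullet> d * (1 / \<rho> n x)) x\<bar> \<le> 2 * norm d / (\<rho> n x)\<^sup>2 + 3 * norm d / (\<rho> n x)\<^sup>2"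
        unfolding lap by (rule order_trans[OF abs_triangle_ineq4 add_mono[OF 1 2]])
      also have "\<dots> = 5 * norm d / (\<rho> n x)\<^sup>2" by (simp add: field_simps)
      also have "\<dots> \<le> 5 * norm d / (norm (x - y))\<^sup>2"
        using that \<rho>(2)[of x n] p by (intro divide_left_mono power_mono) auto
      finally show ?thesis .
    qed
    show "(\<lambda>n. (x - y) \<bullet> d * (1 / \<rho> n x)) \<longlonglongrightarrow> (x - y) \<bullet> d * (1 / norm (x - y))" if "x \<notin> {y}" for x
      using that by (intro tendsto_intros \<rho>lim) auto
    show "(\<lambda>n. laplacian (\<lambda>x. (x - y) \<bullet> d * (1 / \<rho> n x)) x) \<longlonglongrightarrow> - 2 * ((x - y) \<bullet> d) / norm (x - y) ^ 3"
      if "x \<notin> {y}" for x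
    proof -
      have "(\<lambda>n. - 2 * ((x - y) \<bullet> d) / \<rho> n x ^ 3 - 3 * (e n)\<^sup>2 * ((x - y) \<bullet> d) / \<rho> n x ^ 5)
        \<longlonglongrightarrow> - 2 * ((x - y) \<bullet> d) / norm (x - y) ^ 3 - 3 * 0\<^sup>2 * ((x - y) \<bullet> d) / norm (x - y) ^ 5"
        using that by (intro tendsto_intros \<rho>lim elim) auto
      then show ?thesis unfolding lap by simp
    qed
  qed (use \<phi> locally_integrable_const locally_integrable_inverse_norm_sq' in auto)
  then show ?thesis by simp
qed

text \<open>Divided by r1 r2 r12, the triangle inequality reads ab \<le> d(a + b) for the inverse
  distances. It splits products of singularities at different points into sums of singularities at
  single points.\<close>

lemma inverse_square_bounds:
  fixes r1 r2 r12 :: real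
  assumes "0 < r1" "0 < r2" "0 < r12" "r12 \<le> r1 + r2"
  shows "1 / (r1\<^sup>2 * r2 * r12) \<le> 2 / r12\<^sup>2 * (1 / r1\<^sup>2 + 1 / r2\<^sup>2)"
    and "1 / (r1\<^sup>2 * r2\<^sup>2) \<le> 2 / r12\<^sup>2 * (1 / r1\<^sup>2 + 1 / r2\<^sup>2)"
proof -
  define a b d where "a = 1 / r1" "b = 1 / r2" "d = 1 / r12"
  have pos: "0 < a" "0 < b" "0 < d" using assms by (simp_all add: a_b_d_def)
  have ab: "a * b \<le> d * (a + b)"
    using assms by (simp add: a_b_d_def field_simps)
  have sq: "2 * (a * b) \<le> a\<^sup>2 + b\<^sup>2" using sum_squares_bound[of a b] by simp
  have "a * (a * b) \<le> a * (d * (a + b))" using ab pos by simp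
  also have "\<dots> = d * (a\<^sup>2 + a * b)" by (simp add: algebra_simps power2_eq_square)
  also have "\<dots> \<le> d * (2 * (a\<^sup>2 + b\<^sup>2))"
  proof (rule mult_left_mono)
    have "z + x \<le> 2 * (z + y)" if "2 * x \<le> z + y" "0 \<le> z" "0 \<le> y" for x y z :: real using that by argo
    from this[OF sq] show "a\<^sup>2 + a * b \<le> 2 * (a\<^sup>2 + b\<^sup>2)" by simp
  qed (use pos in simp)
  finally have 1: "a * (a * b) * d \<le> d * (2 * (a\<^sup>2 + b\<^sup>2)) * d" using pos by (intro mult_right_mono) auto
  have "(a * b)\<^sup>2 \<le> (d * (a + b))\<^sup>2" using ab pos by (intro power_mono) auto
  also have "\<dots> \<le> d\<^sup>2 * (2 * (a\<^sup>2 + b\<^sup>2))"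
    unfolding power_mult_distrib using sq by (intro mult_left_mono) (simp_all add: power2_sum)
  finally have 2: "(a * b)\<^sup>2 \<le> d\<^sup>2 * (2 * (a\<^sup>2 + b\<^sup>2))" .
  have sqs: "a\<^sup>2 = 1 / r1\<^sup>2" "b\<^sup>2 = 1 / r2\<^sup>2" "d\<^sup>2 = 1 / r12\<^sup>2"
    by (simp_all add: a_b_d_def power_divide)
  have "1 / (r1\<^sup>2 * r2 * r12) = a * (a * b) * d" by (simp add: a_b_d_def power2_eq_square)
  also have "\<dots> \<le> 2 * d\<^sup>2 * (a\<^sup>2 + b\<^sup>2)" using 1 by (simp add: power2_eq_square algebra_simps)
  finally show "1 / (r1\<^sup>2 * r2 * r12) \<le> 2 / r12\<^sup>2 * (1 / r1\<^sup>2 + 1 / r2\<^sup>2)" by (simp add: sqs)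
  have "1 / (r1\<^sup>2 * r2\<^sup>2) = (a * b)\<^sup>2" by (simp add: a_b_d_def power_divide power_mult_distrib)
  also have "\<dots> \<le> 2 * d\<^sup>2 * (a\<^sup>2 + b\<^sup>2)" using 2 by (simp add: algebra_simps)
  finally show "1 / (r1\<^sup>2 * r2\<^sup>2) \<le> 2 / r12\<^sup>2 * (1 / r1\<^sup>2 + 1 / r2\<^sup>2)" by (simp add: sqs)
qed

text \<open>
  The factor vanishing at the centre of the regularised delta function keeps the product below a
  multiple of \<open>1/r\<^sup>2\<close>, so that it leaves no mass in the limit.
\<close>

lemma reg_delta_bound:
  assumes "e \<noteq> 0" "x \<noteq> y1" "x \<noteq> y2" "y1 \<noteq> y2"
  shows "\<bar>- 3 * 1 * e\<^sup>2 / reg_dist y1 e x ^ 5 * (1 / reg_dist y2 e x - 1 / norm (y1 - y2))\<bar>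
    \<le> 12 / (norm (y1 - y2))\<^sup>2 * (1 / (norm (x - y1))\<^sup>2 + 1 / (norm (x - y2))\<^sup>2)"
proof -
  define r1 r2 r12 \<rho>1 \<rho>2 where "r1 = norm (x - y1)" "r2 = norm (x - y2)" "r12 = norm (y1 - y2)"
    "\<rho>1 = reg_dist y1 e x" "\<rho>2 = reg_dist y2 e x"
  note defs = this
  have r: "0 < r1" "0 < r2" "0 < r12" using assms by (simp_all add: defs)
  have \<rho>: "0 < \<rho>1" "0 < \<rho>2" using assms(1) by (simp_all add: defs reg_dist_pos)
  have le: "r1 \<le> \<rho>1" "r2 \<le> \<rho>2" "\<bar>e\<bar> \<le> \<rho>1" "\<rho>2 \<le> r2 + \<bar>e\<bar>"
    by (simp_all add: defs norm_le_reg_dist abs_le_reg_dist reg_dist_le)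
  have tri: "r2 \<le> r12 + r1" "r12 \<le> r2 + r1" "r12 \<le> r1 + r2"
    using norm_triangle_ineq[of "x - y1" "y1 - y2"] norm_triangle_ineq4[of "x - y2" "x - y1"]
    by (simp_all add: defs)
  \<comment> \<open>Here |r12 - r2| \<le> r1 \<le> \<rho>1 by the triangle inequality, and 0 \<le>
    \<rho>2 - r2 \<le> |e| \<le> \<rho>1.\<close>
  have "\<bar>r12 - \<rho>2\<bar> \<le> 2 * \<rho>1" using le tri by linarith
  moreover have "1 / \<rho>2 - 1 / r12 = (r12 - \<rho>2) / (\<rho>2 * r12)" using r \<rho> by (simp add: field_simps)
  ultimately have 1: "\<bar>1 / \<rho>2 - 1 / r12\<bar> \<le> 2 * \<rho>1 / (\<rho>2 * r12)"
    using r \<rho> by (simp add: abs_mult divide_right_mono)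
  also have "\<dots> \<le> 2 * \<rho>1 / (r2 * r12)"
    using r \<rho> le by (intro divide_left_mono mult_right_mono) auto
  finally have 1: "\<bar>1 / \<rho>2 - 1 / r12\<bar> \<le> 2 * \<rho>1 / (r2 * r12)" .
  have e2: "e\<^sup>2 \<le> \<rho>1\<^sup>2" using le(3) \<rho> by (simp add: abs_le_square_iff[symmetric])
  have "\<bar>- 3 * 1 * e\<^sup>2 / \<rho>1 ^ 5 * (1 / \<rho>2 - 1 / r12)\<bar> = 3 * e\<^sup>2 / \<rho>1 ^ 5 * \<bar>1 / \<rho>2 - 1 / r12\<bar>"
    using \<rho> by (simp add: abs_mult)
  also have "\<dots> \<le> 3 * \<rho>1\<^sup>2 / \<rho>1 ^ 5 * (2 * \<rho>1 / (r2 * r12))"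
    using \<rho> e2 by (intro mult_mono 1 divide_right_mono) auto
  also have "\<dots> = 6 * (1 / (\<rho>1\<^sup>2 * r2 * r12))" using \<rho> r by (simp add: field_simps eval_nat_numeral)
  also have "\<dots> \<le> 6 * (1 / (r1\<^sup>2 * r2 * r12))"
    using \<rho> r le by (intro mult_left_mono divide_left_mono mult_right_mono power_mono) auto
  also have "\<dots> \<le> 6 * (2 / r12\<^sup>2 * (1 / r1\<^sup>2 + 1 / r2\<^sup>2))"
    using r tri by (intro mult_left_mono inverse_square_bounds) auto
  finally show ?thesis by (simp add: defs[symmetric])
qed

lemma gradient_product_bound:
  fixes v w :: point
  assumes "0 < r" "0 < s" "norm v \<le> r" "norm w \<le> s" "v \<noteq> 0" "w \<noteq> 0"
  shows "\<bar>(v \<bullet> w) / (r ^ 3 * s ^ 3)\<bar> \<le> 1 / ((norm v)\<^sup>2 * (norm w)\<^sup>2)"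
proof -
  have "\<bar>v \<bullet> w\<bar> \<le> r * s"
    by (rule order_trans[OF Cauchy_Schwarz_ineq2]) (intro mult_mono assms norm_ge_zero less_imp_le)
  then have "\<bar>(v \<bullet> w) / (r ^ 3 * s ^ 3)\<bar> \<le> (r * s) / (r ^ 3 * s ^ 3)"
    using assms by (simp add: abs_mult divide_right_mono)
  also have "\<dots> = 1 / (r\<^sup>2 * s\<^sup>2)" using assms by (simp add: field_simps eval_nat_numeral)
  also have "\<dots> \<le> 1 / ((norm v)\<^sup>2 * (norm w)\<^sup>2)"
    using assms by (intro divide_left_mono mult_mono power_mono) auto
  finally show ?thesis .
qed

lemma sum_pd_inverse_reg_dist:
  assumes "reg_dist y1 e x \<noteq> 0" "reg_dist y2 f x \<noteq> 0"
  shows "(\<Sum>i\<in>UNIV. pd i (\<lambda>x. 1 / reg_dist y1 e x) x * pd i (\<lambda>x. 1 / reg_dist y2 f x) x)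
    = ((x - y1) \<bullet> (x - y2)) / (reg_dist y1 e x ^ 3 * reg_dist y2 f x ^ 3)"
  unfolding pd_inverse_reg_dist[OF assms(1)] pd_inverse_reg_dist[OF assms(2)] inner_sum sum_3
  by (simp add: add_divide_distrib del: vector_minus_component)

text \<open>The function 1/(r1 r2) completed so that at each singular point the other factor
  vanishes. Otherwise Laplace 1/r1 would contribute a delta function at \<open>y1\<close> of weight
  1/r12, and likewise at \<open>y2\<close>.\<close>

definition product_potential :: "point \<Rightarrow> point \<Rightarrow> point \<Rightarrow> real" where
  "product_potential y1 y2 x =
    (1 / norm (x - y1) - 1 / norm (y1 - y2)) * (1 / norm (x - y2) - 1 / norm (y1 - y2))"

definition product_source :: "point \<Rightarrow> point \<Rightarrow> point \<Rightarrow> real" where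
  "product_source y1 y2 x = 2 * ((x - y1) \<bullet> (x - y2)) / (norm (x - y1) ^ 3 * norm (x - y2) ^ 3)"

text \<open>The regularised Laplacian consists of the scalar product of the two gradients and of two
  approximate delta functions, each damped by the factor that vanishes at its centre. All three are
  below a multiple of 1/r1^2 + 1/r2^2, and only the first survives in the limit.\<close>

lemma weak_laplacian_product:
  assumes "y1 \<noteq> y2"
  shows "locally_integrable (product_potential y1 y2)" and "locally_integrable (product_source y1 y2)"
    and "test_function \<phi> \<Longrightarrow> (LINT x|lborel. product_potential y1 y2 x * laplacian \<phi> x)
      = (LINT x|lborel. product_source y1 y2 x * \<phi> x)"
proof -
  let ?u = "\<lambda>x. (1 / norm (x - y1) - 1 / norm (y1 - y2)) * (1 / norm (x - y2) - 1 / norm (y1 - y2))"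
  let ?F = "\<lambda>x. 2 * ((x - y1) \<bullet> (x - y2)) / (norm (x - y1) ^ 3 * norm (x - y2) ^ 3)"
  have u: "product_potential y1 y2 = ?u" and F: "product_source y1 y2 = ?F"
    by (simp_all add: product_potential_def product_source_def fun_eq_iff)
  define D where "D = 1 / norm (y1 - y2)"
  have D: "0 < D" using assms by (simp add: D_def)
  define h where "h x = 1 / (norm (x - y1))\<^sup>2 + 1 / (norm (x - y2))\<^sup>2" for x
  have h: "0 \<le> h x" for x by (simp add: h_def)
  have hint: "locally_integrable (\<lambda>x. a * h x + b)" for a b
    unfolding h_def
    by (intro locally_integrable_add locally_integrable_cmult locally_integrable_inverse_norm_sq locally_integrable_const)
  have AE: "AE x in lborel. x \<notin> {y1, y2}"
    by (intro AE_not_in finite_imp_null_set_lborel) auto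
  \<comment> \<open>Here \<open>a\<close> and \<open>b\<close> stand for the exact and for the
    regularised inverse distances alike.\<close>
  have bdu: "\<bar>(a - D) * (b - D)\<bar> \<le> 2 * h x + 4 * D\<^sup>2"
    if "0 \<le> a" "a \<le> 1 / norm (x - y1)" "0 \<le> b" "b \<le> 1 / norm (x - y2)" for a b x
  proof -
    have "\<bar>(a - D) * (b - D)\<bar> \<le> (a + D) * (b + D)"
      unfolding abs_mult using that D by (intro mult_mono) auto
    also have "\<dots> \<le> 2 * (a\<^sup>2 + b\<^sup>2) + 4 * D\<^sup>2"
    proof -
      \<comment> \<open>The sum of squares is twice the difference of the two sides.\<close>
      have "0 \<le> (a - b)\<^sup>2 + (a - D)\<^sup>2 + (b - D)\<^sup>2 + 2 * (a\<^sup>2 + b\<^sup>2) + 4 * D\<^sup>2" by simp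
      then show ?thesis by (simp add: algebra_simps power2_eq_square)
    qed
    also have "a\<^sup>2 + b\<^sup>2 \<le> (1 / norm (x - y1))\<^sup>2 + (1 / norm (x - y2))\<^sup>2"
      using that by (intro add_mono power_mono)
    finally show ?thesis by (simp add: h_def power_divide)
  qed
  have mu: "?u \<in> borel_measurable borel"
    by (intro borel_measurable_times borel_measurable_diff borel_measurable_divide borel_measurable_norm borel_measurable_const) auto
  have mF: "?F \<in> borel_measurable borel"
    by (intro borel_measurable_times borel_measurable_diff borel_measurable_divide borel_measurable_norm
        borel_measurable_const borel_measurable_inner borel_measurable_power) auto
  show "locally_integrable (product_potential y1 y2)"
    unfolding u
    by (rule locally_integrable_bound[OF hint[of 2 "4 * D\<^sup>2"] mu])
      (use bdu[of "1 / norm (_ - y1)" _ "1 / norm (_ - y2)"] in \<open>simp add: D_def\<close>)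
  have grad: "\<bar>2 * ((x - y1) \<bullet> (x - y2)) / (r ^ 3 * s ^ 3)\<bar> \<le> 4 * D\<^sup>2 * h x"
    if "x \<notin> {y1, y2}" "norm (x - y1) \<le> r" "norm (x - y2) \<le> s" for x r s
  proof -
    have pos: "0 < norm (x - y1)" "0 < norm (x - y2)" using that(1) by auto
    have "\<bar>((x - y1) \<bullet> (x - y2)) / (r ^ 3 * s ^ 3)\<bar> \<le> 1 / ((norm (x - y1))\<^sup>2 * (norm (x - y2))\<^sup>2)"
      by (intro gradient_product_bound less_le_trans[OF pos(1) that(2)] less_le_trans[OF pos(2) that(3)] that)
        (use that(1) in auto)
    also have "\<dots> \<le> 2 / (norm (y1 - y2))\<^sup>2 * (1 / (norm (x - y1))\<^sup>2 + 1 / (norm (x - y2))\<^sup>2)"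
      using pos assms norm_triangle_ineq4[of "x - y2" "x - y1"] by (intro inverse_square_bounds) auto
    finally have "\<bar>((x - y1) \<bullet> (x - y2)) / (r ^ 3 * s ^ 3)\<bar> \<le> 2 * D\<^sup>2 * h x"
      by (simp add: D_def h_def power_divide)
    moreover have "\<bar>2 * ((x - y1) \<bullet> (x - y2)) / (r ^ 3 * s ^ 3)\<bar> = 2 * \<bar>((x - y1) \<bullet> (x - y2)) / (r ^ 3 * s ^ 3)\<bar>"
      by (simp add: abs_mult)
    ultimately show ?thesis by simp
  qed
  show "locally_integrable (product_source y1 y2)"
    unfolding F
    by (rule locally_integrable_bound[OF hint[of "4 * D\<^sup>2" 0] mF])
      (use AE in \<open>eventually_elim, unfold add_0_right, intro grad order_refl\<close>)
  assume \<phi>: "test_function \<phi>"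
  define e where "e n = 1 / real (Suc n)" for n
  have e: "e n \<noteq> 0" for n by (simp add: e_def)
  have elim: "e \<longlonglongrightarrow> 0"
    unfolding e_def[abs_def] using LIMSEQ_inverse_real_of_nat by (simp add: inverse_eq_divide)
  define \<rho> where "\<rho> y n x = reg_dist y (e n) x" for y n x
  have \<rho>: "0 < \<rho> y n x" "norm (x - y) \<le> \<rho> y n x" for y n x
    using e by (simp_all add: \<rho>_def reg_dist_pos norm_le_reg_dist)
  have \<rho>lim: "(\<lambda>n. \<rho> y n x) \<longlonglongrightarrow> norm (x - y)" for x y
    unfolding \<rho>_def e_def by (rule tendsto_reg_dist)
  have sm: "smooth_on UNIV (\<lambda>x. 1 / \<rho> y n x)" for y n
    unfolding \<rho>_def by (rule smooth_on_inverse_reg_dist[OF e])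
  have smD: "smooth_on UNIV (\<lambda>x. 1 / \<rho> y n x - D)" for y n
    by (intro smooth_on_diff open_UNIV sm smooth_on_const)
  have pdD: "pd i (\<lambda>x. 1 / \<rho> y n x - D) = pd i (\<lambda>x. 1 / \<rho> y n x)" for y n i
  proof
    fix x
    have "pd i (\<lambda>x. 1 / \<rho> y n x + (- D)) x = pd i (\<lambda>x. 1 / \<rho> y n x) x + pd i (\<lambda>x. - D) x"
      by (intro pd_add smooth_UNIV_dif sm smooth_on_const)
    then show "pd i (\<lambda>x. 1 / \<rho> y n x - D) x = pd i (\<lambda>x. 1 / \<rho> y n x) x" by simp
  qed
  have r: "reg_dist y (e n) x \<noteq> 0" for y n x using reg_dist_pos[OF e] by (metis less_irrefl)
  have lapD: "laplacian (\<lambda>x. 1 / \<rho> y n x - D) x = - 3 * 1 * (e n)\<^sup>2 / \<rho> y n x ^ 5" for y n x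
    unfolding laplacian_def pdD unfolding laplacian_def[symmetric] \<rho>_def by (rule laplacian_inverse_reg_dist[OF r])
  have lap: "laplacian (\<lambda>x. (1 / \<rho> y1 n x - D) * (1 / \<rho> y2 n x - D)) x
      = - 3 * 1 * (e n)\<^sup>2 / \<rho> y1 n x ^ 5 * (1 / \<rho> y2 n x - D)
      + 2 * ((x - y1) \<bullet> (x - y2)) / (\<rho> y1 n x ^ 3 * \<rho> y2 n x ^ 3)
      + (1 / \<rho> y1 n x - D) * (- 3 * 1 * (e n)\<^sup>2 / \<rho> y2 n x ^ 5)" for n x
    unfolding laplacian_mult[OF open_UNIV smD smD UNIV_I] lapD pdD
    unfolding \<rho>_def sum_pd_inverse_reg_dist[OF r r] by simp
  have 0: "3 * 0\<^sup>2 / norm (x - y) ^ 5 = 0" for x y :: point by simp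
  show "(LINT x|lborel. product_potential y1 y2 x * laplacian \<phi> x) = (LINT x|lborel. product_source y1 y2 x * \<phi> x)"
    unfolding u F D_def[symmetric]
  \<comment> \<open>28 = 12 + 12 + 4: two damped delta functions and the gradient term. The
    \<open>+ 0\<close> gives the majorant the shape of \<open>hint\<close>.\<close>
  proof (rule weak_laplacian_limit[where f="\<lambda>n x. (1 / \<rho> y1 n x - D) * (1 / \<rho> y2 n x - D)" and A="{y1, y2}"
        and g="\<lambda>x. 2 * h x + 4 * D\<^sup>2" and g'="\<lambda>x. 28 * D\<^sup>2 * h x + 0"])
    show "smooth_on UNIV (\<lambda>x. (1 / \<rho> y1 n x - D) * (1 / \<rho> y2 n x - D))" for n
      by (intro smooth_on_mult smD open_UNIV)
    show "\<bar>(1 / \<rho> y1 n x - D) * (1 / \<rho> y2 n x - D)\<bar> \<le> 2 * h x + 4 * D\<^sup>2" if "x \<notin> {y1, y2}" for n x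
      using that \<rho> by (intro bdu divide_left_mono) (auto simp: less_imp_le)
    show "\<bar>laplacian (\<lambda>x. (1 / \<rho> y1 n x - D) * (1 / \<rho> y2 n x - D)) x\<bar> \<le> 28 * D\<^sup>2 * h x + 0"
      if x: "x \<notin> {y1, y2}" for n x
    proof -
      have 1: "\<bar>- 3 * 1 * (e n)\<^sup>2 / \<rho> y1 n x ^ 5 * (1 / \<rho> y2 n x - D)\<bar> \<le> 12 * D\<^sup>2 * h x"
        using reg_delta_bound[OF e, of x y1 y2] x assms by (simp add: \<rho>_def D_def h_def power_divide)
      have 2: "\<bar>(1 / \<rho> y1 n x - D) * (- 3 * 1 * (e n)\<^sup>2 / \<rho> y2 n x ^ 5)\<bar> \<le> 12 * D\<^sup>2 * h x"
        using reg_delta_bound[OF e, of x y2 y1] x assms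
        by (simp add: \<rho>_def D_def h_def power_divide norm_minus_commute[of y2] mult.commute add.commute)
      have 3: "\<bar>2 * ((x - y1) \<bullet> (x - y2)) / (\<rho> y1 n x ^ 3 * \<rho> y2 n x ^ 3)\<bar> \<le> 4 * D\<^sup>2 * h x"
        by (intro grad x \<rho>)
      have "\<bar>a + b + c\<bar> \<le> 28 * t + 0" if "\<bar>a\<bar> \<le> 12 * t" "\<bar>c\<bar> \<le> 12 * t" "\<bar>b\<bar> \<le> 4 * t" for a b c t :: real
        using that by linarith
      from this[of _ "D\<^sup>2 * h x", unfolded mult.assoc[symmetric], OF 1 2 3] show ?thesis
        unfolding lap .
    qed
    show "(\<lambda>n. (1 / \<rho> y1 n x - D) * (1 / \<rho> y2 n x - D)) \<longlonglongrightarrow> (1 / norm (x - y1) - D) * (1 / norm (x - y2) - D)"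
      if "x \<notin> {y1, y2}" for x
      using that by (intro tendsto_intros \<rho>lim) auto
    show "(\<lambda>n. laplacian (\<lambda>x. (1 / \<rho> y1 n x - D) * (1 / \<rho> y2 n x - D)) x)
      \<longlonglongrightarrow> 2 * ((x - y1) \<bullet> (x - y2)) / (norm (x - y1) ^ 3 * norm (x - y2) ^ 3)"
      if "x \<notin> {y1, y2}" for x
    proof -
      have "(\<lambda>n. - 3 * 1 * (e n)\<^sup>2 / \<rho> y1 n x ^ 5 * (1 / \<rho> y2 n x - D)
        + 2 * ((x - y1) \<bullet> (x - y2)) / (\<rho> y1 n x ^ 3 * \<rho> y2 n x ^ 3)
        + (1 / \<rho> y1 n x - D) * (- 3 * 1 * (e n)\<^sup>2 / \<rho> y2 n x ^ 5))
        \<longlonglongrightarrow> - 3 * 1 * 0\<^sup>2 / norm (x - y1) ^ 5 * (1 / norm (x - y2) - D)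
        + 2 * ((x - y1) \<bullet> (x - y2)) / (norm (x - y1) ^ 3 * norm (x - y2) ^ 3)
        + (1 / norm (x - y1) - D) * (- 3 * 1 * 0\<^sup>2 / norm (x - y2) ^ 5)"
        using that by (intro tendsto_intros \<rho>lim elim) auto
      then show ?thesis unfolding lap by simp
    qed
    show "locally_integrable (\<lambda>x. 28 * D\<^sup>2 * h x + 0)" "locally_integrable (\<lambda>x. 2 * h x + 4 * D\<^sup>2)"
      by (rule hint)+
  qed (use \<phi> mu mF in \<open>simp_all add: D_def\<close>)
qed

subsection \<open>The field s\<close>

text \<open>The vector points from the first argument to the second, so that n_1, n_2 and n_12 are
  \<open>unit_vec y1 x\<close>, \<open>unit_vec y2 x\<close> and \<open>unit_vec y2 y1\<close>. The
  point to be differentiated stands second.\<close>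

definition unit_vec :: "point \<Rightarrow> point \<Rightarrow> 3 \<Rightarrow> real" where
  "unit_vec y x i = (x - y) $ i / norm (x - y)"

lemma unit_vec_swap: "unit_vec y x i = - unit_vec x y i"
  by (simp add: unit_vec_def norm_minus_commute[of x y] minus_divide_left)

lemma DERIV_line_norm': "x \<noteq> y \<Longrightarrow>
    ((\<lambda>t. norm (x + t *\<^sub>R axis k 1 - y)) has_real_derivative unit_vec y x k) (at 0)"
  unfolding unit_vec_def by (rule DERIV_line_norm)

lemma DERIV_unit_vec:
  assumes "x \<noteq> y"
  shows "((\<lambda>t. unit_vec y (x + t *\<^sub>R axis k 1) i) has_real_derivative
    (kron k i - unit_vec y x k * unit_vec y x i) / norm (x - y)) (at 0)"
  unfolding unit_vec_def
  by (rule DERIV_cong[OF DERIV_divide[OF DERIV_line_nth DERIV_line_norm[OF assms]]])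
    (use assms in \<open>simp_all add: field_simps\<close>)

lemma smooth_on_unit_vec: "open S \<Longrightarrow> y \<notin> S \<Longrightarrow> smooth_on S (\<lambda>x. unit_vec y x i)"
  unfolding unit_vec_def vector_minus_component
  by (intro smooth_on_divide smooth_on_diff smooth_on_nth smooth_on_const smooth_on_norm) auto

section \<open>Closed form of the mixed second derivatives of ln(r1 + r2 + r12)\<close>

definition T_field :: "point \<Rightarrow> point \<Rightarrow> point \<Rightarrow> 3 \<Rightarrow> 3 \<Rightarrow> real" where
  "T_field y1 y2 x i j =
     - ((kron i j - unit_vec y2 y1 i * unit_vec y2 y1 j) / norm (y1 - y2))
        / (norm (x - y1) + norm (x - y2) + norm (y1 - y2))
     + (unit_vec y2 y1 i - unit_vec y1 x i) * (unit_vec y2 x j + unit_vec y2 y1 j)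
        / (norm (x - y1) + norm (x - y2) + norm (y1 - y2))\<^sup>2"

text \<open>By this symmetry the divergence on the second index follows from the one on the
  first.\<close>

lemma T_field_swap: "T_field y1 y2 x i j = T_field y2 y1 x j i"
  by (simp add: T_field_def unit_vec_swap[of y2 y1] norm_minus_commute[of y1 y2] kron_def algebra_simps)

lemma perimeter_pos: "y1 \<noteq> y2 \<Longrightarrow> 0 < norm (x - y1) + norm (x - y2) + norm (y1 - (y2::point))"
  by (simp add: add_nonneg_pos)

lemma pd_g_log_2:
  assumes "x \<noteq> y2" "a \<noteq> y2"
  shows "pd j (\<lambda>b. g_log x a b) y2
    = - (unit_vec y2 x j + unit_vec y2 a j) / (norm (a - x) + norm (x - y2) + norm (a - y2))"
proof -
  have S: "0 < norm (x - a) + norm (y2 - x) + norm (y2 - a)"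
    using assms by (simp add: add_nonneg_pos)
  have 1: "((\<lambda>t. norm (x - a) + norm (y2 + t *\<^sub>R axis j 1 - x) + norm (y2 + t *\<^sub>R axis j 1 - a))
      has_real_derivative 0 + unit_vec x y2 j + unit_vec a y2 j) (at 0)"
    using assms by (intro DERIV_add DERIV_const DERIV_line_norm') auto
  have "((\<lambda>t. ln (norm (x - a) + norm (y2 + t *\<^sub>R axis j 1 - x) + norm (y2 + t *\<^sub>R axis j 1 - a)))
      has_real_derivative 1 / (norm (x - a) + norm (y2 - x) + norm (y2 - a)) * (0 + unit_vec x y2 j + unit_vec a y2 j)) (at 0)"
    by (rule DERIV_chain2[where f=ln and g="\<lambda>t. norm (x - a) + norm (y2 + t *\<^sub>R axis j 1 - x) + norm (y2 + t *\<^sub>R axis j 1 - a)", OF _ 1])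
      (use S in \<open>auto intro!: derivative_eq_intros simp: divide_simps\<close>)
  then have *: "pd j (\<lambda>b. ln (norm (x - a) + norm (b - x) + norm (b - a))) y2
      = 1 / (norm (x - a) + norm (y2 - x) + norm (y2 - a)) * (0 + unit_vec x y2 j + unit_vec a y2 j)"
    by (rule pd_eqI)
  have "(\<lambda>b. g_log x a b) = (\<lambda>b. ln (norm (x - a) + norm (b - x) + norm (b - a)))"
  proof
    fix b show "g_log x a b = ln (norm (x - a) + norm (b - x) + norm (b - a))"
      using norm_minus_commute[of x b] norm_minus_commute[of a b] by (simp add: g_log_def)
  qed
  with * show ?thesis
    unfolding norm_minus_commute[of x a] norm_minus_commute[of y2 x] norm_minus_commute[of y2 a]
      unit_vec_swap[of x y2] unit_vec_swap[of a y2] by (simp add: divide_simps)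
qed

lemma pd_pd_g_log:
  assumes "x \<noteq> y1" "x \<noteq> y2" "y1 \<noteq> y2"
  shows "pd i (\<lambda>a. pd j (\<lambda>b. g_log x a b) y2) y1 = T_field y1 y2 x i j"
proof -
  let ?S = "\<lambda>a. norm (a - x) + norm (x - y2) + norm (a - y2)"
  have "pd i (\<lambda>a. pd j (\<lambda>b. g_log x a b) y2) y1
      = pd i (\<lambda>a. - (unit_vec y2 x j + unit_vec y2 a j) / ?S a) y1"
    by (rule pd_cong[of "- {y2}"]) (use assms pd_g_log_2 in auto)
  also have "\<dots> = T_field y1 y2 x i j"
  proof -
    have S: "?S y1 \<noteq> 0" using perimeter_pos[OF assms(3), of x] by (simp add: norm_minus_commute[of y1 x])
    have DS: "((\<lambda>t. ?S (y1 + t *\<^sub>R axis i 1)) has_real_derivative unit_vec x y1 i + 0 + unit_vec y2 y1 i) (at 0)"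
      using assms by (intro DERIV_add DERIV_const DERIV_line_norm') auto
    note * = DERIV_divide[OF DERIV_minus[OF DERIV_add[OF DERIV_const[of "unit_vec y2 x j"]
          DERIV_unit_vec[OF assms(3), of i j]]] DS]
    have S': "?S (y1 + 0 *\<^sub>R axis i 1) \<noteq> 0" using S by simp
    have alg: "(- (0 + A) * s - - (q + e) * (- p + 0 + e')) / (s * s) = - A / s + (e' - p) * (q + e) / s\<^sup>2"
      if "s \<noteq> 0" for A s q e p e' :: real
      using that by (simp add: field_simps power2_eq_square)
    show ?thesis
      by (rule pd_eqI, rule DERIV_cong[OF *[OF S']],
          unfold scaleR_zero_left add_0_right T_field_def unit_vec_swap[of x y1] norm_minus_commute[of y1 x],
          rule alg[OF S[unfolded norm_minus_commute[of y1 x]], unfolded add_0_right])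
  qed
  finally show ?thesis .
qed

lemma s_field_eq:
  assumes "x \<noteq> y1" "x \<noteq> y2" "y1 \<noteq> y2"
  shows "s_field y1 y2 x i j = (T_field y1 y2 x i j + T_field y1 y2 x j i) / 2
    - kron i j * (\<Sum>k\<in>UNIV. T_field y1 y2 x k k) / 3"
  unfolding s_field_def stf_def pd_pd_g_log[OF assms] ..

lemma pd_T_field:
  assumes "x \<noteq> y1" "x \<noteq> y2" "y1 \<noteq> y2"
  defines "r1 \<equiv> norm (x - y1)" and "r2 \<equiv> norm (x - y2)" and "r \<equiv> norm (y1 - y2)"
  defines "p \<equiv> unit_vec y1 x" and "q \<equiv> unit_vec y2 x" and "e \<equiv> unit_vec y2 y1"
  shows "pd k (\<lambda>x. T_field y1 y2 x i j) x
    = (kron i j - e i * e j) * (p k + q k) / (r * (r1 + r2 + r)\<^sup>2)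
      + (- ((kron k i - p k * p i) / r1) * (q j + e j) + (e i - p i) * ((kron k j - q k * q j) / r2)) / (r1 + r2 + r)\<^sup>2
      - 2 * (e i - p i) * (q j + e j) * (p k + q k) / (r1 + r2 + r) ^ 3"
proof -
  let ?S = "\<lambda>x. norm (x - y1) + norm (x - y2) + norm (y1 - y2)"
  have S: "r1 + r2 + r \<noteq> 0" and r: "r \<noteq> 0"
    using perimeter_pos[OF assms(3), of x] assms(3) by (simp_all add: r1_def r2_def r_def)
  have DS: "((\<lambda>t. ?S (x + t *\<^sub>R axis k 1)) has_real_derivative p k + q k + 0) (at 0)"
    unfolding p_def q_def using assms(1,2) by (intro DERIV_add DERIV_const DERIV_line_norm') auto
  note * = DERIV_add[OF DERIV_divide[OF DERIV_const[of "- ((kron i j - e i * e j) / r)"] DS]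
      DERIV_divide[OF DERIV_mult[OF DERIV_diff[OF DERIV_const[of "e i"] DERIV_unit_vec[OF assms(1), of k i]]
          DERIV_add[OF DERIV_unit_vec[OF assms(2), of k j] DERIV_const[of "e j"]]] DERIV_power[OF DS, of 2]]]
  have S': "?S (x + 0 *\<^sub>R axis k 1) \<noteq> 0" "(?S (x + 0 *\<^sub>R axis k 1))\<^sup>2 \<noteq> 0"
    using S by (simp_all add: r1_def r2_def r_def)
  have alg: "(0 * s - - (a / r) * (pq + 0)) / (s * s)
      + (((0 - P) * M + (Q + 0) * N) * s\<^sup>2 - N * M * (real 2 * ((pq + 0) * s ^ (2 - Suc 0)))) / (s\<^sup>2 * s\<^sup>2)
      = a * pq / (r * s\<^sup>2) + (- P * M + N * Q) / s\<^sup>2 - 2 * N * M * pq / s ^ 3"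
    if "s \<noteq> 0" "r \<noteq> 0" for a s pq P M N Q :: real
    using that by (simp add: field_simps eval_nat_numeral)
  show ?thesis
    unfolding T_field_def r_def[symmetric] e_def[symmetric]
    by (rule pd_eqI, rule DERIV_cong[OF *[unfolded r_def e_def, OF S', folded r_def e_def]],
        unfold scaleR_zero_left add_0_right r1_def[symmetric] r2_def[symmetric] p_def[symmetric] q_def[symmetric],
        rule alg[OF S r, unfolded add_0_right])
qed

section \<open>Divergence and trace of the mixed derivatives\<close>

lemma sum_kron: "(\<Sum>k\<in>UNIV. f k * kron k j) = f j" "(\<Sum>k\<in>UNIV. kron k j * f k) = f j"
  "(\<Sum>k\<in>UNIV. kron j k * f k) = f j"
  by (simp_all add: kron_def if_distrib if_distribR cong: if_cong)

lemma sum_unit_vec: "(\<Sum>k\<in>UNIV. unit_vec a x k * unit_vec b z k) = ((x - a) \<bullet> (z - b)) / (norm (x - a) * norm (z - b))"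
  by (simp add: unit_vec_def inner_vec_def sum_divide_distrib)

text \<open>The law of cosines, together with r1 n_1 = r2 n_2 - r12 n_12. All contractions thereby
  become rational functions of the three side lengths and of the components of two unit
  vectors.\<close>

lemma triangle_dots:
  assumes "x \<noteq> y1" "x \<noteq> y2" "y1 \<noteq> y2"
  defines "r1 \<equiv> norm (x - y1)" and "r2 \<equiv> norm (x - y2)" and "r \<equiv> norm (y1 - y2)"
  defines "p \<equiv> unit_vec y1 x" and "q \<equiv> unit_vec y2 x" and "e \<equiv> unit_vec y2 y1"
  shows "(\<Sum>k\<in>UNIV. p k * p k) = 1" "(\<Sum>k\<in>UNIV. e k * e k) = 1"
    "(\<Sum>k\<in>UNIV. e k * p k) = (r2\<^sup>2 - r1\<^sup>2 - r\<^sup>2) / (2 * r1 * r)"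
    "(\<Sum>k\<in>UNIV. e k * q k) = (r2\<^sup>2 + r\<^sup>2 - r1\<^sup>2) / (2 * r2 * r)"
    "(\<Sum>k\<in>UNIV. p k * q k) = (r1\<^sup>2 + r2\<^sup>2 - r\<^sup>2) / (2 * r1 * r2)"
    "p j = (r2 * q j - r * e j) / r1"
proof -
  have r: "r1 \<noteq> 0" "r2 \<noteq> 0" "r \<noteq> 0" using assms(1-3) by (simp_all add: r1_def r2_def r_def)
  show "(\<Sum>k\<in>UNIV. p k * p k) = 1" "(\<Sum>k\<in>UNIV. e k * e k) = 1"
    using r unfolding p_def e_def sum_unit_vec r1_def r_def
    by (simp_all add: power2_norm_eq_inner[symmetric] power2_eq_square)
  have "(y1 - y2) \<bullet> (x - y1) = (r2\<^sup>2 - r\<^sup>2 - r1\<^sup>2) / 2"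
    using dot_norm[of "y1 - y2" "x - y1"] by (simp add: r1_def r2_def r_def)
  then show "(\<Sum>k\<in>UNIV. e k * p k) = (r2\<^sup>2 - r1\<^sup>2 - r\<^sup>2) / (2 * r1 * r)"
    unfolding p_def e_def sum_unit_vec r1_def[symmetric] r_def[symmetric] using r by (simp add: field_simps)
  have "(y1 - y2) \<bullet> (x - y2) = (r\<^sup>2 + r2\<^sup>2 - r1\<^sup>2) / 2"
    using dot_norm_neg[of "y1 - y2" "x - y2"] by (simp add: r1_def r2_def r_def norm_minus_commute)
  then show "(\<Sum>k\<in>UNIV. e k * q k) = (r2\<^sup>2 + r\<^sup>2 - r1\<^sup>2) / (2 * r2 * r)"
    unfolding q_def e_def sum_unit_vec r2_def[symmetric] r_def[symmetric] using r by (simp add: field_simps)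
  have "(x - y1) \<bullet> (x - y2) = (r1\<^sup>2 + r2\<^sup>2 - r\<^sup>2) / 2"
    using dot_norm_neg[of "x - y1" "x - y2"] by (simp add: r1_def r2_def r_def norm_minus_commute)
  then show "(\<Sum>k\<in>UNIV. p k * q k) = (r1\<^sup>2 + r2\<^sup>2 - r\<^sup>2) / (2 * r1 * r2)"
    unfolding p_def q_def sum_unit_vec r1_def[symmetric] r2_def[symmetric] using r by (simp add: field_simps)
  have "r1 * p j = r2 * q j - r * e j"
    using r by (simp add: p_def q_def e_def unit_vec_def r1_def r2_def r_def)
  then show "p j = (r2 * q j - r * e j) / r1" using r by (simp add: field_simps)
qed

lemma div_T_algebra:
  fixes r1 r2 r q e :: real
  assumes "r1 > 0" "r2 > 0" "r > 0"
  defines "s \<equiv> r1 + r2 + r" and "p \<equiv> (r2 * q - r * e) / r1"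
    and "P \<equiv> (r2\<^sup>2 - r1\<^sup>2 - r\<^sup>2) / (2 * r1 * r)" and "Q \<equiv> (r2\<^sup>2 + r\<^sup>2 - r1\<^sup>2) / (2 * r2 * r)"
    and "C \<equiv> (r1\<^sup>2 + r2\<^sup>2 - r\<^sup>2) / (2 * r1 * r2)"
  shows "((p + q) - e * (P + Q)) / (r * s\<^sup>2)
      + (- (2 / r1) * (q + e) + ((e - p) - (Q - C) * q) / r2) / s\<^sup>2
      - 2 * (P + Q - 1 - C) * (q + e) / s ^ 3
    = 1 / 2 * (q / r2\<^sup>2 * (1 / r - 1 / r1) + e / r\<^sup>2 * (1 / r2 - 1 / r1))"
proof -
  have s: "s > 0" using assms(1-3) by (simp add: s_def)
  have K: "2 * (P + Q - 1 - C) * (q + e) / s ^ 3 = (r2 - r - r1) * (r2 - r + r1) / (r1 * r2 * r) * (q + e) / s\<^sup>2"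
  proof -
    \<comment> \<open>This numerator contains the perimeter s as a factor, which lowers 1/s^3 to
      1/s^2; then all terms share the same power of s.\<close>
    have eq: "P + Q - 1 - C = s * ((r2 - r - r1) * (r2 - r + r1)) / (2 * r1 * r2 * r)"
      using assms(1-3) unfolding P_def Q_def C_def s_def
      by (simp add: field_simps power2_eq_square)
    show ?thesis unfolding eq using s assms(1-3) by (simp add: field_simps eval_nat_numeral)
  qed
  have main: "((p + q) - e * (P + Q)) / r + (- (2 / r1) * (q + e) + ((e - p) - (Q - C) * q) / r2)
      - (r2 - r - r1) * (r2 - r + r1) / (r1 * r2 * r) * (q + e)
    = 1 / 2 * (q / r2\<^sup>2 * (1 / r - 1 / r1) + e / r\<^sup>2 * (1 / r2 - 1 / r1)) * s\<^sup>2"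
    using assms(1-3) unfolding p_def P_def Q_def C_def s_def
    by (simp add: field_simps power2_eq_square)
  have split: "x / (r * s\<^sup>2) + A / s\<^sup>2 - B / s\<^sup>2 = (x / r + A - B) / s\<^sup>2" for x A B
    using s assms(1-3) by (simp add: field_simps)
  show ?thesis unfolding K split main using s by simp
qed

text \<open>
  With \<open>T\<^sub>k\<^sub>j = \<partial>\<^sup>2 g / \<partial>y\<^sub>1\<^sup>k \<partial>y\<^sub>2\<^sup>j\<close>, translation invariance gives
  \<open>\<partial>\<^sub>k T\<^sub>k\<^sub>j = \<partial>/\<partial>y\<^sub>2\<^sup>j (\<Delta>\<^sub>2 - \<Delta> - \<Delta>\<^sub>1) g / 2\<close>, where \<open>\<Delta> g = 1/r\<^sub>1r\<^sub>2\<close>,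
  \<open>\<Delta>\<^sub>1 g = 1/r\<^sub>1r\<^sub>1\<^sub>2\<close> and \<open>\<Delta>\<^sub>2 g = 1/r\<^sub>2r\<^sub>1\<^sub>2\<close>.
\<close>

definition V_field :: "point \<Rightarrow> point \<Rightarrow> point \<Rightarrow> 3 \<Rightarrow> real" where
  "V_field y1 y2 x j = 1 / 2 * (pd j (\<lambda>x. 1 / norm (x - y2)) x * (1 / norm (x - y1) - 1 / norm (y1 - y2))
     + (y1 - y2) $ j / norm (y1 - y2) ^ 3 * (1 / norm (x - y2) - 1 / norm (x - y1)))"

lemma div_T_field:
  assumes "x \<noteq> y1" "x \<noteq> y2" "y1 \<noteq> y2"
  shows "(\<Sum>k\<in>UNIV. pd k (\<lambda>x. T_field y1 y2 x k j) x) = V_field y1 y2 x j"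
proof -
  define r1 r2 r where "r1 = norm (x - y1)" "r2 = norm (x - y2)" "r = norm (y1 - y2)"
  define p q e where "p = unit_vec y1 x" "q = unit_vec y2 x" "e = unit_vec y2 y1"
  note defs = r1_r2_r_def p_q_e_def
  note dots = triangle_dots[OF assms, folded defs]
  have r: "0 < r1" "0 < r2" "0 < r" using assms by (simp_all add: defs)
  define s where "s = r1 + r2 + r"
  have "(\<Sum>k\<in>UNIV. pd k (\<lambda>x. T_field y1 y2 x k j) x) = (\<Sum>k\<in>UNIV.
      (kron k j - e k * e j) * (p k + q k) / (r * s\<^sup>2)
      + (- ((kron k k - p k * p k) / r1) * (q j + e j) + (e k - p k) * ((kron k j - q k * q j) / r2)) / s\<^sup>2
      - 2 * (e k - p k) * (q j + e j) * (p k + q k) / s ^ 3)"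
    unfolding pd_T_field[OF assms, folded defs] s_def ..
  also have "\<dots> = (\<Sum>k\<in>UNIV. (kron k j - e k * e j) * (p k + q k)) / (r * s\<^sup>2)
      + (- ((\<Sum>k\<in>UNIV. kron k k - p k * p k) / r1) * (q j + e j)
         + (\<Sum>k\<in>UNIV. (e k - p k) * (kron k j - q k * q j)) / r2) / s\<^sup>2
      - 2 * (\<Sum>k\<in>UNIV. (e k - p k) * (p k + q k)) * (q j + e j) / s ^ 3"
    by (simp only: sum_3) (simp add: add_divide_distrib diff_divide_distrib algebra_simps)
  also have "(\<Sum>k\<in>UNIV. (kron k j - e k * e j) * (p k + q k))
      = (p j + q j) - e j * ((\<Sum>k\<in>UNIV. e k * p k) + (\<Sum>k\<in>UNIV. e k * q k))"
  proof -
    have "(\<Sum>k\<in>UNIV. (kron k j - e k * e j) * (p k + q k))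
        = (\<Sum>k\<in>UNIV. kron k j * (p k + q k)) - e j * (\<Sum>k\<in>UNIV. e k * p k + e k * q k)"
      unfolding sum_distrib_left sum_subtractf[symmetric] by (intro sum.cong) (simp_all add: algebra_simps)
    then show ?thesis by (simp add: sum_kron sum.distrib)
  qed
  also have "(\<Sum>k\<in>UNIV. kron k k - p k * p k) = 2"
    by (simp add: sum_subtractf dots(1))
  also have "(\<Sum>k\<in>UNIV. (e k - p k) * (kron k j - q k * q j))
      = (e j - p j) - ((\<Sum>k\<in>UNIV. e k * q k) - (\<Sum>k\<in>UNIV. p k * q k)) * q j"
  proof -
    have "(\<Sum>k\<in>UNIV. (e k - p k) * (kron k j - q k * q j))
        = (\<Sum>k\<in>UNIV. (e k - p k) * kron k j) - (\<Sum>k\<in>UNIV. e k * q k - p k * q k) * q j"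
      unfolding sum_distrib_right sum_subtractf[symmetric] by (intro sum.cong) (simp_all add: algebra_simps)
    then show ?thesis by (simp add: sum_kron sum_subtractf)
  qed
  also have "(\<Sum>k\<in>UNIV. (e k - p k) * (p k + q k))
      = (\<Sum>k\<in>UNIV. e k * p k) + (\<Sum>k\<in>UNIV. e k * q k) - (\<Sum>k\<in>UNIV. p k * p k) - (\<Sum>k\<in>UNIV. p k * q k)"
    unfolding sum_subtractf[symmetric] sum.distrib[symmetric] by (intro sum.cong) (simp_all add: algebra_simps)
  also have "((p j + q j) - e j * ((\<Sum>k\<in>UNIV. e k * p k) + (\<Sum>k\<in>UNIV. e k * q k))) / (r * s\<^sup>2)
      + (- (2 / r1) * (q j + e j)
         + ((e j - p j) - ((\<Sum>k\<in>UNIV. e k * q k) - (\<Sum>k\<in>UNIV. p k * q k)) * q j) / r2) / s\<^sup>2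
      - 2 * ((\<Sum>k\<in>UNIV. e k * p k) + (\<Sum>k\<in>UNIV. e k * q k) - (\<Sum>k\<in>UNIV. p k * p k) - (\<Sum>k\<in>UNIV. p k * q k)) * (q j + e j) / s ^ 3
      = 1 / 2 * (q j / r2\<^sup>2 * (1 / r - 1 / r1) + e j / r\<^sup>2 * (1 / r2 - 1 / r1))"
    unfolding dots(1-5) dots(6)[of j] s_def by (rule div_T_algebra[OF r])
  also have "\<dots> = V_field y1 y2 x j"
  proof -
    have "q j / r2\<^sup>2 = - pd j (\<lambda>x. 1 / norm (x - y2)) x"
      using assms(2) r by (simp add: pd_inverse_norm[OF assms(2)] defs unit_vec_def power2_eq_square power3_eq_cube mult.assoc
          del: vector_minus_component)
    moreover have "e j / r\<^sup>2 = (y1 - y2) $ j / norm (y1 - y2) ^ 3"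
      by (simp add: defs unit_vec_def power2_eq_square power3_eq_cube)
    ultimately show ?thesis
      unfolding V_field_def by (simp only: defs) (simp add: algebra_simps)
  qed
  finally show ?thesis .
qed

lemma div_T_field':
  assumes "x \<noteq> y1" "x \<noteq> y2" "y1 \<noteq> y2"
  shows "(\<Sum>k\<in>UNIV. pd k (\<lambda>x. T_field y1 y2 x i k) x) = V_field y2 y1 x i"
  using div_T_field[of x y2 y1 i] assms T_field_swap[of y1 y2] by simp

text \<open>In the notation used above for the divergence, translation invariance gives Laplace =
  Laplace_1 + Laplace_2 + 2 T_kk when applied to g. So the trace is half of 1/(r1 r2) - 1/(r1 r12) -
  1/(r2 r12), the expanded product potential without its constant.\<close>

lemma trace_T_field:
  assumes "x \<noteq> y1" "x \<noteq> y2" "y1 \<noteq> y2"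
  shows "(\<Sum>k\<in>UNIV. T_field y1 y2 x k k) = 1 / 2 * (product_potential y1 y2 x - 1 / (norm (y1 - y2))\<^sup>2)"
proof -
  define r1 r2 r where "r1 = norm (x - y1)" "r2 = norm (x - y2)" "r = norm (y1 - y2)"
  define p q e where "p = unit_vec y1 x" "q = unit_vec y2 x" "e = unit_vec y2 y1"
  note defs = r1_r2_r_def p_q_e_def
  note dots = triangle_dots[OF assms, folded defs]
  have r: "0 < r1" "0 < r2" "0 < r" using assms by (simp_all add: defs)
  define s where "s = r1 + r2 + r"
  have s: "0 < s" using r by (simp add: s_def)
  have "(\<Sum>k\<in>UNIV. T_field y1 y2 x k k)
      = (\<Sum>k\<in>UNIV. - ((kron k k - e k * e k) / r) / s + (e k - p k) * (q k + e k) / s\<^sup>2)"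
    unfolding T_field_def defs s_def ..
  also have "\<dots> = - ((\<Sum>k\<in>UNIV. kron k k - e k * e k) / r) / s + (\<Sum>k\<in>UNIV. (e k - p k) * (q k + e k)) / s\<^sup>2"
    by (simp only: sum_3) (simp add: add_divide_distrib diff_divide_distrib)
  also have "(\<Sum>k\<in>UNIV. kron k k - e k * e k) = 2"
    by (simp add: sum_subtractf dots(2))
  also have "(\<Sum>k\<in>UNIV. (e k - p k) * (q k + e k))
      = (\<Sum>k\<in>UNIV. e k * q k) + (\<Sum>k\<in>UNIV. e k * e k) - (\<Sum>k\<in>UNIV. p k * q k) - (\<Sum>k\<in>UNIV. e k * p k)"
    unfolding sum_subtractf[symmetric] sum.distrib[symmetric] by (intro sum.cong) (simp_all add: algebra_simps)
  also have "\<dots> = s * (r\<^sup>2 - (r1 - r2)\<^sup>2) / (2 * r1 * r2 * r)"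
    unfolding dots(1-5) s_def using r by (simp add: field_simps power2_eq_square)
  also have "- (2 / r) / s + s * (r\<^sup>2 - (r1 - r2)\<^sup>2) / (2 * r1 * r2 * r) / s\<^sup>2
      = (r\<^sup>2 - (r1 - r2)\<^sup>2 - 4 * (r1 * r2)) / (2 * r1 * r2 * r) / s"
    using r s by (simp add: field_simps power2_eq_square)
  \<comment> \<open>The left side is r^2 - (r1 + r2)^2; its factor s cancels the perimeter in the
    denominator.\<close>
  also have "r\<^sup>2 - (r1 - r2)\<^sup>2 - 4 * (r1 * r2) = (r - r1 - r2) * s"
    by (simp add: s_def power2_eq_square algebra_simps)
  also have "(r - r1 - r2) * s / (2 * r1 * r2 * r) / s = 1 / 2 * ((1 / r1 - 1 / r) * (1 / r2 - 1 / r) - 1 / r\<^sup>2)"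
    using r s by (simp add: field_simps power2_eq_square)
  finally show ?thesis by (simp add: product_potential_def defs)
qed

section \<open>Double divergence of the field s\<close>

lemma open_Compl_pair [simp]: "open (- {y1, y2 :: point})"
  by (intro open_Compl) auto

lemma smooth_on_inverse_norm: "open S \<Longrightarrow> y \<notin> S \<Longrightarrow> smooth_on S (\<lambda>x. c / norm (x - y))"
  by (intro smooth_on_divide smooth_on_const smooth_on_norm) auto

lemma pd_add_const: "f differentiable (at x) \<Longrightarrow> pd i (\<lambda>x. f x - c) x = pd i f x"
  using pd_add[of f x "\<lambda>x. - c"] by simp

definition div_V_source :: "point \<Rightarrow> point \<Rightarrow> point \<Rightarrow> real" where
  "div_V_source y1 y2 x = product_source y1 y2 x / 4
     + (((x - y1) \<bullet> (y1 - y2)) / norm (x - y1) ^ 3 - ((x - y2) \<bullet> (y1 - y2)) / norm (x - y2) ^ 3)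
        / (2 * norm (y1 - y2) ^ 3)"

text \<open>Both sides are the double divergence of the same tensor, contracted in the two possible
  orders. Symmetrising the tensor therefore leaves the double divergence unchanged.\<close>

lemma div_V_source_swap: "div_V_source y1 y2 = div_V_source y2 y1"
proof
  fix x
  have swap: "(x - y2) \<bullet> (y1 - y2) = - ((x - y2) \<bullet> (y2 - y1))" "(x - y1) \<bullet> (y1 - y2) = - ((x - y1) \<bullet> (y2 - y1))"
    by (simp_all add: inner_diff_right)
  show "div_V_source y1 y2 x = div_V_source y2 y1 x"
    unfolding div_V_source_def product_source_def swap norm_minus_commute[of y1 y2] inner_commute[of "x - y1" "x - y2"]
    by (simp add: mult.commute)
qed

lemma smooth_on_V_field: "smooth_on (- {y1, y2}) (\<lambda>x. V_field y1 y2 x j)"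
  unfolding V_field_def
  by (intro smooth_on_mult smooth_on_add smooth_on_diff smooth_on_const smooth_on_pd smooth_on_inverse_norm
      open_Compl_pair) auto

lemma div_V_field:
  assumes "x \<noteq> y1" "x \<noteq> y2"
  shows "(\<Sum>j\<in>UNIV. pd j (\<lambda>x. V_field y1 y2 x j) x) = div_V_source y1 y2 x"
proof -
  let ?U = "- {y1, y2}"
  define a b D c where "a = (\<lambda>x. 1 / norm (x - y1))" "b = (\<lambda>x. 1 / norm (x - y2))"
    "D = 1 / norm (y1 - y2)" "c = (\<lambda>j. (y1 - y2) $ j / norm (y1 - y2) ^ 3)"
  note defs = this
  have x: "x \<in> ?U" using assms by simp
  have sm: "smooth_on ?U a" "smooth_on ?U b"
    unfolding defs by (auto intro: smooth_on_inverse_norm)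
  note dif = smooth_on_differentiable[OF _ open_Compl_pair x]
  have "pd j (\<lambda>x. V_field y1 y2 x j) x
      = 1 / 2 * ((pd j (pd j b) x * (a x - D) + pd j a x * pd j b x) + c j * (pd j b x - pd j a x))" for j
  proof -
    have "pd j (\<lambda>x. V_field y1 y2 x j) x
        = pd j (\<lambda>x. 1 / 2 * (pd j b x * (a x - D) + c j * (b x + (-1) * a x))) x"
      by (simp add: V_field_def defs)
    also have "\<dots> = 1 / 2 * pd j (\<lambda>x. pd j b x * (a x - D) + c j * (b x + (-1) * a x)) x"
      by (intro pd_cmult dif smooth_on_add smooth_on_mult smooth_on_diff smooth_on_const smooth_on_pd sm open_Compl_pair)
    also have "pd j (\<lambda>x. pd j b x * (a x - D) + c j * (b x + (-1) * a x)) x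
        = pd j (\<lambda>x. pd j b x * (a x - D)) x + pd j (\<lambda>x. c j * (b x + (-1) * a x)) x"
      by (intro pd_add dif smooth_on_add smooth_on_mult smooth_on_diff smooth_on_const smooth_on_pd sm open_Compl_pair)
    also have "pd j (\<lambda>x. pd j b x * (a x - D)) x = pd j (pd j b) x * (a x - D) + pd j b x * pd j (\<lambda>x. a x - D) x"
      by (intro pd_mult dif smooth_on_diff smooth_on_const smooth_on_pd sm open_Compl_pair)
    also have "pd j (\<lambda>x. a x - D) x = pd j a x"
      by (intro pd_add_const dif sm)
    also have "pd j (\<lambda>x. c j * (b x + (-1) * a x)) x = c j * pd j (\<lambda>x. b x + (-1) * a x) x"
      by (intro pd_cmult dif smooth_on_add smooth_on_mult smooth_on_const sm open_Compl_pair)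
    also have "pd j (\<lambda>x. b x + (-1) * a x) x = pd j b x + pd j (\<lambda>x. (-1) * a x) x"
      by (intro pd_add dif smooth_on_add smooth_on_mult smooth_on_const sm open_Compl_pair)
    also have "pd j (\<lambda>x. (-1) * a x) x = (-1) * pd j a x"
      by (intro pd_cmult dif sm)
    finally show ?thesis by simp
  qed
  then have "(\<Sum>j\<in>UNIV. pd j (\<lambda>x. V_field y1 y2 x j) x)
      = 1 / 2 * (laplacian b x * (a x - D) + (\<Sum>j\<in>UNIV. pd j a x * pd j b x)
        + ((\<Sum>j\<in>UNIV. c j * pd j b x) - (\<Sum>j\<in>UNIV. c j * pd j a x)))"
    by (simp add: laplacian_def sum.distrib sum_distrib_left sum_distrib_right sum_subtractf right_diff_distrib
        add_divide_distrib diff_divide_distrib flip: sum_divide_distrib)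
  moreover have "laplacian b x = 0"
    unfolding defs using laplacian_inverse_norm[OF assms(2), of 1] by simp
  moreover have "(\<Sum>j\<in>UNIV. pd j a x * pd j b x) = ((x - y1) \<bullet> (x - y2)) / (norm (x - y1) ^ 3 * norm (x - y2) ^ 3)"
    unfolding defs using sum_pd_inverse_reg_dist[of y1 0 x y2 0] assms by simp
  moreover have "(\<Sum>j\<in>UNIV. c j * pd j (\<lambda>x. 1 / norm (x - y)) x)
      = - (((x - y) \<bullet> (y1 - y2)) / norm (x - y) ^ 3 / norm (y1 - y2) ^ 3)" if "x \<noteq> y" for y
    unfolding pd_inverse_norm[OF that] defs inner_sum sum_3
    by (simp add: add_divide_distrib mult.commute del: vector_minus_component)
  from this[OF assms(1)] this[OF assms(2)]
  have "(\<Sum>j\<in>UNIV. c j * pd j a x) = - (((x - y1) \<bullet> (y1 - y2)) / norm (x - y1) ^ 3 / norm (y1 - y2) ^ 3)"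
    "(\<Sum>j\<in>UNIV. c j * pd j b x) = - (((x - y2) \<bullet> (y1 - y2)) / norm (x - y2) ^ 3 / norm (y1 - y2) ^ 3)"
    by (simp_all only: defs)
  ultimately show ?thesis
    by (simp add: div_V_source_def product_source_def add_divide_distrib diff_divide_distrib)
qed

lemma smooth_on_T_field:
  assumes "y1 \<noteq> y2"
  shows "smooth_on (- {y1, y2}) (\<lambda>x. T_field y1 y2 x i j)"
  unfolding T_field_def
  by (intro smooth_on_add smooth_on_divide smooth_on_mult smooth_on_diff smooth_on_const smooth_on_power
      smooth_on_norm smooth_on_unit_vec open_Compl_pair zero_less_power perimeter_pos assms) auto

lemma smooth_on_s_field:
  assumes "y1 \<noteq> y2"
  shows "smooth_on (- {y1, y2}) (\<lambda>x. s_field y1 y2 x i j)"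
proof (rule smooth_on_cong[OF open_Compl_pair, THEN iffD2])
  show "s_field y1 y2 x i j = 1 / 2 * (T_field y1 y2 x i j + T_field y1 y2 x j i)
      + (- kron i j / 3) * (\<Sum>k\<in>UNIV. T_field y1 y2 x k k)" if "x \<in> - {y1, y2}" for x
    using that assms by (simp add: s_field_eq)
  show "smooth_on (- {y1, y2}) (\<lambda>x. 1 / 2 * (T_field y1 y2 x i j + T_field y1 y2 x j i)
      + (- kron i j / 3) * (\<Sum>k\<in>UNIV. T_field y1 y2 x k k))"
    by (intro smooth_on_add smooth_on_mult smooth_on_sum smooth_on_const smooth_on_T_field open_Compl_pair assms)
qed

lemma s_field_sym: "s_field y1 y2 x i j = s_field y1 y2 x j i"
  by (simp add: s_field_def stf_def kron_def add.commute)

lemma s_field_trace: "(\<Sum>i\<in>UNIV. s_field y1 y2 x i i) = 0"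
  by (simp add: s_field_def stf_def sum_3 field_simps)

lemma smooth_on_product_potential: "smooth_on (- {y1, y2}) (product_potential y1 y2)"
  unfolding product_potential_def[abs_def]
  by (intro smooth_on_mult smooth_on_diff smooth_on_const smooth_on_inverse_norm open_Compl_pair) auto

lemma laplacian_product_potential:
  assumes "x \<noteq> y1" "x \<noteq> y2"
  shows "laplacian (product_potential y1 y2) x = product_source y1 y2 x"
proof -
  let ?U = "- {y1, y2}"
  define a where "a y x = 1 / norm (x - y)" for y x :: point
  define D where "D = 1 / norm (y1 - y2)"
  have x: "x \<in> ?U" using assms by simp
  have sm: "smooth_on ?U (a y)" if "y \<in> {y1, y2}" for y
    unfolding a_def using that by (auto intro: smooth_on_inverse_norm)
  have smD: "smooth_on ?U (\<lambda>x. a y x - D)" if "y \<in> {y1, y2}" for y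
    by (intro smooth_on_diff sm that smooth_on_const open_Compl_pair)
  have pdD: "pd i (\<lambda>x. a y x - D) z = pd i (a y) z" if "y \<in> {y1, y2}" "z \<in> ?U" for y z i
    by (intro pd_add_const smooth_on_differentiable[OF sm open_Compl_pair] that)
  have lapD: "laplacian (\<lambda>x. a y x - D) x = 0" if "y \<in> {y1, y2}" for y
  proof -
    have "pd i (pd i (\<lambda>x. a y x - D)) x = pd i (pd i (a y)) x" for i
      by (rule pd_cong[OF open_Compl_pair x]) (rule pdD[OF that])
    then have "laplacian (\<lambda>x. a y x - D) x = laplacian (a y) x" by (simp add: laplacian_def)
    also have "\<dots> = 0" unfolding a_def[abs_def] using laplacian_inverse_norm[of x y 1] that assms by auto
    finally show ?thesis .
  qed
  have "laplacian (product_potential y1 y2) x = laplacian (\<lambda>x. (a y1 x - D) * (a y2 x - D)) x"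
    by (simp add: product_potential_def[abs_def] a_def D_def)
  also have "\<dots> = 2 * (\<Sum>i\<in>UNIV. pd i (a y1) x * pd i (a y2) x)"
    by (subst laplacian_mult[OF open_Compl_pair smD smD x]) (simp_all add: lapD pdD[OF _ x])
  also have "(\<Sum>i\<in>UNIV. pd i (a y1) x * pd i (a y2) x) = ((x - y1) \<bullet> (x - y2)) / (norm (x - y1) ^ 3 * norm (x - y2) ^ 3)"
    unfolding a_def[abs_def] using sum_pd_inverse_reg_dist[of y1 0 x y2 0] assms by simp
  finally show ?thesis by (simp add: product_source_def)
qed

text \<open>Removing the trace \<tau> subtracts Laplace \<tau>/3, and \<tau> is half the product
  potential up to a constant: hence the 1/6.\<close>

lemma div_div_s_field:
  assumes "x \<noteq> y1" "x \<noteq> y2" "y1 \<noteq> y2"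
  shows "(\<Sum>i\<in>UNIV. \<Sum>j\<in>UNIV. pd i (pd j (\<lambda>x. s_field y1 y2 x i j)) x)
    = div_V_source y1 y2 x - product_source y1 y2 x / 6"
proof -
  let ?U = "- {y1, y2}"
  define T where "T i j = (\<lambda>x. T_field y1 y2 x i j)" for i j
  define \<tau> where "\<tau> = (\<lambda>x. \<Sum>k\<in>UNIV. T k k x)"
  have x: "x \<in> ?U" using assms by simp
  have smT: "smooth_on ?U (T i j)" for i j unfolding T_def by (rule smooth_on_T_field[OF assms(3)])
  have sm\<tau>: "smooth_on ?U \<tau>" unfolding \<tau>_def by (intro smooth_on_sum smT open_Compl_pair)
  have smV: "smooth_on ?U (\<lambda>x. V_field y1 y2 x i)" "smooth_on ?U (\<lambda>x. V_field y2 y1 x i)" for i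
    using smooth_on_V_field[of y1 y2 i] smooth_on_V_field[of y2 y1 i] by (simp_all add: insert_commute)
  note dif = smooth_on_differentiable[OF _ open_Compl_pair]
  have lin: "pd i (\<lambda>x. a * f x + b * g x + c * h x) z = a * pd i f z + b * pd i g z + c * pd i h z"
    if "smooth_on ?U f" "smooth_on ?U g" "smooth_on ?U h" "z \<in> ?U" for a b c f g h i z
  proof -
    have "pd i (\<lambda>x. a * f x + b * g x + c * h x) z = pd i (\<lambda>x. a * f x + b * g x) z + pd i (\<lambda>x. c * h x) z"
      by (intro pd_add dif[OF _ that(4)] smooth_on_add smooth_on_mult smooth_on_const that open_Compl_pair)
    also have "pd i (\<lambda>x. a * f x + b * g x) z = pd i (\<lambda>x. a * f x) z + pd i (\<lambda>x. b * g x) z"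
      by (intro pd_add dif[OF _ that(4)] smooth_on_add smooth_on_mult smooth_on_const that open_Compl_pair)
    finally show ?thesis using that by (simp add: pd_cmult dif)
  qed
  have div: "(\<Sum>j\<in>UNIV. pd j (\<lambda>x. s_field y1 y2 x i j) z)
      = 1 / 2 * V_field y2 y1 z i + 1 / 2 * V_field y1 y2 z i + (- 1 / 3) * pd i \<tau> z" if z: "z \<in> ?U" for i z
  proof -
    have eq: "pd j (\<lambda>x. s_field y1 y2 x i j) z
        = pd j (\<lambda>x. 1 / 2 * T i j x + 1 / 2 * T j i x + (- kron i j / 3) * \<tau> x) z" for j
      by (rule pd_cong[OF open_Compl_pair z]) (use assms(3) in \<open>simp add: s_field_eq T_def \<tau>_def add_divide_distrib\<close>)
    have "(\<Sum>j\<in>UNIV. pd j (\<lambda>x. s_field y1 y2 x i j) z)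
        = (\<Sum>j\<in>UNIV. 1 / 2 * pd j (T i j) z + 1 / 2 * pd j (T j i) z + (- 1 / 3) * (kron i j * pd j \<tau> z))"
      unfolding eq lin[OF smT smT sm\<tau> z] by simp
    also have "\<dots> = 1 / 2 * (\<Sum>j\<in>UNIV. pd j (T i j) z) + 1 / 2 * (\<Sum>j\<in>UNIV. pd j (T j i) z)
        + (- 1 / 3) * (\<Sum>j\<in>UNIV. kron i j * pd j \<tau> z)"
      by (simp only: sum.distrib sum_distrib_left)
    also have "(\<Sum>j\<in>UNIV. kron i j * pd j \<tau> z) = pd i \<tau> z" by (rule sum_kron(3))
    finally show ?thesis
      unfolding T_def using z assms(3) by (simp add: div_T_field div_T_field')
  qed
  have sms: "smooth_on ?U (pd j (\<lambda>x. s_field y1 y2 x i j))" for i j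
    by (intro smooth_on_pd smooth_on_s_field assms)
  have "(\<Sum>i\<in>UNIV. \<Sum>j\<in>UNIV. pd i (pd j (\<lambda>x. s_field y1 y2 x i j)) x)
      = (\<Sum>i\<in>UNIV. pd i (\<lambda>z. \<Sum>j\<in>UNIV. pd j (\<lambda>x. s_field y1 y2 x i j) z) x)"
    by (intro sum.cong refl pd_sum[symmetric] dif[OF sms x])
  also have "\<dots> = (\<Sum>i\<in>UNIV. 1 / 2 * pd i (\<lambda>z. V_field y2 y1 z i) x + 1 / 2 * pd i (\<lambda>z. V_field y1 y2 z i) x
      + (- 1 / 3) * pd i (pd i \<tau>) x)"
  proof (intro sum.cong refl)
    fix i
    have "pd i (\<lambda>z. \<Sum>j\<in>UNIV. pd j (\<lambda>x. s_field y1 y2 x i j) z) x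
        = pd i (\<lambda>z. 1 / 2 * V_field y2 y1 z i + 1 / 2 * V_field y1 y2 z i + (- 1 / 3) * pd i \<tau> z) x"
      by (rule pd_cong[OF open_Compl_pair x]) (rule div)
    also have "\<dots> = 1 / 2 * pd i (\<lambda>z. V_field y2 y1 z i) x + 1 / 2 * pd i (\<lambda>z. V_field y1 y2 z i) x
      + (- 1 / 3) * pd i (pd i \<tau>) x"
      by (intro lin smV smooth_on_pd sm\<tau> x)
    finally show "pd i (\<lambda>z. \<Sum>j\<in>UNIV. pd j (\<lambda>x. s_field y1 y2 x i j) z) x
      = 1 / 2 * pd i (\<lambda>z. V_field y2 y1 z i) x + 1 / 2 * pd i (\<lambda>z. V_field y1 y2 z i) x
      + (- 1 / 3) * pd i (pd i \<tau>) x" .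
  qed
  also have "\<dots> = 1 / 2 * (\<Sum>i\<in>UNIV. pd i (\<lambda>z. V_field y2 y1 z i) x)
      + 1 / 2 * (\<Sum>i\<in>UNIV. pd i (\<lambda>z. V_field y1 y2 z i) x) + (- 1 / 3) * laplacian \<tau> x"
    by (simp only: sum.distrib sum_distrib_left laplacian_def)
  also have "laplacian \<tau> x = 1 / 2 * product_source y1 y2 x"
  proof -
    define \<tau>' where "\<tau>' = (\<lambda>x. 1 / 2 * product_potential y1 y2 x + (- 1 / 2 / (norm (y1 - y2))\<^sup>2) * (1::real))"
    have eq: "\<tau> z = \<tau>' z" if "z \<in> ?U" for z
      unfolding \<tau>_def \<tau>'_def T_def using that assms(3) by (simp add: trace_T_field right_diff_distrib)
    have "pd i \<tau> z = pd i \<tau>' z" if "z \<in> ?U" for i z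
      by (rule pd_cong[OF open_Compl_pair that eq])
    then have "pd i (pd i \<tau>) x = pd i (pd i \<tau>') x" for i
      by (rule pd_cong[OF open_Compl_pair x])
    then have "laplacian \<tau> x = laplacian \<tau>' x" by (simp add: laplacian_def)
    also have "\<dots> = 1 / 2 * laplacian (product_potential y1 y2) x + (- 1 / 2 / (norm (y1 - y2))\<^sup>2) * laplacian (\<lambda>_. 1) x"
      unfolding \<tau>'_def by (rule laplacian_lincomb[OF open_Compl_pair smooth_on_product_potential smooth_on_const x])
    finally show ?thesis using assms by (simp add: laplacian_product_potential laplacian_def[of "\<lambda>_. 1"])
  qed
  finally show ?thesis
    using assms div_V_field[of x y1 y2] div_V_field[of x y2 y1] div_V_source_swap[of y2 y1] by simp
qed

subsection \<open>The constraint equation order by order\<close>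

lemma fpd_nth [simp]: "fps_nth (fpd i F x) n = pd i (\<lambda>z. fps_nth (F z) n) x"
  by (simp add: fpd_def)

lemma fpd_const [simp]: "fpd i (\<lambda>z. c) x = 0"
  by (rule fps_ext) simp

lemma gamma_tilde_nth:
  "fps_nth (gamma_tilde y1 y2 x $ i $ j) n = (if n = 0 then kron i j else if n = 1 then s_field y1 y2 x i j else 0)"
  by (cases n) (auto simp: gamma_tilde_def fps_mult_fps_X_commute fps_X_mult_nth)

text \<open>
  A matrix of power series has a two-sided inverse if its constant term is the identity; without
  one, \<^const>\<open>matrix_inv\<close> would be unspecified.
\<close>

primrec neumann :: "(3 \<Rightarrow> 3 \<Rightarrow> real) \<Rightarrow> nat \<Rightarrow> 3 \<Rightarrow> 3 \<Rightarrow> real" where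
  "neumann s 0 = kron"
| "neumann s (Suc n) = (\<lambda>i j. - (\<Sum>k\<in>UNIV. s i k * neumann s n k j))"

text \<open>The recursion puts the new factor on the left, which yields one of the two inverse
  identities; the other needs it on the right.\<close>

lemma neumann_Suc_right: "neumann s (Suc n) i j = - (\<Sum>k\<in>UNIV. neumann s n i k * s k j)"
proof (induction n arbitrary: i j)
  case 0
  show ?case by (simp add: sum_kron)
next
  case (Suc n)
  have "neumann s (Suc (Suc n)) i j = - (\<Sum>k\<in>UNIV. s i k * - (\<Sum>l\<in>UNIV. neumann s n k l * s l j))"
    by (simp only: neumann.simps(2)[of s "Suc n"] Suc.IH)
  also have "\<dots> = (\<Sum>k\<in>UNIV. \<Sum>l\<in>UNIV. s i k * neumann s n k l * s l j)"
    by (simp add: sum_negf sum_distrib_left mult.assoc)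
  also have "\<dots> = (\<Sum>l\<in>UNIV. \<Sum>k\<in>UNIV. s i k * neumann s n k l * s l j)"
    by (rule sum.swap)
  also have "\<dots> = - (\<Sum>l\<in>UNIV. neumann s (Suc n) i l * s l j)"
    by (simp add: sum_distrib_right sum_negf)
  finally show ?case .
qed

lemma gamma_tilde_inverse:
  "gamma_tilde y1 y2 x ** matrix_inv (gamma_tilde y1 y2 x) = mat 1"
proof -
  let ?A = "gamma_tilde y1 y2 x" and ?s = "s_field y1 y2 x"
  define B :: "real fps ^ 3 ^ 3" where "B = (\<chi> i j. Abs_fps (\<lambda>n. neumann ?s n i j))"
  have B: "fps_nth (B $ i $ j) n = neumann ?s n i j" for i j n by (simp add: B_def)
  have nth0: "fps_nth (f * g) 0 = fps_nth f 0 * fps_nth g 0" for f g :: "real fps" by simp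
  have A: "?A $ i $ j = fps_const (kron i j) + fps_X * fps_const (?s i j)" for i j by (simp add: gamma_tilde_def)
  have one: "fps_nth (mat 1 $ i $ j :: real fps) n = (if n = 0 then kron i j else 0)" for i j :: 3 and n
    by (simp add: mat_def kron_def)
  have "?A ** B = mat 1"
  proof (intro vec_eq_iff[THEN iffD2] allI fps_ext)
    fix i j n
    have "fps_nth ((?A ** B) $ i $ j) n = (\<Sum>k\<in>UNIV. kron i k * neumann ?s n k j)
        + (if n = 0 then 0 else (\<Sum>k\<in>UNIV. ?s i k * neumann ?s (n - 1) k j))"
      by (simp add: matrix_matrix_mult_def fps_sum_nth A B distrib_right sum.distrib mult.assoc fps_X_mult_nth)
    then have "fps_nth ((?A ** B) $ i $ j) n = neumann ?s n i j
        + (if n = 0 then 0 else (\<Sum>k\<in>UNIV. ?s i k * neumann ?s (n - 1) k j))"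
      by (simp only: sum_kron)
    then show "fps_nth ((?A ** B) $ i $ j) n = fps_nth (mat 1 $ i $ j) n"
      by (cases n) (simp_all add: sum_kron one)
  qed
  moreover have "B ** ?A = mat 1"
  proof (intro vec_eq_iff[THEN iffD2] allI fps_ext)
    fix i j n
    have "fps_nth ((B ** ?A) $ i $ j) n = (\<Sum>k\<in>UNIV. neumann ?s n i k * kron k j)
        + (if n = 0 then 0 else (\<Sum>k\<in>UNIV. neumann ?s (n - 1) i k * ?s k j))"
    proof -
      have "B $ i $ k * ?A $ k $ j = B $ i $ k * fps_const (kron k j) + fps_X * (B $ i $ k * fps_const (?s k j))" for k
        by (simp add: A distrib_left mult_ac)
      then show ?thesis
        by (simp add: matrix_matrix_mult_def fps_sum_nth B sum.distrib fps_X_mult_nth)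
    qed
    then have "fps_nth ((B ** ?A) $ i $ j) n = neumann ?s n i j
        + (if n = 0 then 0 else (\<Sum>k\<in>UNIV. neumann ?s (n - 1) i k * ?s k j))"
      by (simp only: sum_kron)
    then show "fps_nth ((B ** ?A) $ i $ j) n = fps_nth (mat 1 $ i $ j) n"
      by (cases n) (simp_all add: sum_kron one neumann_Suc_right del: neumann.simps(2))
  qed
  ultimately have "\<exists>B. ?A ** B = mat 1 \<and> B ** ?A = mat 1" by blast
  from someI_ex[OF this] show ?thesis unfolding matrix_inv_def by blast
qed

lemma gamma_tilde_inverse_nth_0: "fps_nth (matrix_inv (gamma_tilde y1 y2 x) $ i $ j) 0 = kron i j"
proof -
  let ?A = "gamma_tilde y1 y2 x"
  have "fps_nth ((?A ** matrix_inv ?A) $ i $ j) 0 = kron i j"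
    unfolding gamma_tilde_inverse by (simp add: mat_def kron_def)
  then show ?thesis
    by (simp add: matrix_matrix_mult_def fps_sum_nth gamma_tilde_nth sum_kron)
qed

lemma christoffel_nth_0: "fps_nth (christoffel (gamma_tilde y1 y2) k i j x) 0 = 0"
  by (simp add: christoffel_def fps_sum_nth gamma_tilde_nth)

definition lin_christoffel :: "point \<Rightarrow> point \<Rightarrow> 3 \<Rightarrow> 3 \<Rightarrow> 3 \<Rightarrow> point \<Rightarrow> real" where
  "lin_christoffel y1 y2 k i j x = 1 / 2 * (pd i (\<lambda>z. s_field y1 y2 z k j) x
     + pd j (\<lambda>z. s_field y1 y2 z k i) x - pd k (\<lambda>z. s_field y1 y2 z i j) x)"

lemma christoffel_nth_1:
  "fps_nth (christoffel (gamma_tilde y1 y2) k i j x) 1 = lin_christoffel y1 y2 k i j x"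
proof -
  let ?t = "\<lambda>l. pd i (\<lambda>z. s_field y1 y2 z l j) x + pd j (\<lambda>z. s_field y1 y2 z l i) x - pd l (\<lambda>z. s_field y1 y2 z i j) x"
  have "fps_nth (christoffel (gamma_tilde y1 y2) k i j x) 1 = 1 / 2 * (\<Sum>l\<in>UNIV. kron k l * ?t l)"
    by (simp add: christoffel_def fps_sum_nth fps_mult_nth_1 gamma_tilde_nth gamma_tilde_inverse_nth_0)
  then show ?thesis by (simp only: sum_kron lin_christoffel_def)
qed

lemma ricci_nth_0: "fps_nth (ricci (gamma_tilde y1 y2) i j x) 0 = 0"
  by (simp add: ricci_def fps_sum_nth christoffel_nth_0)

text \<open>The connection starts at first order, so its products contribute from second order
  on.\<close>

lemma ricci_nth_1:
  "fps_nth (ricci (gamma_tilde y1 y2) i j x) 1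
    = (\<Sum>k\<in>UNIV. pd k (lin_christoffel y1 y2 k i j) x - pd j (lin_christoffel y1 y2 k i k) x)"
  by (simp add: ricci_def fps_sum_nth fps_mult_nth_1 christoffel_nth_0 christoffel_nth_1[unfolded One_nat_def])

lemma scalar_curvature_nth_1:
  "fps_nth (scalar_curvature (gamma_tilde y1 y2) x) 1
    = (\<Sum>i\<in>UNIV. \<Sum>k\<in>UNIV. pd k (lin_christoffel y1 y2 k i i) x - pd i (lin_christoffel y1 y2 k i k) x)"
proof -
  have "fps_nth (scalar_curvature (gamma_tilde y1 y2) x) 1
      = (\<Sum>i\<in>UNIV. \<Sum>j\<in>UNIV. kron i j * fps_nth (ricci (gamma_tilde y1 y2) i j x) 1)"
    by (simp add: scalar_curvature_def fps_sum_nth fps_mult_nth_1 ricci_nth_0 gamma_tilde_inverse_nth_0)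
  then show ?thesis by (simp only: sum_kron ricci_nth_1)
qed

text \<open>The linearised curvature of \<delta>_ij + h_ij is the double divergence of h minus the
  Laplacian of its trace, and s is trace-free.\<close>

lemma scalar_curvature_nth_1_eq:
  assumes "x \<noteq> y1" "x \<noteq> y2" "y1 \<noteq> y2"
  shows "fps_nth (scalar_curvature (gamma_tilde y1 y2) x) 1
    = (\<Sum>i\<in>UNIV. \<Sum>j\<in>UNIV. pd i (pd j (\<lambda>x. s_field y1 y2 x i j)) x)"
proof -
  let ?U = "- {y1, y2}"
  define s where "s i j = (\<lambda>z. s_field y1 y2 z i j)" for i j
  have x: "x \<in> ?U" using assms by simp
  note dif = smooth_on_differentiable[OF _ open_Compl_pair[of y1 y2]]
  have sm: "smooth_on ?U (s i j)" for i j unfolding s_def by (rule smooth_on_s_field[OF assms(3)])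
  have sym: "s i j = s j i" for i j unfolding s_def using s_field_sym by blast
  have "(\<Sum>i\<in>UNIV. s i i z) = 0" for z unfolding s_def by (rule s_field_trace)
  then have tr: "(\<Sum>i\<in>UNIV. pd k (pd k (s i i)) x) = 0" for k
  proof -
    have "pd k (\<lambda>z. \<Sum>i\<in>UNIV. s i i z) z = (\<Sum>i\<in>UNIV. pd k (s i i) z)" if "z \<in> ?U" for z
      by (intro pd_sum dif sm that)
    then have "pd k (pd k (\<lambda>z. \<Sum>i\<in>UNIV. s i i z)) x = pd k (\<lambda>z. \<Sum>i\<in>UNIV. pd k (s i i) z) x"
      by (intro pd_cong[OF open_Compl_pair x])
    also have "\<dots> = (\<Sum>i\<in>UNIV. pd k (pd k (s i i)) x)"
      by (intro pd_sum dif smooth_on_pd sm x)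
    finally show ?thesis using \<open>\<And>z. (\<Sum>i\<in>UNIV. s i i z) = 0\<close> by simp
  qed
  have 1: "pd k (lin_christoffel y1 y2 k i i) x = pd k (pd i (s k i)) x + (- 1 / 2) * pd k (pd k (s i i)) x" for i k
  proof -
    have "lin_christoffel y1 y2 k i i = (\<lambda>z. pd i (s k i) z + (- 1 / 2) * pd k (s i i) z)"
      by (simp add: lin_christoffel_def s_def fun_eq_iff)
    moreover have "pd k (\<lambda>z. pd i (s k i) z + (- 1 / 2) * pd k (s i i) z) x
        = pd k (pd i (s k i)) x + pd k (\<lambda>z. (- 1 / 2) * pd k (s i i) z) x"
      by (intro pd_add dif[OF _ x] smooth_on_mult smooth_on_const smooth_on_pd sm open_Compl_pair)
    moreover have "pd k (\<lambda>z. (- 1 / 2) * pd k (s i i) z) x = (- 1 / 2) * pd k (pd k (s i i)) x"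
      by (intro pd_cmult dif[OF _ x] smooth_on_pd sm)
    ultimately show ?thesis by simp
  qed
  have 2: "pd i (lin_christoffel y1 y2 k i k) x = 1 / 2 * pd i (pd i (s k k)) x" for i k
  proof -
    have "lin_christoffel y1 y2 k i k = (\<lambda>z. 1 / 2 * pd i (s k k) z)"
      using sym[of i k] by (simp add: lin_christoffel_def s_def fun_eq_iff)
    moreover have "pd i (\<lambda>z. 1 / 2 * pd i (s k k) z) x = 1 / 2 * pd i (pd i (s k k)) x"
      by (intro pd_cmult dif[OF _ x] smooth_on_pd sm)
    ultimately show ?thesis by simp
  qed
  have "fps_nth (scalar_curvature (gamma_tilde y1 y2) x) 1
      = (\<Sum>i\<in>UNIV. \<Sum>k\<in>UNIV. pd k (pd i (s k i)) x + (- 1 / 2) * pd k (pd k (s i i)) x + (- 1 / 2) * pd i (pd i (s k k)) x)"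
    unfolding scalar_curvature_nth_1 1 2 by simp
  also have "\<dots> = (\<Sum>i\<in>UNIV. \<Sum>k\<in>UNIV. pd k (pd i (s k i)) x)
      + (- 1 / 2) * (\<Sum>i\<in>UNIV. \<Sum>k\<in>UNIV. pd k (pd k (s i i)) x)
      + (- 1 / 2) * (\<Sum>i\<in>UNIV. \<Sum>k\<in>UNIV. pd i (pd i (s k k)) x)"
    by (simp only: sum.distrib sum_distrib_left)
  also have "(\<Sum>i\<in>UNIV. \<Sum>k\<in>UNIV. pd k (pd k (s i i)) x) = 0"
    by (subst sum.swap) (simp add: tr)
  also have "(\<Sum>i\<in>UNIV. \<Sum>k\<in>UNIV. pd i (pd i (s k k)) x) = 0"
    by (simp add: tr)
  also have "(\<Sum>i\<in>UNIV. \<Sum>k\<in>UNIV. pd k (pd i (s k i)) x) = (\<Sum>k\<in>UNIV. \<Sum>i\<in>UNIV. pd k (pd i (s k i)) x)"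
    by (rule sum.swap)
  finally show ?thesis by (simp add: s_def)
qed

text \<open>For vanishing constants the series truncated below order 1 is the constant 1, which the
  Laplacian of the metric annihilates. What remains is one eighth of the linearised
  curvature.\<close>

lemma constraint_source_flat_nth_1:
  assumes "x \<noteq> y1" "x \<noteq> y2" "y1 \<noteq> y2"
  shows "constraint_source (gamma_tilde y1 y2) (conformal_series (brill_lindquist y1 y2 0 0) \<sigma>) 1 x
    = (div_V_source y1 y2 x - product_source y1 y2 x / 6) / 8"
proof -
  have cut: "(\<lambda>z. fps_cutoff 1 (conformal_series (brill_lindquist y1 y2 0 0) \<sigma> z)) = (\<lambda>z. 1)"
    by (rule ext, rule fps_ext) (simp add: conformal_series_def brill_lindquist_def)
  have fpd0: "fpd i (\<lambda>z. 1) = (\<lambda>x. 0)" for i by (rule ext) simp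
  have "metric_laplacian (gamma_tilde y1 y2) (\<lambda>z. 1) x = 0"
    unfolding metric_laplacian_def fpd0 by simp
  then have "constraint_source (gamma_tilde y1 y2) (conformal_series (brill_lindquist y1 y2 0 0) \<sigma>) 1 x
      = 1 / 8 * fps_nth (scalar_curvature (gamma_tilde y1 y2) x) 1"
    unfolding constraint_source_def Let_def cut by simp
  then show ?thesis
    by (simp add: scalar_curvature_nth_1_eq[OF assms, unfolded One_nat_def] div_div_s_field[OF assms])
qed

section \<open>Linearity of the hierarchy\<close>

lemma fpd_lincomb:
  assumes U: "open U" "x \<in> U" and F: "\<And>z. z \<in> U \<Longrightarrow> F z = fps_const a * G z + fps_const b * H z"
    and "\<And>m. smooth_on U (\<lambda>z. fps_nth (G z) m)" "\<And>m. smooth_on U (\<lambda>z. fps_nth (H z) m)"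
  shows "fpd i F x = fps_const a * fpd i G x + fps_const b * fpd i H x"
proof (rule fps_ext)
  fix m
  note dif = smooth_on_differentiable[OF _ U]
  have "pd i (\<lambda>z. fps_nth (F z) m) x = pd i (\<lambda>z. a * fps_nth (G z) m + b * fps_nth (H z) m) x"
    by (rule pd_cong[OF U]) (simp add: F)
  also have "\<dots> = pd i (\<lambda>z. a * fps_nth (G z) m) x + pd i (\<lambda>z. b * fps_nth (H z) m) x"
    by (intro pd_add dif smooth_on_mult smooth_on_const assms)
  finally show "fps_nth (fpd i F x) m = fps_nth (fps_const a * fpd i G x + fps_const b * fpd i H x) m"
    by (simp add: pd_cmult dif assms)
qed

lemma metric_laplacian_lincomb:
  assumes U: "open U" "x \<in> U" and F: "\<And>z. z \<in> U \<Longrightarrow> F z = fps_const a * G z + fps_const b * H z"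
    and G: "\<And>m. smooth_on U (\<lambda>z. fps_nth (G z) m)" and H: "\<And>m. smooth_on U (\<lambda>z. fps_nth (H z) m)"
  shows "metric_laplacian h F x = fps_const a * metric_laplacian h G x + fps_const b * metric_laplacian h H x"
proof -
  have 1: "fpd j F z = fps_const a * fpd j G z + fps_const b * fpd j H z" if "z \<in> U" for j z
    by (rule fpd_lincomb[OF U(1) that F G H])
  have "smooth_on U (\<lambda>z. fps_nth (fpd j G z) m)" "smooth_on U (\<lambda>z. fps_nth (fpd j H z) m)" for j m
    using smooth_on_pd[OF G] smooth_on_pd[OF H] by simp_all
  then have 2: "fpd i (fpd j F) x = fps_const a * fpd i (fpd j G) x + fps_const b * fpd i (fpd j H) x" for i j
    by (intro fpd_lincomb[OF U] 1)
  show ?thesis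
    unfolding metric_laplacian_def 1[OF U(2)] 2
    by (simp add: sum.distrib sum_distrib_left sum_subtractf algebra_simps)
qed

text \<open>The metric is fixed, so the constraint is linear in the conformal factor; the truncation
  confines the hypothesis to orders below \<open>n\<close>, which suits an induction on the
  order.\<close>

lemma constraint_source_lincomb:
  assumes U: "open U" "x \<in> U"
    and \<Psi>: "\<And>z m. z \<in> U \<Longrightarrow> m < n \<Longrightarrow> fps_nth (\<Psi> z) m = a * fps_nth (\<Phi> z) m + b * fps_nth (\<Phi>' z) m"
    and sm: "\<And>m. smooth_on U (\<lambda>z. fps_nth (\<Phi> z) m)" "\<And>m. smooth_on U (\<lambda>z. fps_nth (\<Phi>' z) m)"
  shows "constraint_source h \<Psi> n x = a * constraint_source h \<Phi> n x + b * constraint_source h \<Phi>' n x"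
proof -
  have cut: "fps_cutoff n (\<Psi> z) = fps_const a * fps_cutoff n (\<Phi> z) + fps_const b * fps_cutoff n (\<Phi>' z)"
    if "z \<in> U" for z
    by (rule fps_ext) (simp add: \<Psi>[OF that])
  have "smooth_on U (\<lambda>z. fps_nth (fps_cutoff n (\<Phi> z)) m)" "smooth_on U (\<lambda>z. fps_nth (fps_cutoff n (\<Phi>' z)) m)" for m
    using sm smooth_on_const by (cases "m < n"; simp)+
  from metric_laplacian_lincomb[OF U cut this]
  show ?thesis
    unfolding constraint_source_def Let_def by (simp add: cut[OF U(2)] algebra_simps flip: fps_mult_left_const_nth)
qed

subsection \<open>The perturbative solution\<close>

text \<open>Sources are computed only off the singular points, where their values are unspecified by
  the formulas; every excised region leaves those points out.\<close>

lemma has_finite_part_cong: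
  assumes f: "has_finite_part y1 y2 f I" and eq: "\<And>x. x \<notin> {y1, y2} \<Longrightarrow> f x = g x"
  shows "has_finite_part y1 y2 g I"
proof -
  define E where "E = (\<lambda>s::real. {x. s < dist x y1 \<and> s < dist x y2})"
  have ind: "indicat_real (E s) x *\<^sub>R f x = indicat_real (E s) x *\<^sub>R g x" if "s > 0" for s x
    using eq[of x] that by (cases "x \<in> {y1, y2}") (auto simp: E_def indicator_def)
  from f obtain K a where int: "\<forall>s>0. set_integrable lborel (E s) f" and a: "a 0 0 = I"
    and lim: "((\<lambda>s. (LINT x:E s|lborel. f x) - (\<Sum>p\<le>K. \<Sum>q\<le>K. a p q * (1 / s ^ p) * ln s ^ q)) \<longlongrightarrow> 0) (at_right 0)"
    unfolding has_finite_part_def Let_def E_def by blast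
  have "\<forall>\<^sub>F s in at_right 0. (LINT x:E s|lborel. f x) - (\<Sum>p\<le>K. \<Sum>q\<le>K. a p q * (1 / s ^ p) * ln s ^ q)
      = (LINT x:E s|lborel. g x) - (\<Sum>p\<le>K. \<Sum>q\<le>K. a p q * (1 / s ^ p) * ln s ^ q)"
    using eventually_at_right_less[of 0]
    by eventually_elim (simp only: set_lebesgue_integral_def ind)
  with lim have "((\<lambda>s. (LINT x:E s|lborel. g x) - (\<Sum>p\<le>K. \<Sum>q\<le>K. a p q * (1 / s ^ p) * ln s ^ q)) \<longlongrightarrow> 0) (at_right 0)"
    by (rule Lim_transform_eventually)
  moreover have "\<forall>s>0. set_integrable lborel (E s) g"
  proof (intro allI impI)
    fix s :: real assume "s > 0"
    with int have "set_integrable lborel (E s) f" by blast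
    then show "set_integrable lborel (E s) g" unfolding set_integrable_def ind[OF \<open>s > 0\<close>] .
  qed
  ultimately show ?thesis
    unfolding has_finite_part_def Let_def E_def[symmetric] using a by blast
qed

section \<open>The weak Poisson equation and the first-order solution\<close>

lemma weak_poisson_locally_integrable: "weak_poisson y1 y2 u F \<Longrightarrow> locally_integrable u"
  by (simp add: weak_poisson_def locally_integrable_def)

lemma integrable_times_laplacian:
  assumes "locally_integrable u" "test_function \<phi>"
  shows "integrable lborel (\<lambda>x. u x * laplacian \<phi> x)"
proof -
  obtain R where "has_support_in_cball \<phi> R" "smooth_on UNIV \<phi>" using test_functionE[OF assms(2)] .
  then show ?thesis
    by (intro integrable_locally_integrable_mult[OF assms(1) laplacian_continuous has_support_laplacian])
qed

lemma weak_poisson_lincomb: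
  assumes u: "weak_poisson y1 y2 u F" and v: "weak_poisson y1 y2 v H"
    and K: "\<And>x. x \<notin> {y1, y2} \<Longrightarrow> K x = a * F x + b * H x"
  shows "weak_poisson y1 y2 (\<lambda>x. a * u x + b * v x) K"
  unfolding weak_poisson_def
proof (intro conjI allI impI)
  note loc = u[THEN weak_poisson_locally_integrable] v[THEN weak_poisson_locally_integrable]
  show "set_integrable lborel (cball 0 R) (\<lambda>x. a * u x + b * v x)" for R
    using locally_integrable_add[OF loc[THEN locally_integrable_cmult]]
    by (simp add: locally_integrable_def)
  fix \<phi> assume \<phi>: "test_function \<phi>"
  have fp: "has_finite_part y1 y2 (\<lambda>x. a * (F x * \<phi> x) + b * (H x * \<phi> x))
      (a * (LINT x|lborel. u x * laplacian \<phi> x) + b * (LINT x|lborel. v x * laplacian \<phi> x))"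
    using u v \<phi> by (intro finite_part_lincomb) (simp_all add: weak_poisson_def)
  have "a * (LINT x|lborel. u x * laplacian \<phi> x) + b * (LINT x|lborel. v x * laplacian \<phi> x)
      = (LINT x|lborel. (a * u x + b * v x) * laplacian \<phi> x)"
    using integrable_times_laplacian[OF loc(1) \<phi>] integrable_times_laplacian[OF loc(2) \<phi>]
    by (simp add: distrib_right mult.assoc)
  with fp have "has_finite_part y1 y2 (\<lambda>x. a * (F x * \<phi> x) + b * (H x * \<phi> x))
      (LINT x|lborel. (a * u x + b * v x) * laplacian \<phi> x)" by simp
  then show "has_finite_part y1 y2 (\<lambda>x. K x * \<phi> x) (LINT x|lborel. (a * u x + b * v x) * laplacian \<phi> x)"
    by (rule has_finite_part_cong) (simp add: K distrib_right mult.assoc)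
qed

text \<open>The difference has source zero off the two points. A finite part of such a source can
  only be 0, so the difference is weakly harmonic on the whole space.\<close>

lemma weak_poisson_unique:
  assumes u: "weak_poisson y1 y2 u F" "continuous_on (- {y1, y2}) u" "(u \<longlongrightarrow> 0) at_infinity"
    and v: "weak_poisson y1 y2 v H" "continuous_on (- {y1, y2}) v" "(v \<longlongrightarrow> 0) at_infinity"
    and eq: "\<And>x. x \<notin> {y1, y2} \<Longrightarrow> F x = H x" and x: "x \<notin> {y1, y2}"
  shows "u x = v x"
proof -
  let ?w = "\<lambda>x. 1 * u x + (-1) * v x"
  have w: "weak_poisson y1 y2 ?w (\<lambda>_. 0)"
    by (rule weak_poisson_lincomb[OF u(1) v(1)]) (simp add: eq)
  have "?w x = 0"
  proof (rule weakly_harmonic_vanishing_at_infinity)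
    show "locally_integrable ?w" by (rule weak_poisson_locally_integrable[OF w])
    show "continuous_on (- {y1, y2}) ?w" by (intro continuous_intros u v)
    show "(?w \<longlongrightarrow> 0) at_infinity" using tendsto_diff[OF u(3) v(3)] by simp
    show "(LINT x|lborel. ?w x * laplacian \<phi> x) = 0" if "test_function \<phi>" for \<phi>
      by (rule finite_part_0_unique[of y1 y2 "\<lambda>x. 0 * \<phi> x"])
        (use w[unfolded weak_poisson_def, THEN conjunct2, rule_format, OF that] in simp_all)
  qed (use x in auto)
  then show ?thesis by simp
qed

text \<open>The constant \<open>1/r\<^sub>1\<^sub>2\<^sup>2\<close> is subtracted to make the function vanish at infinity.\<close>

definition sigma1 :: "point \<Rightarrow> point \<Rightarrow> point \<Rightarrow> real" where
  "sigma1 y1 y2 x = 1 / 96 * (product_potential y1 y2 x - 1 / (norm (y1 - y2))\<^sup>2)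
     - 1 / (32 * norm (y1 - y2) ^ 3) *
         ((x - y1) \<bullet> (y1 - y2) / norm (x - y1) - (x - y2) \<bullet> (y1 - y2) / norm (x - y2))"

text \<open>The coefficients match because 1/96 = (1/4 - 1/6)/8, and because the source term 1/(2
  r12^3)/8 = 1/(16 r12^3) is divided by the -2 in Laplace (n.d) = -2 n.d/r^2.\<close>

lemma weak_poisson_sigma1:
  assumes "y1 \<noteq> y2"
  shows "weak_poisson y1 y2 (sigma1 y1 y2) (\<lambda>x. (div_V_source y1 y2 x - product_source y1 y2 x / 6) / 8)"
proof -
  define d where "d = y1 - y2"
  define k where "k = 1 / (32 * norm d ^ 3)"
  define h where "h = - 1 / (96 * (norm d)\<^sup>2)"
  define p where "p y x = (x - y) \<bullet> d / norm (x - y)" for x y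
  define p' where "p' y x = - 2 * ((x - y) \<bullet> d) / norm (x - y) ^ 3" for x y
  define F where "F = (\<lambda>x. (1 / 96 * product_source y1 y2 x + (- k) * p' y1 x) + k * p' y2 x)"
  have sig: "sigma1 y1 y2 = (\<lambda>x. ((1 / 96 * product_potential y1 y2 x + (- k) * p y1 x) + k * p y2 x) + h * 1)"
    by (simp add: sigma1_def fun_eq_iff k_def h_def p_def d_def algebra_simps)
  have F: "(div_V_source y1 y2 x - product_source y1 y2 x / 6) / 8 = F x" for x
    by (simp add: F_def div_V_source_def k_def p'_def d_def add_divide_distrib diff_divide_distrib mult.commute)
  have loc: "locally_integrable (p y)" "locally_integrable (p' y)" for y
    unfolding p_def[abs_def] p'_def[abs_def] by (rule dipole_locally_integrable)+
  note locp = weak_laplacian_product(1,2)[OF assms]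
  have locF: "locally_integrable F"
    unfolding F_def by (intro locally_integrable_add locally_integrable_cmult loc locp)
  show ?thesis
    unfolding weak_poisson_def F
  proof (intro conjI allI impI)
    show "set_integrable lborel (cball 0 R) (sigma1 y1 y2)" for R
    proof -
      have "locally_integrable (sigma1 y1 y2)"
        unfolding sig by (intro locally_integrable_add locally_integrable_cmult loc locp locally_integrable_const)
      then show ?thesis by (simp add: locally_integrable_def)
    qed
    fix \<phi> assume \<phi>: "test_function \<phi>"
    obtain R where R: "has_support_in_cball \<phi> R" and s: "smooth_on UNIV \<phi>" using test_functionE[OF \<phi>] .
    note i1 = integrable_times_laplacian[OF _ \<phi>]
    note i2 = integrable_locally_integrable_mult[OF _ smooth_on_continuous[OF s] R]
    have weakp: "(LINT x|lborel. p y x * laplacian \<phi> x) = (LINT x|lborel. p' y x * \<phi> x)" for y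
      unfolding p_def p'_def by (rule weak_laplacian_dipole[OF \<phi>])
    \<comment> \<open>The constant added for decay at infinity is harmonic.\<close>
    have weak1: "(LINT x|lborel. 1 * laplacian \<phi> x) = 0"
      using green_identity[OF smooth_on_const \<phi>, of 1] by (simp add: laplacian_def[of "\<lambda>_. 1"])
    have "(LINT x|lborel. sigma1 y1 y2 x * laplacian \<phi> x)
        = (LINT x|lborel. 1 / 96 * (product_potential y1 y2 x * laplacian \<phi> x) + (- k) * (p y1 x * laplacian \<phi> x)
            + k * (p y2 x * laplacian \<phi> x) + h * (1 * laplacian \<phi> x))"
      unfolding sig by (simp add: algebra_simps)
    also have "\<dots> = 1 / 96 * (LINT x|lborel. product_potential y1 y2 x * laplacian \<phi> x)
        + (- k) * (LINT x|lborel. p y1 x * laplacian \<phi> x) + k * (LINT x|lborel. p y2 x * laplacian \<phi> x)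
        + h * (LINT x|lborel. 1 * laplacian \<phi> x)"
      using i1[OF loc(1)[of y1]] i1[OF loc(1)[of y2]] i1[OF locp(1)] i1[OF locally_integrable_const[of 1]]
      by (simp del: mult_minus_left)
    also have "\<dots> = 1 / 96 * (LINT x|lborel. product_source y1 y2 x * \<phi> x)
        + (- k) * (LINT x|lborel. p' y1 x * \<phi> x) + k * (LINT x|lborel. p' y2 x * \<phi> x)"
      unfolding weakp weak1 weak_laplacian_product(3)[OF assms \<phi>] by simp
    also have "\<dots> = (LINT x|lborel. 1 / 96 * (product_source y1 y2 x * \<phi> x) + (- k) * (p' y1 x * \<phi> x)
            + k * (p' y2 x * \<phi> x))"
      using i2[OF loc(2)[of y1]] i2[OF loc(2)[of y2]] i2[OF locp(2)]
      by (simp del: mult_minus_left)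
    also have "\<dots> = (LINT x|lborel. F x * \<phi> x)"
      unfolding F_def by (simp add: algebra_simps)
    finally have eq: "(LINT x|lborel. sigma1 y1 y2 x * laplacian \<phi> x) = (LINT x|lborel. F x * \<phi> x)" .
    show "has_finite_part y1 y2 (\<lambda>x. F x * \<phi> x) (LINT x|lborel. sigma1 y1 y2 x * laplacian \<phi> x)"
      unfolding eq by (rule integrable_has_finite_part[OF i2[OF locF]])
  qed
qed

section \<open>Decay of the first-order solution\<close>

lemma tendsto_inverse_norm_at_infinity: "((\<lambda>x. c / norm (x - y)) \<longlongrightarrow> 0) at_infinity" for y :: point
proof (rule tendsto_0_le[where K="\<bar>c\<bar>"])
  show "((\<lambda>x. 1 / norm (x - y)) \<longlongrightarrow> 0) at_infinity"
  proof (rule tendstoI)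
    fix e :: real assume e: "0 < e"
    have "dist (1 / norm (x - y)) 0 < e" if "norm y + 1 / e + 1 \<le> norm x" for x
    proof -
      have gt: "1 / e < norm (x - y)" using that norm_triangle_ineq2[of x y] by linarith
      moreover have "0 < norm (x - y)" using e by (intro less_trans[OF _ gt]) simp
      ultimately have "1 / norm (x - y) < e" using e by (simp add: divide_less_eq mult.commute)
      then show ?thesis by simp
    qed
    then show "\<forall>\<^sub>F x in at_infinity. dist (1 / norm (x - y)) 0 < e"
      unfolding eventually_at_infinity by blast
  qed
qed (simp add: always_eventually)

text \<open>Each of the two terms has direction-dependent limits at infinity; only their difference
  decays, like |d|^2/r1.\<close>

lemma dipole_difference_tendsto:
  fixes y1 y2 :: point
  shows "((\<lambda>x. (x - y1) \<bullet> (y1 - y2) / norm (x - y1) - (x - y2) \<bullet> (y1 - y2) / norm (x - y2)) \<longlongrightarrow> 0) at_infinity"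
proof (rule tendsto_0_le[where K=1])
  define d where "d = y1 - y2"
  show "((\<lambda>x. (2 * (norm d)\<^sup>2) / norm (x - y1)) \<longlongrightarrow> 0) at_infinity"
    by (rule tendsto_inverse_norm_at_infinity)
  have "\<bar>(x - y1) \<bullet> d / norm (x - y1) - (x - y2) \<bullet> d / norm (x - y2)\<bar> \<le> 2 * (norm d)\<^sup>2 / norm (x - y1)"
    if "x \<noteq> y1" "x \<noteq> y2" for x
  proof -
    define X where "X = x - y1"
    have Y: "x - y2 = X + d" by (simp add: X_def d_def)
    have nz: "0 < norm X" using that by (simp add: X_def)
    have nz': "0 < norm (X + d)" unfolding Y[symmetric] using that by simp
    have dd: "d \<bullet> d = (norm d)\<^sup>2" by (simp add: power2_norm_eq_inner)
    \<comment> \<open>Inserting X.d = (X + d).d - d.d leaves two terms, each at most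
      |d|^2/|X|.\<close>
    have "X \<bullet> d / norm X - (X + d) \<bullet> d / norm (X + d)
        = (X + d) \<bullet> d * (norm (X + d) - norm X) / (norm X * norm (X + d)) - (norm d)\<^sup>2 / norm X"
      using nz nz' by (simp add: inner_add_left dd field_simps)
    also have "\<bar>\<dots>\<bar> \<le> \<bar>(X + d) \<bullet> d * (norm (X + d) - norm X) / (norm X * norm (X + d))\<bar> + \<bar>(norm d)\<^sup>2 / norm X\<bar>"
      by (rule abs_triangle_ineq4)
    also have "\<bar>(X + d) \<bullet> d * (norm (X + d) - norm X) / (norm X * norm (X + d))\<bar>
        \<le> (norm (X + d) * norm d) * norm d / (norm X * norm (X + d))"
    proof -
      have "\<bar>norm (X + d) - norm X\<bar> \<le> norm d" using norm_triangle_ineq3[of "X + d" X] by simp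
      then have *: "\<bar>(X + d) \<bullet> d\<bar> * \<bar>norm (X + d) - norm X\<bar> \<le> (norm (X + d) * norm d) * norm d"
        by (intro mult_mono Cauchy_Schwarz_ineq2) auto
      have "\<bar>(X + d) \<bullet> d * (norm (X + d) - norm X) / (norm X * norm (X + d))\<bar>
          = \<bar>(X + d) \<bullet> d\<bar> * \<bar>norm (X + d) - norm X\<bar> / (norm X * norm (X + d))" by (simp add: abs_mult)
      also have "\<dots> \<le> (norm (X + d) * norm d) * norm d / (norm X * norm (X + d))"
        by (rule divide_right_mono[OF *]) simp
      finally show ?thesis .
    qed
    also have "\<dots> = (norm d)\<^sup>2 / norm X" using nz nz' by (simp add: power2_eq_square)
    finally show ?thesis unfolding Y X_def[symmetric] by simp
  qed
  note bound = this
  have "\<forall>\<^sub>F x in at_infinity. norm ((x - y1) \<bullet> d / norm (x - y1) - (x - y2) \<bullet> d / norm (x - y2))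
      \<le> norm (2 * (norm d)\<^sup>2 / norm (x - y1)) * 1"
    unfolding eventually_at_infinity
  proof (intro exI allI impI)
    fix x :: point assume x: "norm y1 + norm y2 + 1 \<le> norm x"
    have "norm x \<noteq> norm y1" "norm x \<noteq> norm y2"
      using x norm_ge_zero[of y1] norm_ge_zero[of y2] by linarith+
    then have "x \<noteq> y1" "x \<noteq> y2" by auto
    from bound[OF this] show "norm ((x - y1) \<bullet> d / norm (x - y1) - (x - y2) \<bullet> d / norm (x - y2))
      \<le> norm (2 * (norm d)\<^sup>2 / norm (x - y1)) * 1" by simp
  qed
  then show "\<forall>\<^sub>F x in at_infinity. norm ((x - y1) \<bullet> (y1 - y2) / norm (x - y1) - (x - y2) \<bullet> (y1 - y2) / norm (x - y2))
      \<le> norm (2 * (norm d)\<^sup>2 / norm (x - y1)) * 1" by (simp add: d_def)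
qed

lemma sigma1_tendsto: "(sigma1 y1 y2 \<longlongrightarrow> 0) at_infinity"
proof -
  define D where "D = 1 / norm (y1 - y2)"
  have "((\<lambda>x. 1 / 96 * ((1 / norm (x - y1) - D) * (1 / norm (x - y2) - D) - D\<^sup>2)
      - 1 / (32 * norm (y1 - y2) ^ 3) *
         ((x - y1) \<bullet> (y1 - y2) / norm (x - y1) - (x - y2) \<bullet> (y1 - y2) / norm (x - y2)))
    \<longlongrightarrow> 1 / 96 * ((0 - D) * (0 - D) - D\<^sup>2) - 1 / (32 * norm (y1 - y2) ^ 3) * 0) at_infinity"
    by (intro tendsto_intros tendsto_inverse_norm_at_infinity dipole_difference_tendsto)
  then show ?thesis
    by (simp add: sigma1_def[abs_def] product_potential_def D_def power2_eq_square)
qed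

lemma continuous_on_sigma1: "continuous_on (- {y1, y2}) (sigma1 y1 y2)"
  unfolding sigma1_def[abs_def] product_potential_def by (intro continuous_intros) auto

section \<open>Dependence on the Brill-Lindquist constants\<close>

lemma smooth_on_conformal_series:
  assumes "perturbative_solution y1 y2 a1 a2 \<sigma>"
  shows "smooth_on (- {y1, y2}) (\<lambda>z. fps_nth (conformal_series (brill_lindquist y1 y2 a1 a2) \<sigma> z) m)"
proof (cases "m = 0")
  case True
  have "smooth_on (- {y1, y2}) (\<lambda>z. 1 + a1 / norm (z - y1) + a2 / norm (z - y2))"
    by (intro smooth_on_add smooth_on_const smooth_on_inverse_norm open_Compl_pair) auto
  with True show ?thesis by (simp add: conformal_series_def brill_lindquist_def)
next
  case False
  with assms show ?thesis by (simp add: conformal_series_def perturbative_solution_def)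
qed

lemma perturbative_solution_unique:
  assumes \<sigma>: "perturbative_solution y1 y2 a1 a2 \<sigma>" and \<tau>: "perturbative_solution y1 y2 a1 a2 \<tau>"
  shows "1 \<le> n \<Longrightarrow> x \<notin> {y1, y2} \<Longrightarrow> \<sigma> n x = \<tau> n x"
proof (induction n arbitrary: x rule: less_induct)
  case (less n)
  let ?c = "\<lambda>\<sigma>. constraint_source (gamma_tilde y1 y2) (conformal_series (brill_lindquist y1 y2 a1 a2) \<sigma>) n"
  \<comment> \<open>The linearity lemma with coefficients 1 and 0 serves as a congruence rule: the
    source at order n sees only lower orders, where the two solutions agree.\<close>
  have "?c \<sigma> z = 1 * ?c \<tau> z + 0 * ?c \<tau> z" if "z \<in> - {y1, y2}" for z
    by (rule constraint_source_lincomb[OF open_Compl_pair that])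
      (use less.IH smooth_on_conformal_series[OF \<tau>] in \<open>auto simp: conformal_series_def\<close>)
  then have "?c \<sigma> z = ?c \<tau> z" if "z \<notin> {y1, y2}" for z using that by simp
  moreover have "weak_poisson y1 y2 (\<sigma> n) (?c \<sigma>)" "continuous_on (- {y1, y2}) (\<sigma> n)" "(\<sigma> n \<longlongrightarrow> 0) at_infinity"
    "weak_poisson y1 y2 (\<tau> n) (?c \<tau>)" "continuous_on (- {y1, y2}) (\<tau> n)" "(\<tau> n \<longlongrightarrow> 0) at_infinity"
    using \<sigma> \<tau> less.prems(1) by (simp_all add: perturbative_solution_def smooth_on_continuous)
  ultimately show ?case using weak_poisson_unique less.prems(2) by blast
qed

text \<open>The hierarchy is linear in the whole conformal factor, but its zeroth coefficient must
  keep the leading 1 of Brill and Lindquist; this is the condition \<open>s + t = 1\<close>.\<close>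

lemma perturbative_solution_affine:
  assumes \<sigma>: "perturbative_solution y1 y2 a1 a2 \<sigma>" and \<tau>: "perturbative_solution y1 y2 b1 b2 \<tau>" and "s + t = 1"
  shows "perturbative_solution y1 y2 (s * a1 + t * b1) (s * a2 + t * b2) (\<lambda>n x. s * \<sigma> n x + t * \<tau> n x)"
  unfolding perturbative_solution_def
proof (intro allI impI conjI)
  fix n :: nat assume n: "1 \<le> n"
  note S = \<sigma>[unfolded perturbative_solution_def, rule_format, OF n] \<tau>[unfolded perturbative_solution_def, rule_format, OF n]
  show "smooth_on (- {y1, y2}) (\<lambda>x. s * \<sigma> n x + t * \<tau> n x)"
    using S by (intro smooth_on_add smooth_on_mult smooth_on_const open_Compl_pair) auto
  have "((\<lambda>x. s * \<sigma> n x + t * \<tau> n x) \<longlongrightarrow> s * 0 + t * 0) at_infinity"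
    using S by (intro tendsto_intros) auto
  then show "((\<lambda>x. s * \<sigma> n x + t * \<tau> n x) \<longlongrightarrow> 0) at_infinity" by simp
  have bl: "brill_lindquist y1 y2 (s * a1 + t * b1) (s * a2 + t * b2) z
      = s * brill_lindquist y1 y2 a1 a2 z + t * brill_lindquist y1 y2 b1 b2 z" for z
  proof -
    have "s * brill_lindquist y1 y2 a1 a2 z + t * brill_lindquist y1 y2 b1 b2 z
        = (s + t) + (s * a1 + t * b1) / norm (z - y1) + (s * a2 + t * b2) / norm (z - y2)"
      by (simp add: brill_lindquist_def add_divide_distrib distrib_left)
    then show ?thesis using assms(3) by (simp add: brill_lindquist_def)
  qed
  show "weak_poisson y1 y2 (\<lambda>x. s * \<sigma> n x + t * \<tau> n x)
      (constraint_source (gamma_tilde y1 y2) (conformal_series (brill_lindquist y1 y2 (s * a1 + t * b1) (s * a2 + t * b2))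
        (\<lambda>n x. s * \<sigma> n x + t * \<tau> n x)) n)"
  proof (rule weak_poisson_lincomb)
    show "weak_poisson y1 y2 (\<sigma> n) (constraint_source (gamma_tilde y1 y2) (conformal_series (brill_lindquist y1 y2 a1 a2) \<sigma>) n)"
      "weak_poisson y1 y2 (\<tau> n) (constraint_source (gamma_tilde y1 y2) (conformal_series (brill_lindquist y1 y2 b1 b2) \<tau>) n)"
      using S by auto
    fix x assume "x \<notin> {y1, y2}"
    then have x: "x \<in> - {y1, y2}" by simp
    show "constraint_source (gamma_tilde y1 y2) (conformal_series (brill_lindquist y1 y2 (s * a1 + t * b1) (s * a2 + t * b2))
        (\<lambda>n x. s * \<sigma> n x + t * \<tau> n x)) n x
      = s * constraint_source (gamma_tilde y1 y2) (conformal_series (brill_lindquist y1 y2 a1 a2) \<sigma>) n x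
        + t * constraint_source (gamma_tilde y1 y2) (conformal_series (brill_lindquist y1 y2 b1 b2) \<tau>) n x"
      by (rule constraint_source_lincomb[OF open_Compl_pair x])
        (use smooth_on_conformal_series[OF \<sigma>] smooth_on_conformal_series[OF \<tau>] in \<open>auto simp: conformal_series_def bl\<close>)
  qed
qed

text \<open>Uniqueness turns affine combinations of solutions into identities for the given family.
  The point (a1, a2) is the midpoint of (2 a1, 0) and (0, 2 a2), which lie on lines through (0,0)
  and (1,0), and through (0,0) and (0,1).\<close>

lemma perturbative_solution_formula:
  assumes sol: "\<And>a1 a2. perturbative_solution y1 y2 a1 a2 (\<sigma> a1 a2)" and n: "1 \<le> n" and x: "x \<notin> {y1, y2}"
  shows "\<sigma> a1 a2 n x = \<sigma> 0 0 n x + a1 * (\<sigma> 1 0 n x - \<sigma> 0 0 n x) + a2 * (\<sigma> 0 1 n x - \<sigma> 0 0 n x)"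
proof -
  have line: "\<sigma> (s * a1 + t * b1) (s * a2 + t * b2) n x = s * \<sigma> a1 a2 n x + t * \<sigma> b1 b2 n x"
    if "s + t = 1" for s t a1 a2 b1 b2
    by (rule perturbative_solution_unique[OF sol perturbative_solution_affine[OF sol sol that] n x])
  have "\<sigma> (2 * a1) 0 n x = (1 - 2 * a1) * \<sigma> 0 0 n x + 2 * a1 * \<sigma> 1 0 n x"
    using line[of "1 - 2 * a1" "2 * a1" 0 1 0 0] by simp
  moreover have "\<sigma> 0 (2 * a2) n x = (1 - 2 * a2) * \<sigma> 0 0 n x + 2 * a2 * \<sigma> 0 1 n x"
    using line[of "1 - 2 * a2" "2 * a2" 0 0 0 1] by simp
  moreover have "\<sigma> a1 a2 n x = 1 / 2 * \<sigma> (2 * a1) 0 n x + 1 / 2 * \<sigma> 0 (2 * a2) n x"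
    using line[of "1 / 2" "1 / 2" "2 * a1" 0 0 "2 * a2"] by simp
  ultimately show ?thesis by (simp add: algebra_simps)
qed

lemma perturbative_solution_first_order:
  assumes sol: "perturbative_solution y1 y2 0 0 \<sigma>" and "y1 \<noteq> y2" and x: "x \<notin> {y1, y2}"
  shows "\<sigma> 1 x = sigma1 y1 y2 x"
proof (rule weak_poisson_unique[OF _ _ _ weak_poisson_sigma1[OF assms(2)] continuous_on_sigma1 sigma1_tendsto _ x])
  have S: "smooth_on (- {y1, y2}) (\<sigma> 1) \<and> (\<sigma> 1 \<longlongrightarrow> 0) at_infinity \<and> weak_poisson y1 y2 (\<sigma> 1)
      (constraint_source (gamma_tilde y1 y2) (conformal_series (brill_lindquist y1 y2 0 0) \<sigma>) 1)"
    using sol[unfolded perturbative_solution_def, rule_format, of 1] by simp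
  then show "weak_poisson y1 y2 (\<sigma> 1) (constraint_source (gamma_tilde y1 y2) (conformal_series (brill_lindquist y1 y2 0 0) \<sigma>) 1)"
    "continuous_on (- {y1, y2}) (\<sigma> 1)" "(\<sigma> 1 \<longlongrightarrow> 0) at_infinity"
    by (simp_all add: smooth_on_continuous)
  show "constraint_source (gamma_tilde y1 y2) (conformal_series (brill_lindquist y1 y2 0 0) \<sigma>) 1 x
      = (div_V_source y1 y2 x - product_source y1 y2 x / 6) / 8" if "x \<notin> {y1, y2}" for x
    using that assms(2) by (intro constraint_source_flat_nth_1) auto
qed

subsection \<open>The post-Newtonian expansion\<close>

definition pn_order :: "nat \<Rightarrow> (real \<Rightarrow> real) set" where
  "pn_order k = O[at_top](\<lambda>c. (1 / c\<^sup>2) ^ k)"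

lemma pn_order_mult:
  assumes "f \<in> pn_order k" "g \<in> pn_order m" "k + m = n"
  shows "(\<lambda>c. f c * g c) \<in> pn_order n"
  using landau_o.big.mult[OF assms(1,2)[unfolded pn_order_def]] assms(3)
  unfolding pn_order_def by (simp flip: power_add)

lemma pn_order_add: "f \<in> pn_order k \<Longrightarrow> g \<in> pn_order k \<Longrightarrow> (\<lambda>c. f c + g c) \<in> pn_order k"
  unfolding pn_order_def by (rule sum_in_bigo)

lemma pn_order_mono:
  assumes "f \<in> pn_order m" "k \<le> m" shows "f \<in> pn_order k"
proof -
  have "(\<lambda>c::real. (1 / c\<^sup>2) ^ m) \<in> O[at_top](\<lambda>c. (1 / c\<^sup>2) ^ k)"
  proof (rule bigoI[where c=1])
    show "\<forall>\<^sub>F c::real in at_top. norm ((1 / c\<^sup>2) ^ m) \<le> 1 * norm ((1 / c\<^sup>2) ^ k)"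
      using eventually_ge_at_top[of 1]
    proof eventually_elim
      fix c :: real assume "1 \<le> c"
      then have "1 \<le> c\<^sup>2" by (simp add: one_le_power)
      then have "1 / c\<^sup>2 \<le> 1" by (simp add: divide_le_eq)
      then have "(1 / c\<^sup>2) ^ m \<le> (1 / c\<^sup>2) ^ k" using assms(2) by (intro power_decreasing) auto
      then show "norm ((1 / c\<^sup>2) ^ m) \<le> 1 * norm ((1 / c\<^sup>2) ^ k)" by simp
    qed
  qed
  with assms(1) show ?thesis unfolding pn_order_def by (rule landau_o.big_trans)
qed

lemma pn_order_const: "(\<lambda>_. a) \<in> pn_order 0"
  by (simp add: pn_order_def)

lemma pn_order_eps: "(\<lambda>c. (1 / c\<^sup>2) ^ k) \<in> pn_order k"
  by (simp add: pn_order_def)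

lemma pn_order_cmult: "f \<in> pn_order k \<Longrightarrow> (\<lambda>c. a * f c) \<in> pn_order k"
  using pn_order_mult[OF pn_order_const, of f k k a] by simp

lemma pn_order_sum: "(\<And>i. i \<in> A \<Longrightarrow> f i \<in> pn_order k) \<Longrightarrow> (\<lambda>c. \<Sum>i\<in>A. f i c) \<in> pn_order k"
  unfolding pn_order_def by (rule big_sum_in_bigo)

lemma pn_order_power: "f \<in> pn_order k \<Longrightarrow> (\<lambda>c. f c ^ n) \<in> pn_order (n * k)"
  by (induction n) (auto intro: pn_order_mult simp: pn_order_const[of 1])

lemma pn_order_fps_mult:
  assumes "\<And>n. (\<lambda>c. fps_nth (F c) n) \<in> pn_order 0" "\<And>n. (\<lambda>c. fps_nth (H c) n) \<in> pn_order 0"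
  shows "(\<lambda>c. fps_nth (F c * H c) n) \<in> pn_order 0"
  unfolding fps_mult_nth using pn_order_mult[OF assms, of 0] by (intro pn_order_sum) simp

lemma pn_order_fps_power:
  assumes "\<And>n. (\<lambda>c. fps_nth (F c) n) \<in> pn_order 0"
  shows "(\<lambda>c. fps_nth (F c ^ k) n) \<in> pn_order 0"
  by (induction k arbitrary: n) (auto intro!: pn_order_fps_mult assms pn_order_const simp del: fps_nth_fps_const)

section \<open>Expansion of the constants and of the fourth power\<close>

lemma alpha_expansion:
  fixes A b :: real
  assumes \<rho>: "\<rho> \<in> O[at_top](\<lambda>c. 1 / c^4)"
    and \<alpha>: "\<And>c. \<alpha> c = A / c\<^sup>2 * (1 - b / c\<^sup>2 + \<rho> c)"
  shows "(\<lambda>c. \<alpha> c - (A * (1 / c\<^sup>2) - A * b * (1 / c\<^sup>2)\<^sup>2)) \<in> pn_order 3"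
proof -
  have "\<rho> \<in> pn_order 2" using \<rho> by (simp add: pn_order_def power_one_over flip: power_mult)
  then have "(\<lambda>c. A * ((1 / c\<^sup>2) ^ 1 * \<rho> c)) \<in> pn_order 3"
    by (intro pn_order_cmult pn_order_mult[OF pn_order_eps]) simp_all
  moreover have "A * ((1 / c\<^sup>2) ^ 1 * \<rho> c) = \<alpha> c - (A * (1 / c\<^sup>2) - A * b * (1 / c\<^sup>2)\<^sup>2)" for c
    unfolding \<alpha> by (simp add: divide_inverse power2_eq_square algebra_simps)
  ultimately show ?thesis by simp
qed

text \<open>In the binomial expansion the cubic and quartic terms are already of order 3. For the
  quadratic one, w^2 - (p \<epsilon>)^2 = (w - p \<epsilon>)(w + p \<epsilon>) has orders 2 and
  1.\<close>

lemma fourth_power_expansion: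
  assumes w: "(\<lambda>c. w c - (p * (1 / c\<^sup>2) + q * (1 / c\<^sup>2)\<^sup>2)) \<in> pn_order 3"
  shows "w \<in> pn_order 1"
    and "(\<lambda>c. (1 + w c) ^ 4 - (1 + 4 * p * (1 / c\<^sup>2) + (4 * q + 6 * p\<^sup>2) * (1 / c\<^sup>2)\<^sup>2)) \<in> pn_order 3"
proof -
  let ?\<epsilon> = "\<lambda>c::real. 1 / c\<^sup>2"
  define r where "r c = w c - (p * ?\<epsilon> c + q * (?\<epsilon> c)\<^sup>2)" for c
  have r: "r \<in> pn_order 3" using w by (simp add: r_def[abs_def])
  have e1: "(\<lambda>c. p * ?\<epsilon> c) \<in> pn_order 1" using pn_order_cmult[OF pn_order_eps[of 1]] by simp
  have e2: "(\<lambda>c. q * (?\<epsilon> c)\<^sup>2) \<in> pn_order 2" by (rule pn_order_cmult[OF pn_order_eps])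
  have rq: "(\<lambda>c. r c + q * (?\<epsilon> c)\<^sup>2) \<in> pn_order 2"
    by (rule pn_order_add[OF pn_order_mono[OF r] e2]) simp
  have "(\<lambda>c. (r c + q * (?\<epsilon> c)\<^sup>2) + p * ?\<epsilon> c) \<in> pn_order 1"
    by (rule pn_order_add[OF pn_order_mono[OF rq] e1]) simp
  moreover have "(\<lambda>c. (r c + q * (?\<epsilon> c)\<^sup>2) + p * ?\<epsilon> c) = w" by (simp add: r_def fun_eq_iff)
  ultimately show w1: "w \<in> pn_order 1" by (simp only:)
  have 1: "(\<lambda>c. 6 * ((r c + q * (?\<epsilon> c)\<^sup>2) * (w c + p * ?\<epsilon> c))) \<in> pn_order 3"
    by (intro pn_order_cmult pn_order_mult[OF rq pn_order_add[OF w1 e1]]) simp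
  have 2: "(\<lambda>c. 4 * w c ^ 3 + w c ^ 4) \<in> pn_order 3"
    by (intro pn_order_add pn_order_cmult pn_order_mono[OF pn_order_power[OF w1]]) simp_all
  have "(\<lambda>c. 4 * r c + 6 * ((r c + q * (?\<epsilon> c)\<^sup>2) * (w c + p * ?\<epsilon> c)) + (4 * w c ^ 3 + w c ^ 4)) \<in> pn_order 3"
    by (rule pn_order_add[OF pn_order_add[OF pn_order_cmult[OF r] 1] 2])
  moreover have "4 * r c + 6 * ((r c + q * (?\<epsilon> c)\<^sup>2) * (w c + p * ?\<epsilon> c)) + (4 * w c ^ 3 + w c ^ 4)
      = (1 + w c) ^ 4 - (1 + 4 * p * ?\<epsilon> c + (4 * q + 6 * p\<^sup>2) * (?\<epsilon> c)\<^sup>2)" for c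
  proof -
    have "4 * (w - (p * e + q * e\<^sup>2)) + 6 * ((w - (p * e + q * e\<^sup>2) + q * e\<^sup>2) * (w + p * e)) + (4 * w ^ 3 + w ^ 4)
      = (1 + w) ^ 4 - (1 + 4 * p * e + (4 * q + 6 * p\<^sup>2) * e\<^sup>2)" for w e :: real
      by (simp add: algebra_simps eval_nat_numeral)
    then show ?thesis unfolding r_def .
  qed
  ultimately show "(\<lambda>c. (1 + w c) ^ 4 - (1 + 4 * p * ?\<epsilon> c + (4 * q + 6 * p\<^sup>2) * (?\<epsilon> c)\<^sup>2)) \<in> pn_order 3"
    by simp
qed

text \<open>For one body the harmonic radius exceeds the isotropic radius r by G^2 m^2/(4 c^4 r), up
  to higher orders; this is that radial shift for each body, without the factor 1/c^4. Twice the
  symmetrised gradient of n/(4r) is (\<delta>_ij - 2 n_i n_j)/(2 r^2), the difference between the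
  isotropic 3/2 \<delta>_ij/r^2 and the harmonic (\<delta>_ij + n_i n_j)/r^2.\<close>

definition gauge_vector :: "real \<Rightarrow> real \<Rightarrow> real \<Rightarrow> point \<Rightarrow> point \<Rightarrow> point \<Rightarrow> point" where
  "gauge_vector G m1 m2 y1 y2 x = (G\<^sup>2 / 4) *\<^sub>R
     ((m1\<^sup>2 / (norm (x - y1))\<^sup>2) *\<^sub>R (x - y1) + (m2\<^sup>2 / (norm (x - y2))\<^sup>2) *\<^sub>R (x - y2))"

lemma gauge_vector_nth: "gauge_vector G m1 m2 y1 y2 x $ j = G\<^sup>2 / 4 *
    (m1\<^sup>2 / (norm (x - y1))\<^sup>2 * (x $ j - y1 $ j) + m2\<^sup>2 / (norm (x - y2))\<^sup>2 * (x $ j - y2 $ j))"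
  by (simp add: gauge_vector_def)

lemma smooth_on_gauge_vector: "smooth_on (- {y1, y2}) (\<lambda>x. gauge_vector G m1 m2 y1 y2 x $ j)"
  unfolding gauge_vector_nth
  by (intro smooth_on_mult smooth_on_add smooth_on_divide smooth_on_diff smooth_on_const smooth_on_nth
      smooth_on_norm_sq open_Compl_pair) auto

lemma pd_gauge_vector:
  assumes "x \<noteq> y1" "x \<noteq> y2"
  shows "pd i (\<lambda>x. gauge_vector G m1 m2 y1 y2 x $ j) x = G\<^sup>2 / 4 *
    (m1\<^sup>2 / (norm (x - y1))\<^sup>2 * (kron i j - 2 * unit_vec y1 x i * unit_vec y1 x j)
     + m2\<^sup>2 / (norm (x - y2))\<^sup>2 * (kron i j - 2 * unit_vec y2 x i * unit_vec y2 x j))"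
proof -
  have 1: "((\<lambda>t. m / norm (x + t *\<^sub>R axis i 1 - y) * unit_vec y (x + t *\<^sub>R axis i 1) j) has_real_derivative
      m / (norm (x - y))\<^sup>2 * (kron i j - 2 * unit_vec y x i * unit_vec y x j)) (at 0)" if "x \<noteq> y" for y m
    by (rule DERIV_cong[OF DERIV_mult[OF DERIV_divide[OF DERIV_const DERIV_line_norm'[OF that]] DERIV_unit_vec[OF that]]])
      (use that in \<open>simp_all add: field_simps power2_eq_square\<close>)
  have eq: "gauge_vector G m1 m2 y1 y2 x $ j = G\<^sup>2 / 4 *
    (m1\<^sup>2 / norm (x - y1) * unit_vec y1 x j + m2\<^sup>2 / norm (x - y2) * unit_vec y2 x j)" for x
    by (simp add: gauge_vector_nth unit_vec_def power2_eq_square)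
  show ?thesis
    unfolding eq by (rule pd_eqI, rule DERIV_cmult, rule DERIV_add[OF 1[OF assms(1)] 1[OF assms(2)]])
qed

section \<open>Exact comparison of the metrics at order 1/c^4\<close>

lemma sigma1_eq:
  assumes "x \<noteq> y1" "x \<noteq> y2" "y1 \<noteq> y2"
  defines "r1 \<equiv> norm (x - y1)" and "r2 \<equiv> norm (x - y2)" and "r \<equiv> norm (y1 - y2)"
  shows "sigma1 y1 y2 x = 1 / 96 * (1 / (r1 * r2) - 1 / (r * r1) - 1 / (r * r2))
    - 1 / (64 * r ^ 3) * (r2\<^sup>2 / r1 + r1\<^sup>2 / r2 - r1 - r2 - r\<^sup>2 / r1 - r\<^sup>2 / r2)"
proof -
  have r: "r1 \<noteq> 0" "r2 \<noteq> 0" "r \<noteq> 0" using assms(1-3) by (simp_all add: r1_def r2_def r_def)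
  have 1: "(x - y1) \<bullet> (y1 - y2) = (r2\<^sup>2 - r1\<^sup>2 - r\<^sup>2) / 2"
    using dot_norm[of "x - y1" "y1 - y2"] by (simp add: r1_def r2_def r_def)
  have 2: "(x - y2) \<bullet> (y1 - y2) = (r2\<^sup>2 + r\<^sup>2 - r1\<^sup>2) / 2"
    using dot_norm_neg[of "x - y2" "y1 - y2"] by (simp add: r1_def r2_def r_def norm_minus_commute)
  have 3: "(1 / r1 - 1 / r) * (1 / r2 - 1 / r) - 1 / r\<^sup>2 = 1 / (r1 * r2) - 1 / (r * r1) - 1 / (r * r2)"
    using r by (simp add: field_simps power2_eq_square)
  have 4: "(r2\<^sup>2 - r1\<^sup>2 - r\<^sup>2) / 2 / r1 - (r2\<^sup>2 + r\<^sup>2 - r1\<^sup>2) / 2 / r2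
      = 1 / 2 * (r2\<^sup>2 / r1 + r1\<^sup>2 / r2 - r1 - r2 - r\<^sup>2 / r1 - r\<^sup>2 / r2)"
    using r by (simp add: field_simps power2_eq_square)
  show ?thesis
    unfolding sigma1_def product_potential_def 1 2 r1_def[symmetric] r2_def[symmetric] r_def[symmetric] 3 4
    by simp
qed

text \<open>The numbers \<open>p\<close> and \<open>q\<close> are the first two coefficients of
  \<psi> - 1 in powers of 1/c^2. The left side is the truncation of the solution after order 1/c^4;
  all terms containing the perimeter come from s, and the gauge vector absorbs the n_a n_a terms of
  each single body.\<close>

lemma metric_2PN_matching:
  fixes G m1 m2 :: real
  assumes "x \<noteq> y1" "x \<noteq> y2" "y1 \<noteq> y2" "c \<noteq> 0"
  defines "r1 \<equiv> norm (x - y1)" and "r2 \<equiv> norm (x - y2)" and "r \<equiv> norm (y1 - y2)"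
  defines "p \<equiv> G * m1 / 2 / r1 + G * m2 / 2 / r2" and "q \<equiv> - (G\<^sup>2 * m1 * m2 / (4 * r) * (1 / r1 + 1 / r2))"
  shows "kron i j * (1 + 4 * p * (1 / c\<^sup>2) + (4 * q + 6 * p\<^sup>2) * (1 / c\<^sup>2)\<^sup>2)
      + (s_field y1 y2 x i j + 4 * sigma1 y1 y2 x * kron i j) * (- 8 * G^2 * m1 * m2 / c^4)
    = metric_2PN G m1 m2 y1 y2 c x i j
      + 1 / c^4 * (pd i (\<lambda>z. gauge_vector G m1 m2 y1 y2 z $ j) x + pd j (\<lambda>z. gauge_vector G m1 m2 y1 y2 z $ i) x)"
proof -
  define K where "K = kron i j"
  have Ks: "kron j i = K" by (simp add: K_def kron_def)
  define pi pj qi qj ei ej where "pi = unit_vec y1 x i" "pj = unit_vec y1 x j" "qi = unit_vec y2 x i"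
    "qj = unit_vec y2 x j" "ei = unit_vec y2 y1 i" "ej = unit_vec y2 y1 j"
  note udefs = this
  have r: "r1 > 0" "r2 > 0" "r > 0" using assms(1-3) by (simp_all add: r1_def r2_def r_def)
  define S where "S = r1 + r2 + r"
  have S: "S > 0" using r by (simp add: S_def)
  define mu where "mu = G\<^sup>2 * m1 * m2"
  define \<tau> where "\<tau> = 1 / 2 * ((1 / r1 - 1 / r) * (1 / r2 - 1 / r) - 1 / r\<^sup>2)"
  define sg where "sg = sigma1 y1 y2 x"
  \<comment> \<open>This is -1/8 of the perimeter-dependent part of the 2PN metric per unit of
    \<open>mu\<close>, arranged so that \<open>- 8 * mu * T\<close> reproduces that part
    literally.\<close>
  define T where "T = (8 * ei * ej * (1 / S\<^sup>2 + 1 / (r * S)) - 8 * K / (r * S)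
      - 8 / S\<^sup>2 * ((pi * qj + pj * qi) / 2 + (pi * ej + pj * ei) / 2 - (qi * ej + qj * ei) / 2)) / 8"
  have s: "s_field y1 y2 x i j = T - K * \<tau> / 3"
  proof -
    have "T_field y1 y2 x i j = - ((K - ei * ej) / r) / S + (ei - pi) * (qj + ej) / S\<^sup>2"
      "T_field y1 y2 x j i = - ((K - ej * ei) / r) / S + (ej - pj) * (qi + ei) / S\<^sup>2"
      unfolding T_field_def Ks by (simp_all add: udefs S_def r1_def r2_def r_def K_def)
    moreover have "(- ((K - ei * ej) / r) / S + (ei - pi) * (qj + ej) / S\<^sup>2
        + (- ((K - ej * ei) / r) / S + (ej - pj) * (qi + ei) / S\<^sup>2)) / 2 = T"
      unfolding T_def using r S by (simp add: field_simps power2_eq_square)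
    moreover have "(\<Sum>k\<in>UNIV. T_field y1 y2 x k k) = \<tau>"
      unfolding trace_T_field[OF assms(1-3)] product_potential_def \<tau>_def r1_def r2_def r_def ..
    ultimately show ?thesis unfolding s_field_eq[OF assms(1-3)] K_def by simp
  qed
  have pdg: "pd i (\<lambda>z. gauge_vector G m1 m2 y1 y2 z $ j) x + pd j (\<lambda>z. gauge_vector G m1 m2 y1 y2 z $ i) x
      = G\<^sup>2 / 2 * (m1\<^sup>2 / r1\<^sup>2 * (K - 2 * pi * pj) + m2\<^sup>2 / r2\<^sup>2 * (K - 2 * qi * qj))"
    unfolding pd_gauge_vector[OF assms(1,2)] Ks
    by (simp add: udefs r1_def r2_def K_def algebra_simps)
  have scalar: "4 * q + 6 * p\<^sup>2 + 8 * mu * \<tau> / 3 - 32 * mu * sg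
      = 3 / 2 * G\<^sup>2 * (m1\<^sup>2 / r1\<^sup>2 + m2\<^sup>2 / r2\<^sup>2) + mu * (4 / (r1 * r2) - (r1 + r2) / (2 * r ^ 3)
           + 1 / (2 * r^3) * (r1\<^sup>2 / r2 + r2\<^sup>2 / r1)
           - 5 / (2 * r) * (1 / r1 + 1 / r2))"
  proof -
    have "6 * p\<^sup>2 = 3 / 2 * G\<^sup>2 * (m1\<^sup>2 / r1\<^sup>2 + m2\<^sup>2 / r2\<^sup>2) + 3 * mu / (r1 * r2)"
      unfolding p_def mu_def using r by (simp add: field_simps power2_eq_square)
    moreover have "4 * q = mu * (- 1 / r * (1 / r1 + 1 / r2))" unfolding q_def mu_def using r by (simp add: field_simps)
    moreover have "mu * (- 1 / r * (1 / r1 + 1 / r2)) + 3 * mu / (r1 * r2) + 8 * mu * \<tau> / 3 - 32 * mu * sg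
      = mu * (4 / (r1 * r2) - (r1 + r2) / (2 * r ^ 3)
           + 1 / (2 * r^3) * (r1\<^sup>2 / r2 + r2\<^sup>2 / r1)
           - 5 / (2 * r) * (1 / r1 + 1 / r2))"
      unfolding sg_def sigma1_eq[OF assms(1-3), folded r1_def r2_def r_def] \<tau>_def using r
      by (simp add: field_simps power2_eq_square power3_eq_cube)
    ultimately show ?thesis by linarith
  qed
  have metric: "metric_2PN G m1 m2 y1 y2 c x i j = K * (1 + 2 * G * m1 / (c^2 * r1) + 2 * G * m2 / (c^2 * r2))
      + G^2 / c^4 * (m1^2 / r1^2 * (K + pi * pj) + m2^2 / r2^2 * (K + qi * qj))
      + G^2 * m1 * m2 / c^4 * K * (4 / (r1 * r2) - (r1 + r2) / (2 * r^3)
           + 1 / (2 * r^3) * (r1^2 / r2 + r2^2 / r1)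
           - 5 / (2 * r) * (1 / r1 + 1 / r2) + 8 / (r * S))
      - 8 * G^2 * m1 * m2 / c^4 * (ei * ej) * (1 / S^2 + 1 / (r * S))
      + 8 * G^2 * m1 * m2 / (c^4 * S^2) *
          ((pi * qj + pj * qi) / 2 + (pi * ej + pj * ei) / 2 - (qi * ej + qj * ei) / 2)"
  proof -
    have n: "((a - b) /\<^sub>R norm (a - b)) $ k = unit_vec b a k" for a b :: point and k
      by (simp add: unit_vec_def divide_inverse_commute)
    show ?thesis
      unfolding metric_2PN_def Let_def sym_prod_def n S_def r1_def r2_def r_def udefs K_def
      by (simp only: mult.commute)
  qed
  have e: "(1 / c\<^sup>2)\<^sup>2 = 1 / c^4" by (simp add: power_divide flip: power_mult)
  have lin: "4 * p * (1 / c\<^sup>2) = 2 * G * m1 / (c^2 * r1) + 2 * G * m2 / (c^2 * r2)"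
    unfolding p_def using r assms(4) by (simp add: field_simps)
  have "kron i j * (1 + 4 * p * (1 / c\<^sup>2) + (4 * q + 6 * p\<^sup>2) * (1 / c\<^sup>2)\<^sup>2)
      + (s_field y1 y2 x i j + 4 * sigma1 y1 y2 x * kron i j) * (- 8 * G^2 * m1 * m2 / c^4)
    = K * (1 + (2 * G * m1 / (c^2 * r1) + 2 * G * m2 / (c^2 * r2)))
      + (K * (4 * q + 6 * p\<^sup>2 + 8 * mu * \<tau> / 3 - 32 * mu * sg) - 8 * mu * T) * (1 / c^4)"
    unfolding s lin e K_def[symmetric] sg_def[symmetric] mu_def
    by (simp add: algebra_simps add_divide_distrib diff_divide_distrib)
  also have "\<dots> = metric_2PN G m1 m2 y1 y2 c x i j
      + 1 / c^4 * (pd i (\<lambda>z. gauge_vector G m1 m2 y1 y2 z $ j) x + pd j (\<lambda>z. gauge_vector G m1 m2 y1 y2 z $ i) x)"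
  proof -
    define s1 where "s1 = 4 / (r1 * r2) - (r1 + r2) / (2 * r ^ 3) + 1 / (2 * r^3) * (r1\<^sup>2 / r2 + r2\<^sup>2 / r1)
           - 5 / (2 * r) * (1 / r1 + 1 / r2)"
    define s2 where "s2 = 1 / (r * S)"
    define s3 where "s3 = 1 / S\<^sup>2"
    define s4 where "s4 = (pi * qj + pj * qi) / 2 + (pi * ej + pj * ei) / 2 - (qi * ej + qj * ei) / 2"
    define k where "k = 1 / c^4"
    define a1 a2 where "a1 = m1\<^sup>2 / r1\<^sup>2" "a2 = m2\<^sup>2 / r2\<^sup>2"
    note folds = s1_def[symmetric] s3_def[symmetric] s4_def[symmetric] a1_a2_def[symmetric]
    have T: "T = (8 * ei * ej * (s3 + s2) - 8 * K * s2 - 8 * s3 * s4) / 8"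
      by (simp add: T_def s2_def s3_def s4_def)
    have m: "metric_2PN G m1 m2 y1 y2 c x i j = K * (1 + 2 * G * m1 / (c^2 * r1) + 2 * G * m2 / (c^2 * r2))
      + G^2 * k * (a1 * (K + pi * pj) + a2 * (K + qi * qj)) + mu * k * K * (s1 + 8 * s2)
      - 8 * mu * k * (ei * ej) * (s3 + s2) + 8 * mu * (k * s3) * s4"
      unfolding metric folds by (simp add: k_def mu_def s2_def s3_def)
    show ?thesis
      unfolding scalar m pdg T folds k_def[symmetric] by (simp add: field_simps)
  qed
  finally show ?thesis .
qed

section \<open>Collecting the error terms\<close>

lemma pn_order_one_plus_power:
  assumes w: "w \<in> pn_order 1"
  shows "(\<lambda>c. (1 + w c) ^ k) \<in> pn_order 0" and "(\<lambda>c. (1 + w c) ^ k - 1) \<in> pn_order 1"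
proof -
  have w0: "(\<lambda>c. 1 + w c) \<in> pn_order 0"
    by (intro pn_order_add pn_order_const pn_order_mono[OF w]) simp
  show "(\<lambda>c. (1 + w c) ^ k) \<in> pn_order 0" using pn_order_power[OF w0, of k] by simp
  show "(\<lambda>c. (1 + w c) ^ k - 1) \<in> pn_order 1"
  proof (induction k)
    case 0
    show ?case using pn_order_cmult[OF w, of 0] by simp
  next
    case (Suc k)
    have "(\<lambda>c. ((1 + w c) ^ k - 1) * (1 + w c) + w c) \<in> pn_order 1"
      by (intro pn_order_add[OF pn_order_mult[OF Suc w0] w]) simp
    moreover have "((1 + w c) ^ k - 1) * (1 + w c) + w c = (1 + w c) ^ Suc k - 1" for c
      by (simp add: algebra_simps)
    ultimately show ?case by (simp only:)
  qed
qed

theorem theorem1: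
  fixes y1 y2 :: point and G m1 m2 :: real
    and \<rho>1 \<rho>2 \<alpha>1 \<alpha>2 \<beta> :: "real \<Rightarrow> real"
    and \<sigma> :: "real \<Rightarrow> real \<Rightarrow> nat \<Rightarrow> point \<Rightarrow> real"
  assumes "y1 \<noteq> y2" and "m1 > 0" and "m2 > 0" and "G > 0"
    and "\<And>a1 a2. perturbative_solution y1 y2 a1 a2 (\<sigma> a1 a2)"
    and "\<rho>1 \<in> O[at_top](\<lambda>c. 1 / c^4)" and "\<rho>2 \<in> O[at_top](\<lambda>c. 1 / c^4)"
    and "\<And>c. \<alpha>1 c = G * m1 / (2 * c^2) * (1 - G * m2 / (2 * norm (y1 - y2) * c^2) + \<rho>1 c)"
    and "\<And>c. \<alpha>2 c = G * m2 / (2 * c^2) * (1 - G * m1 / (2 * norm (y1 - y2) * c^2) + \<rho>2 c)"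
    and "\<And>c. \<beta> c = - 8 * G^2 * m1 * m2 / c^4"
  shows "\<exists>(\<xi> :: real \<Rightarrow> point \<Rightarrow> point) (\<zeta> :: point \<Rightarrow> point).
     (\<forall>i. smooth_on (- {y1, y2}) (\<lambda>x. \<zeta> x $ i)) \<and>
     (\<forall>c. \<forall>x\<in>- {y1, y2}. \<xi> c x = (1 / c^4) *\<^sub>R \<zeta> x) \<and>
     (\<forall>x\<in>- {y1, y2}. \<forall>i j. \<forall>N\<ge>1.
        (\<lambda>c. fps_partial_eval N (gamma_series y1 y2 (\<alpha>1 c) (\<alpha>2 c) (\<sigma> (\<alpha>1 c) (\<alpha>2 c)) x $ i $ j) (\<beta> c)
             - (metric_2PN G m1 m2 y1 y2 c x i j
                + pd i (\<lambda>z. \<xi> c z $ j) x + pd j (\<lambda>z. \<xi> c z $ i) x))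
        \<in> O[at_top](\<lambda>c. 1 / c^6))"
proof -
  define \<zeta> where "\<zeta> = gauge_vector G m1 m2 y1 y2"
  define \<xi> where "\<xi> c x = (1 / c^4) *\<^sub>R \<zeta> x" for c :: real and x
  have sm\<zeta>: "smooth_on (- {y1, y2}) (\<lambda>x. \<zeta> x $ i)" for i
    unfolding \<zeta>_def by (rule smooth_on_gauge_vector)
  define r where "r = norm (y1 - y2)"
  define A1 b1 A2 b2 where "A1 = G * m1 / 2" "b1 = G * m2 / (2 * r)" "A2 = G * m2 / 2" "b2 = G * m1 / (2 * r)"
  note Ab = this
  have \<alpha>1: "(\<lambda>c. \<alpha>1 c - (A1 * (1 / c\<^sup>2) - A1 * b1 * (1 / c\<^sup>2)\<^sup>2)) \<in> pn_order 3"
    by (rule alpha_expansion[OF assms(6)]) (simp add: assms(8) Ab r_def)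
  have \<alpha>2: "(\<lambda>c. \<alpha>2 c - (A2 * (1 / c\<^sup>2) - A2 * b2 * (1 / c\<^sup>2)\<^sup>2)) \<in> pn_order 3"
    by (rule alpha_expansion[OF assms(7)]) (simp add: assms(9) Ab r_def)
  have \<alpha>1': "\<alpha>1 \<in> pn_order 1"
    by (rule fourth_power_expansion(1)[where p=A1 and q="- A1 * b1"]) (use \<alpha>1 in simp)
  have \<alpha>2': "\<alpha>2 \<in> pn_order 1"
    by (rule fourth_power_expansion(1)[where p=A2 and q="- A2 * b2"]) (use \<alpha>2 in simp)
  have \<beta>: "\<beta> \<in> pn_order 2"
  proof -
    have "\<beta> = (\<lambda>c. (- 8 * G^2 * m1 * m2) * (1 / c\<^sup>2) ^ 2)"
      by (simp add: assms(10) fun_eq_iff power_one_over flip: power_mult)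
    then show ?thesis by (simp only: pn_order_cmult[OF pn_order_eps])
  qed
  have O6: "O[at_top](\<lambda>c::real. 1 / c^6) = pn_order 3"
    by (simp add: pn_order_def power_one_over flip: power_mult)
  have main: "(\<lambda>c. fps_partial_eval N (gamma_series y1 y2 (\<alpha>1 c) (\<alpha>2 c) (\<sigma> (\<alpha>1 c) (\<alpha>2 c)) x $ i $ j) (\<beta> c)
             - (metric_2PN G m1 m2 y1 y2 c x i j + pd i (\<lambda>z. \<xi> c z $ j) x + pd j (\<lambda>z. \<xi> c z $ i) x))
        \<in> pn_order 3" if x: "x \<in> - {y1, y2}" and N: "1 \<le> N" for x i j N
  proof -
    have x': "x \<noteq> y1" "x \<noteq> y2" "x \<notin> {y1, y2}" using x by auto
    define r1 r2 where "r1 = norm (x - y1)" "r2 = norm (x - y2)"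
    note rs = this
    \<comment> \<open>Thus \<psi> = 1 + p/c^2 + q/c^4 + O(1/c^6): \<open>p\<close> comes from the
      leading parts of the constants, \<open>q\<close> from their corrections, whose coefficients
      coincide because \<open>A1 * b1 = A2 * b2\<close>.\<close>
    define p where "p = G * m1 / 2 / r1 + G * m2 / 2 / r2"
    define q where "q = - (G\<^sup>2 * m1 * m2 / (4 * r) * (1 / r1 + 1 / r2))"
    define w where "w c = \<alpha>1 c / r1 + \<alpha>2 c / r2" for c
    have "(\<lambda>c. 1 / r1 * (\<alpha>1 c - (A1 * (1 / c\<^sup>2) - A1 * b1 * (1 / c\<^sup>2)\<^sup>2))
        + 1 / r2 * (\<alpha>2 c - (A2 * (1 / c\<^sup>2) - A2 * b2 * (1 / c\<^sup>2)\<^sup>2))) \<in> pn_order 3"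
      by (intro pn_order_add pn_order_cmult \<alpha>1 \<alpha>2)
    moreover have "1 / r1 * (\<alpha>1 c - (A1 * (1 / c\<^sup>2) - A1 * b1 * (1 / c\<^sup>2)\<^sup>2))
        + 1 / r2 * (\<alpha>2 c - (A2 * (1 / c\<^sup>2) - A2 * b2 * (1 / c\<^sup>2)\<^sup>2))
      = w c - (p * (1 / c\<^sup>2) + q * (1 / c\<^sup>2)\<^sup>2)" for c
    proof -
      have ab: "A1 * b1 = G\<^sup>2 * m1 * m2 / (4 * r)" "A2 * b2 = G\<^sup>2 * m1 * m2 / (4 * r)"
        by (simp_all add: Ab power2_eq_square)
      define e where "e = 1 / c\<^sup>2"
      show ?thesis
        unfolding ab w_def p_def q_def e_def[symmetric]
        by (simp add: Ab add_divide_distrib diff_divide_distrib algebra_simps)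
    qed
    ultimately have w: "(\<lambda>c. w c - (p * (1 / c\<^sup>2) + q * (1 / c\<^sup>2)\<^sup>2)) \<in> pn_order 3" by (simp only:)
    note w1 = fourth_power_expansion(1)[OF w]
    define K where "K = kron i j"
    define s where "s = s_field y1 y2 x i j"
    define sg where "sg = sigma1 y1 y2 x"
    define \<Psi> where "\<Psi> c = conformal_series (brill_lindquist y1 y2 (\<alpha>1 c) (\<alpha>2 c)) (\<sigma> (\<alpha>1 c) (\<alpha>2 c)) x" for c
    have \<Psi>0: "fps_nth (\<Psi> c) 0 = 1 + w c" for c
      by (simp add: \<Psi>_def conformal_series_def brill_lindquist_def w_def rs)
    have \<Psi>n: "fps_nth (\<Psi> c) n = \<sigma> 0 0 n x + \<alpha>1 c * (\<sigma> 1 0 n x - \<sigma> 0 0 n x) + \<alpha>2 c * (\<sigma> 0 1 n x - \<sigma> 0 0 n x)"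
      if "1 \<le> n" for c n
      unfolding \<Psi>_def using that perturbative_solution_formula[OF assms(5) that x'(3), of "\<alpha>1 c" "\<alpha>2 c"]
      by (simp add: conformal_series_def)
    have lin: "(\<lambda>c. \<alpha>1 c * k + \<alpha>2 c * l) \<in> pn_order 1" for k l
      using pn_order_add[OF pn_order_cmult[OF \<alpha>1', of k] pn_order_cmult[OF \<alpha>2', of l]] by (simp add: mult.commute)
    have ord\<Psi>: "(\<lambda>c. fps_nth (\<Psi> c) n) \<in> pn_order 0" for n
    proof (cases "1 \<le> n")
      case True
      \<comment> \<open>For fixed x the three values of \<sigma> are numbers independent of c, so
        boundedness reduces to that of the constants.\<close>
      have "(\<lambda>c. \<sigma> 0 0 n x + (\<alpha>1 c * (\<sigma> 1 0 n x - \<sigma> 0 0 n x) + \<alpha>2 c * (\<sigma> 0 1 n x - \<sigma> 0 0 n x))) \<in> pn_order 0"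
        by (intro pn_order_add[OF pn_order_const] pn_order_mono[OF lin]) simp
      then show ?thesis by (simp add: \<Psi>n[OF True] add.assoc)
    next
      case False
      then show ?thesis using pn_order_one_plus_power(1)[OF w1, of 1] by (simp add: \<Psi>0 not_le)
    qed
    define F where "F c = \<Psi> c ^ 4 * gamma_tilde y1 y2 x $ i $ j" for c
    have ordF: "(\<lambda>c. fps_nth (F c) n) \<in> pn_order 0" for n
      unfolding F_def by (intro pn_order_fps_mult pn_order_fps_power ord\<Psi> pn_order_const)
    have F0: "fps_nth (F c) 0 = K * (1 + w c) ^ 4" for c
      by (simp add: F_def gamma_tilde_nth fps_nth_power_0 \<Psi>0 K_def mult.commute)
    have F1: "fps_nth (F c) 1 = (1 + w c) ^ 4 * s + 4 * K * ((1 + w c) ^ 3 * fps_nth (\<Psi> c) 1)" for c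
    proof -
      have "\<Psi> c ^ 4 = (\<Psi> c * \<Psi> c) * (\<Psi> c * \<Psi> c)" by (simp add: eval_nat_numeral mult.assoc)
      then have "fps_nth (F c) 1 = fps_nth ((\<Psi> c * \<Psi> c) * (\<Psi> c * \<Psi> c) * gamma_tilde y1 y2 x $ i $ j) 1"
        by (simp only: F_def)
      also have "\<dots> = (1 + w c) ^ 4 * s + 4 * K * ((1 + w c) ^ 3 * fps_nth (\<Psi> c) 1)"
        by (simp add: fps_mult_nth_1 gamma_tilde_nth \<Psi>0 K_def s_def eval_nat_numeral algebra_simps)
      finally show ?thesis .
    qed
    have sg: "\<sigma> 0 0 1 x = sg"
      unfolding sg_def by (rule perturbative_solution_first_order[OF assms(5,1) x'(3)])
    \<comment> \<open>The three errors: that of the fourth power at order zero in \<beta>, that of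
      replacing \<psi> by 1 and \<sigma>_1 by its value at vanishing constants at order one, and all
      higher orders, where \<beta>^n is of order 1/c^8 at least.\<close>
    define t0 where "t0 c = K * ((1 + w c) ^ 4 - (1 + 4 * p * (1 / c\<^sup>2) + (4 * q + 6 * p\<^sup>2) * (1 / c\<^sup>2)\<^sup>2))" for c
    define t1 where "t1 c = s * ((1 + w c) ^ 4 - 1) + 4 * K * (((1 + w c) ^ 3 - 1) * fps_nth (\<Psi> c) 1
        + (\<alpha>1 c * (\<sigma> 1 0 1 x - \<sigma> 0 0 1 x) + \<alpha>2 c * (\<sigma> 0 1 1 x - \<sigma> 0 0 1 x)))" for c
    define t2 where "t2 c = (\<Sum>n=2..N. fps_nth (F c) n * \<beta> c ^ n)" for c
    have t0: "t0 \<in> pn_order 3"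
      unfolding t0_def[abs_def] by (rule pn_order_cmult[OF fourth_power_expansion(2)[OF w]])
    have "t1 \<in> pn_order 1"
      unfolding t1_def[abs_def]
      by (intro pn_order_add[OF pn_order_cmult[OF pn_order_one_plus_power(2)[OF w1]]
            pn_order_cmult[OF pn_order_add[OF pn_order_mult[OF pn_order_one_plus_power(2)[OF w1] ord\<Psi>] lin]]]) simp
    then have t1: "(\<lambda>c. t1 c * \<beta> c) \<in> pn_order 3"
      by (rule pn_order_mult[OF _ \<beta>]) simp
    have t2: "t2 \<in> pn_order 3"
      unfolding t2_def[abs_def]
    proof (rule pn_order_sum)
      fix n assume n: "n \<in> {2..N}"
      have "(\<lambda>c. fps_nth (F c) n * \<beta> c ^ n) \<in> pn_order (n * 2)"
        by (rule pn_order_mult[OF ordF pn_order_power[OF \<beta>]]) simp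
      then show "(\<lambda>c. fps_nth (F c) n * \<beta> c ^ n) \<in> pn_order 3"
        using n by (elim pn_order_mono) simp
    qed
    have diff: "fps_partial_eval N (F c) (\<beta> c)
        - (metric_2PN G m1 m2 y1 y2 c x i j + pd i (\<lambda>z. \<xi> c z $ j) x + pd j (\<lambda>z. \<xi> c z $ i) x)
        = t0 c + t1 c * \<beta> c + t2 c" if c: "0 < c" for c
    proof -
      have pd\<xi>: "pd k (\<lambda>z. \<xi> c z $ l) x = 1 / c^4 * pd k (\<lambda>z. \<zeta> z $ l) x" for k l
        unfolding \<xi>_def vector_scaleR_component real_scaleR_def
        by (rule pd_cmult[OF smooth_on_differentiable[OF sm\<zeta> open_Compl_pair x]])
      have "K * (1 + 4 * p * (1 / c\<^sup>2) + (4 * q + 6 * p\<^sup>2) * (1 / c\<^sup>2)\<^sup>2) + (s + 4 * sg * K) * \<beta> c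
          = metric_2PN G m1 m2 y1 y2 c x i j + 1 / c^4 * (pd i (\<lambda>z. \<zeta> z $ j) x + pd j (\<lambda>z. \<zeta> z $ i) x)"
        unfolding K_def s_def sg_def assms(10) p_def q_def rs r_def \<zeta>_def
        by (rule metric_2PN_matching) (use x' assms(1) c in auto)
      then have metric: "metric_2PN G m1 m2 y1 y2 c x i j + pd i (\<lambda>z. \<xi> c z $ j) x + pd j (\<lambda>z. \<xi> c z $ i) x
          = K * (1 + 4 * p * (1 / c\<^sup>2) + (4 * q + 6 * p\<^sup>2) * (1 / c\<^sup>2)\<^sup>2) + (s + 4 * sg * K) * \<beta> c"
        unfolding pd\<xi> by (simp add: distrib_left)
      \<comment> \<open>Here \<open>N \<ge> 1\<close> enters: the partial sum must contain the
        first-order term, which is of the same order 1/c^4 as the quantities compared.\<close>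
      have "{..N} = insert 0 (insert 1 {2..N})" using N by auto
      then have "fps_partial_eval N (F c) (\<beta> c) = fps_nth (F c) 0 + fps_nth (F c) 1 * \<beta> c + t2 c"
        by (simp add: fps_partial_eval_def t2_def)
      then have eval: "fps_partial_eval N (F c) (\<beta> c) = K * (1 + w c) ^ 4
          + ((1 + w c) ^ 4 * s + 4 * K * ((1 + w c) ^ 3 * fps_nth (\<Psi> c) 1)) * \<beta> c + t2 c"
        unfolding F0 F1 .
      have "fps_nth (\<Psi> c) 1 = sg + (\<alpha>1 c * (\<sigma> 1 0 1 x - \<sigma> 0 0 1 x) + \<alpha>2 c * (\<sigma> 0 1 1 x - \<sigma> 0 0 1 x))"
        using \<Psi>n[of 1 c] sg by simp
      then have d: "\<alpha>1 c * (\<sigma> 1 0 1 x - \<sigma> 0 0 1 x) + \<alpha>2 c * (\<sigma> 0 1 1 x - \<sigma> 0 0 1 x) = fps_nth (\<Psi> c) 1 - sg"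
        by simp
      show ?thesis
        unfolding eval metric t0_def t1_def d by (simp only: ring_distribs) (simp add: mult_ac)
    qed
    have "(\<lambda>c. t0 c + t1 c * \<beta> c + t2 c) \<in> pn_order 3"
      by (intro pn_order_add t0 t1 t2)
    moreover have "\<forall>\<^sub>F c in at_top. t0 c + t1 c * \<beta> c + t2 c = fps_partial_eval N (F c) (\<beta> c)
        - (metric_2PN G m1 m2 y1 y2 c x i j + pd i (\<lambda>z. \<xi> c z $ j) x + pd j (\<lambda>z. \<xi> c z $ i) x)"
      using eventually_gt_at_top[of 0] by eventually_elim (simp only: diff)
    ultimately have "(\<lambda>c. fps_partial_eval N (F c) (\<beta> c)
        - (metric_2PN G m1 m2 y1 y2 c x i j + pd i (\<lambda>z. \<xi> c z $ j) x + pd j (\<lambda>z. \<xi> c z $ i) x)) \<in> pn_order 3"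
      unfolding pn_order_def by (subst (asm) landau_o.big.in_cong)
    moreover have "gamma_series y1 y2 (\<alpha>1 c) (\<alpha>2 c) (\<sigma> (\<alpha>1 c) (\<alpha>2 c)) x $ i $ j = F c" for c
      by (simp add: gamma_series_def F_def \<Psi>_def)
    ultimately show ?thesis by (simp only:)
  qed
  show ?thesis
    unfolding O6 by (intro exI[of _ \<xi>] exI[of _ \<zeta>] conjI allI ballI impI sm\<zeta> main) (simp_all add: \<xi>_def)
qed

end
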